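(* Let $\{(X_t,Z_t)\}_{t\in\mathbb Z}$ be a stationary $(1+d)$-dimensional time series with $X_t=\varphi(Z_t)+h(Z_t)\eta_t$ for some $\varphi:\mathbb R^d\to\mathbb R$ and $h:\mathbb R^d\to\mathbb R^+$, where the time series $\{Z_t\}$ and $\{\eta_t\}$ are independent of each other and $\mathbb E(X_t|Z_t=z)=\varphi(z)$. Suppose $\{Z_t\}$ is 2-mixing with size $\mathfrak v$ and the autocovariance of $\{\eta_t\}$ has size $\mathfrak u$. Let $f$ be the density of $Z_t$ and $g=\varphi\cdot f$. Suppose: (i) for some $p>2$ the functions $h^2\cdot f$ and $|\varphi|^p\cdot f$ are uniformly bounded; put $q:=1-2/p\in(0,1)$; (ii) for $t\ne\tau$ let $f^{(t,\tau)}$ be the joint density of $(Z_t,Z_\tau)$, $g^{(t,\tau)}(z_1,z_2):=\mathbb E[X_tX_\tau|Z_t=z_1,Z_\tau=z_2]\,f^{(t,\tau)}(z_1,z_2)$, $F^{(t,\tau)}:=f^{(t,\tau)}-f\otimes f$ and $G^{(t,\tau)}:=g^{(t,\tau)}-g\otimes g$; the norms $\|F^{(t,\tau)}\|_{p_F}$ and $\|G^{(t,\tau)}\|_{p_G}$ are bounded uniformly in $t,\tau$ for some $p_F,p_G>2$; put $q_F:=1-2/p_F$, $q_G:=1-2/p_G$, $q_{FG}:=q_F\wedge q_G\in(0,1)$; (iii) $K$ is a multiplicative kernel on $\mathbb R^d$ of order $r$ with finite first and $p$-th moment; (iv) $\varphi\cdot f$ and $f$ belong to $\mathfrak G^d_{s,\triangle}$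 for some $\triangle,s>0$, and $f$ is bounded away from zero; put $\rho=r\wedge s$. Let $\hat\varphi(z)=\hat g(z)/\hat f(z)$ with $\hat g(z)=\frac1T\sum_{t=1}^TX_tK_b(Z_t-z)$ and $\hat f(z)=\frac1T\sum_{t=1}^TK_b(Z_t-z)$, where $b>0$ is a bandwidth. Then for all $z\in\mathbb R^d$ $$|\hat\varphi(z)-\varphi(z)|^2=O_P\Bigl(b^{2\rho}+b^{-d}\cdot T^{-(\mathfrak u\wedge1)}+b^{-d(1+q+q_{FG}(1-[(q\mathfrak v)\vee1]))}\cdot T^{-[(q\mathfrak v)\wedge1]}\Bigr),\quad T\to\infty.$$
   Context: $\wedge$ is minimum, $\vee$ is maximum, $(f\otimes g)(x,y)=f(x)g(y)$, $\|g\|_p=(\int|g|^p)^{1/p}$, and $K_b(z)=b^{-d}K(z/b)$. All densities mentioned are assumed to exist. "$K$ has finite first and $p$-th moment" means $\|K\|_1<\infty$ and $\|K\|_p<\infty$. 2-mixing: $\{Z_t\}$ is 2-mixing with size $\mathfrak v$ if there is $C<\infty$, independent of $t,\tau$, such that for all $t\ne\tau$, $\sup_{A\in\sigma(Z_t),B\in\sigma(Z_\tau)}|P(A\cap B)-P(A)P(B)|\le C|t-\tau|^{-\mathfrak v}$. The covariance of a stationary process $\{\eta_t\}$ has size $\mathfrak u$ if there is $C<\infty$, independent of $t,\tau$, with $|\mathrm{cov}(\eta_t,\eta_\tau)|\le C|t-\tau|^{-\mathfrak u}$ for all $t\ne\tau$. Multiplicative kernel of order $r$: $K(w)=\prod_{i=1}^d\ell(w_i)$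 with $\ell$ a univariate even function satisfying $\int\ell(u)\,du=1$, $\int u^i\ell(u)\,du=0$ for $i=1,\dots,r-1$, and $[\int|u|^r\ell(u)\,du]^d=S_K$ for a constant $S_K$. Class $\mathfrak G^d_{s,\triangle}$ ($s,\triangle>0$, $\triangle$ finite): functions $g:\mathbb R^d\to\mathbb R$ that are everywhere $(m-1)$-times partially differentiable for $m-1<s\le m$ ($m$ an integer), and such that for some $\varrho>0$ and for all $x$, $\sup_{y:|y-x|<\varrho}\frac{|g(y)-g(x)-Q(y-x)|}{|y-x|^s}\le\triangle$, where $Q=0$ if $m=1$ and, for $m>1$, $Q$ is an $(m-1)$th-degree homogeneous polynomial in $y-x$ whose coefficients are the partial derivatives of $g$ of orders $1$ to $m-1$ evaluated at $x$.
   Formalization: No density on R^d is bounded away from zero, so f is bounded below only on an arbitrary set D and the rate holds for z in D; the bandwidth b=b(T) is also required to make the bound inside O_P tend to 0, as a fixed b with a signed kernel can otherwise break the claim. *)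

theory Defs
  imports "HOL-Probability.Probability"
begin

definition stationary_process :: "'w measure \<Rightarrow> (int \<Rightarrow> 'w \<Rightarrow> 'b::topological_space) \<Rightarrow> bool" where
  "stationary_process M Y \<longleftrightarrow>
     (\<forall>t. Y t \<in> borel_measurable M) \<and>
     (\<forall>J k. finite J \<longrightarrow>
        distr M (PiM J (\<lambda>_. borel)) (\<lambda>\<omega>. \<lambda>t\<in>J. Y (t + k) \<omega>) =
        distr M (PiM J (\<lambda>_. borel)) (\<lambda>\<omega>. \<lambda>t\<in>J. Y t \<omega>))"

definition rv_sigma :: "'w measure \<Rightarrow> ('w \<Rightarrow> 'b::topological_space) \<Rightarrow> 'w measure" where
  "rv_sigma M W = vimage_algebra (space M) W borel"

definition process_sigma :: "'w measure \<Rightarrow> (int \<Rightarrow> 'w \<Rightarrow> 'b::topological_space) \<Rightarrow> 'w measure" where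
  "process_sigma M Y = vimage_algebra (space M) (\<lambda>\<omega> t. Y t \<omega>) (PiM UNIV (\<lambda>_. borel))"

text \<open>The library constant \<^const>\<open>prob_space.indep_var\<close> forces both variables to have the same
  type, hence the formulation through the generated sigma-algebras.\<close>

definition indep_processes ::
    "'w measure \<Rightarrow> (int \<Rightarrow> 'w \<Rightarrow> 'b::topological_space) \<Rightarrow> (int \<Rightarrow> 'w \<Rightarrow> 'c::topological_space) \<Rightarrow> bool" where
  "indep_processes M Y W \<longleftrightarrow>
     prob_space.indep_set M (sets (process_sigma M Y)) (sets (process_sigma M W))"

definition two_mixing :: "'w measure \<Rightarrow> (int \<Rightarrow> 'w \<Rightarrow> 'b::topological_space) \<Rightarrow> real \<Rightarrow> bool" where
  "two_mixing M Z v \<longleftrightarrow>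
     (\<exists>C::real. \<forall>t \<tau>. t \<noteq> \<tau> \<longrightarrow>
        (\<forall>A \<in> sets (rv_sigma M (Z t)). \<forall>B \<in> sets (rv_sigma M (Z \<tau>)).
           \<bar>measure M (A \<inter> B) - measure M A * measure M B\<bar> \<le> C * real_of_int \<bar>t - \<tau>\<bar> powr (- v)))"

definition covar :: "'w measure \<Rightarrow> ('w \<Rightarrow> real) \<Rightarrow> ('w \<Rightarrow> real) \<Rightarrow> real" where
  "covar M Y W =
     (\<integral>\<omega>. (Y \<omega> - (\<integral>\<omega>'. Y \<omega>' \<partial>M)) * (W \<omega> - (\<integral>\<omega>'. W \<omega>' \<partial>M)) \<partial>M)"

definition autocov_size :: "'w measure \<Rightarrow> (int \<Rightarrow> 'w \<Rightarrow> real) \<Rightarrow> real \<Rightarrow> bool" where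
  "autocov_size M \<eta> u \<longleftrightarrow>
     stationary_process M \<eta> \<and>
     (\<forall>t. integrable M (\<lambda>\<omega>. (\<eta> t \<omega>)\<^sup>2)) \<and>
     (\<exists>C::real. \<forall>t \<tau>. t \<noteq> \<tau> \<longrightarrow>
        \<bar>covar M (\<eta> t) (\<eta> \<tau>)\<bar> \<le> C * real_of_int \<bar>t - \<tau>\<bar> powr (- u))"

text \<open>\<open>cond_mean_fun M Y W m\<close> says that \<open>E[Y | W = w] = m w\<close>; such an \<open>m\<close> is determined up to
  null sets of the law of \<open>W\<close>.\<close>

definition cond_mean_fun ::
    "'w measure \<Rightarrow> ('w \<Rightarrow> real) \<Rightarrow> ('w \<Rightarrow> 'b::topological_space) \<Rightarrow> ('b \<Rightarrow> real) \<Rightarrow> bool" where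
  "cond_mean_fun M Y W m \<longleftrightarrow>
     integrable M Y \<and> m \<in> borel_measurable borel \<and>
     (AE \<omega> in M. real_cond_exp M (rv_sigma M W) Y \<omega> = m (W \<omega>))"

definition has_density :: "'w measure \<Rightarrow> ('w \<Rightarrow> 'b::euclidean_space) \<Rightarrow> ('b \<Rightarrow> real) \<Rightarrow> bool" where
  "has_density M W f \<longleftrightarrow>
     f \<in> borel_measurable borel \<and> (\<forall>x. 0 \<le> f x) \<and> distributed M lborel W (\<lambda>x. ennreal (f x))"

definition bigO_P :: "'w measure \<Rightarrow> (nat \<Rightarrow> 'w \<Rightarrow> real) \<Rightarrow> (nat \<Rightarrow> real) \<Rightarrow> bool" where
  "bigO_P M Y a \<longleftrightarrow>
     (\<forall>\<epsilon>>0. \<exists>C>0. \<forall>\<^sub>F T in sequentially.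
        measure M {\<omega> \<in> space M. \<bar>Y T \<omega>\<bar> > C * a T} < \<epsilon>)"

definition in_Lp :: "real \<Rightarrow> ('b::euclidean_space \<Rightarrow> real) \<Rightarrow> bool" where
  "in_Lp p g \<longleftrightarrow> g \<in> borel_measurable borel \<and> integrable lborel (\<lambda>x. \<bar>g x\<bar> powr p)"

text \<open>Meaningful only together with \<^const>\<open>in_Lp\<close>, as the integral is 0 when it diverges.\<close>

definition Lp_norm :: "real \<Rightarrow> ('b::euclidean_space \<Rightarrow> real) \<Rightarrow> real" where
  "Lp_norm p g = (\<integral>x. \<bar>g x\<bar> powr p \<partial>lborel) powr (1 / p)"

definition tensor :: "('b \<Rightarrow> real) \<Rightarrow> ('c \<Rightarrow> real) \<Rightarrow> 'b \<times> 'c \<Rightarrow> real" where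
  "tensor g1 g2 = (\<lambda>(x, y). g1 x * g2 y)"

definition uniformly_bounded :: "('b \<Rightarrow> real) \<Rightarrow> bool" where
  "uniformly_bounded g \<longleftrightarrow> (\<exists>C. \<forall>x. \<bar>g x\<bar> \<le> C)"

fun iterated_partial :: "'d list \<Rightarrow> (real ^ 'd \<Rightarrow> real) \<Rightarrow> real ^ 'd \<Rightarrow> real" where
  "iterated_partial [] g = g"
| "iterated_partial (i # is) g =
     (\<lambda>x. deriv (\<lambda>t. iterated_partial is g (x + t *\<^sub>R axis i 1)) 0)"

definition partially_differentiable :: "nat \<Rightarrow> (real ^ 'd \<Rightarrow> real) \<Rightarrow> bool" where
  "partially_differentiable n g \<longleftrightarrow>
     (\<forall>is i x. length is < n \<longrightarrow>
        (\<lambda>t. iterated_partial is g (x + t *\<^sub>R axis i 1)) field_differentiable (at 0))"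

text \<open>The Taylor polynomial without its constant term. Summing over index lists of length \<open>k\<close>
  with weight \<open>1 / k!\<close> is the same as summing over multi-indices \<open>\<alpha>\<close> with weight \<open>1 / \<alpha>!\<close>.\<close>

definition taylor_poly :: "nat \<Rightarrow> (real ^ 'd \<Rightarrow> real) \<Rightarrow> real ^ 'd \<Rightarrow> real ^ 'd \<Rightarrow> real" where
  "taylor_poly n g x u =
     (\<Sum>k=1..n. (\<Sum>is | length is = k. iterated_partial is g x * prod_list (map (\<lambda>i. u $ i) is)) / fact k)"

text \<open>For \<open>y = x\<close> the quotient below is \<open>0 / 0 = 0\<close>, so that this point imposes nothing.\<close>

definition smooth_class :: "real \<Rightarrow> real \<Rightarrow> (real ^ 'd \<Rightarrow> real) set" where
  "smooth_class s \<Delta> =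
     {g. \<exists>m::nat. real m - 1 < s \<and> s \<le> real m \<and>
         partially_differentiable (m - 1) g \<and>
         (\<exists>\<delta>>0. \<forall>x y. norm (y - x) < \<delta> \<longrightarrow>
            \<bar>g y - g x - taylor_poly (m - 1) g x (y - x)\<bar> / norm (y - x) powr s \<le> \<Delta>)}"

definition multiplicative_kernel :: "nat \<Rightarrow> real \<Rightarrow> (real ^ 'd \<Rightarrow> real) \<Rightarrow> bool" where
  "multiplicative_kernel r S K \<longleftrightarrow> 1 \<le> r \<and>
     (\<exists>l :: real \<Rightarrow> real. K = (\<lambda>w. \<Prod>i\<in>UNIV. l (w $ i)) \<and>
        (\<forall>u. l (- u) = l u) \<and>
        has_bochner_integral lborel l 1 \<and>
        (\<forall>i\<in>{1..<r}. has_bochner_integral lborel (\<lambda>u. u ^ i * l u) 0) \<and>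
        integrable lborel (\<lambda>u. \<bar>u\<bar> ^ r * l u) \<and>
        (\<integral>u. \<bar>u\<bar> ^ r * l u \<partial>lborel) ^ CARD('d) = S)"

definition scaled_kernel :: "(real ^ 'd \<Rightarrow> real) \<Rightarrow> real \<Rightarrow> real ^ 'd \<Rightarrow> real" where
  "scaled_kernel K b z = K (z /\<^sub>R b) / b ^ CARD('d)"

definition f_hat ::
    "(real ^ 'd \<Rightarrow> real) \<Rightarrow> (int \<Rightarrow> 'w \<Rightarrow> real ^ 'd) \<Rightarrow> real \<Rightarrow> nat \<Rightarrow> real ^ 'd \<Rightarrow> 'w \<Rightarrow> real" where
  "f_hat K Z b T z \<omega> = (\<Sum>t=1..T. scaled_kernel K b (Z (int t) \<omega> - z)) / real T"

definition g_hat ::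
    "(real ^ 'd \<Rightarrow> real) \<Rightarrow> (int \<Rightarrow> 'w \<Rightarrow> real) \<Rightarrow> (int \<Rightarrow> 'w \<Rightarrow> real ^ 'd) \<Rightarrow> real \<Rightarrow> nat \<Rightarrow>
       real ^ 'd \<Rightarrow> 'w \<Rightarrow> real" where
  "g_hat K X Z b T z \<omega> =
     (\<Sum>t=1..T. X (int t) \<omega> * scaled_kernel K b (Z (int t) \<omega> - z)) / real T"

definition phi_hat ::
    "(real ^ 'd \<Rightarrow> real) \<Rightarrow> (int \<Rightarrow> 'w \<Rightarrow> real) \<Rightarrow> (int \<Rightarrow> 'w \<Rightarrow> real ^ 'd) \<Rightarrow> real \<Rightarrow> nat \<Rightarrow>
       real ^ 'd \<Rightarrow> 'w \<Rightarrow> real" where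
  "phi_hat K X Z b T z \<omega> = g_hat K X Z b T z \<omega> / f_hat K Z b T z \<omega>"

end

theory Submission
  imports Defs
begin

text \<open>Fix \<open>z\<close> with \<open>f z > 0\<close>. Since
\<open>f_hat * (phi_hat - \<phi> z) = (g_hat - g z) - \<phi> z * (f_hat - f z)\<close>, it is enough to show that
\<open>f_hat - f z\<close> and \<open>g_hat - g z\<close> are bounded by a multiple of \<open>sqrt R\<close> in mean: then \<open>f_hat\<close> stays
above \<open>f z / 2\<close> with probability tending to one, because \<open>R\<close> tends to \<open>0\<close>, and Markov's inequality
finishes the proof (\<open>bigO_P_square_ratio\<close>). As \<open>X = \<phi>(Z) + h(Z) \<eta>\<close>, three averages have to be
controlled: \<open>f_hat\<close>, the average of \<open>\<phi>(Z) K_b(Z - z)\<close> and the noise average of \<open>h(Z) \<eta> K_b(Z - z)\<close>;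
see \<open>kernel_mean_L1_rate\<close> and \<open>kernel_noise_L1_rate\<close>.

Bias. The order of the kernel removes the Taylor terms of degree below \<open>r\<close>, so the means are off by
\<open>b\<^sup>\<rho>\<close> (\<open>smooth_class_kernel_bias\<close>). This uses that a density in the smoothness class is bounded
(\<open>smooth_class_integrable_imp_bounded\<close>).

Localisation. Choose a ball around \<open>z\<close> on which \<open>f \<ge> f z / 2\<close>. There \<open>\<phi>\<close> and \<open>h\<close> are bounded. Outside
it, where they may be unbounded, no variance is computed: \<open>\<phi> f\<close> and \<open>h f\<close> are bounded everywhere, so the
contribution of the complement is in mean at most a multiple of the tail integral of \<open>K\<close>, which is
again of order \<open>b\<^sup>\<rho>\<close>.

Variance. Write \<open>d\<close> for the dimension, \<open>k\<close> for the lag and \<open>u\<close> for the localised weight. Inside the ball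
a covariance at lag \<open>k\<close> is the bilinear form \<open>\<integral>\<integral> u(x) u(y) F(x, y)\<close>. Hoelder's inequality and the \<open>L\<^sup>p\<close> bound
on \<open>F\<close> give \<open>b powr (- d (1 - q\<^sub>F))\<close>. The classical covariance inequality of Davydov for mixing
variables would give \<open>b powr (- d (1 + q)) * k powr (- q v)\<close>; summed over the lags this produces a
factor \<open>ln T\<close> when \<open>q v = 1\<close>, and no such factor is present in \<open>R\<close>. Instead the kernel is cut into its level
sets \<open>2\<^sup>i \<le> |K| \<le> 2\<^sup>i\<^sup>+\<^sup>1\<close>, and each pair of pieces is estimated by a geometric mean of the mixing bound and the
Hoelder bound. The pieces sum up to \<open>b powr (- d (1 + q - (1 - q) q\<^sub>F)) * k powr (- q v)\<close>
(\<open>mixing_interpolation\<close>, \<open>bilinear_form_bounds\<close>): the same decay in \<open>k\<close>, at a smaller cost in \<open>b\<close>. For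
the noise the covariance of \<open>\<eta>\<close> is multiplied by \<open>E |u(Z\<^sub>t) u(Z\<^sub>s)|\<close>, which by the Hoelder bound for \<open>F\<close> is of order
\<open>b powr (- d (1 - q\<^sub>F))\<close> and not merely \<open>b powr (- d)\<close>.

In both cases a positive power \<open>\<epsilon>\<close> of \<open>b\<close> is left over. It pays for the logarithm: \<open>ln T\<close> is dominated by
\<open>T powr \<kappa>\<close>, and \<open>b powr (- E + \<epsilon>) * T powr (\<kappa> - 1)\<close> is for small \<open>\<kappa>\<close> at most a geometric mean of \<open>b powr (- E) / T\<close> and
\<open>b powr (2 \<rho>)\<close>, that is, of two terms of \<open>R\<close> (\<open>weighted_sum_rate\<close>).\<close>

section \<open>Sums of powers and integral inequalities\<close>

text \<open>For \<open>e \<le> 0\<close> every term is at most the last one. For \<open>0 < e < 1\<close> use induction on \<open>n\<close>: the increment of \<open>n powr (1 - e) / (1 - e)\<close> dominates \<open>n powr (- e)\<close> because \<open>x powr (1 - e)\<close> is concave; the tangent inequality at \<open>1\<close> is an instance of Young's inequality.\<close>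

lemma sum_powr_le:
  fixes e :: real
  assumes "e < 1"
  shows "\<exists>C\<ge>0. \<forall>n::nat. (\<Sum>k=1..n. real k powr (-e)) \<le> C * real n powr (1 - e)"
proof (cases "e \<le> 0")
  case True
  have "(\<Sum>k=1..n. real k powr (-e)) \<le> 1 * real n powr (1 - e)" for n :: nat
  proof (cases "n = 0")
    case False
    have "(\<Sum>k=1..n. real k powr (-e)) \<le> (\<Sum>k=1..n. real n powr (-e))"
      using True by (intro sum_mono powr_mono2) auto
    also have "\<dots> = real n powr (1 - e)"
      using False by (simp add: powr_diff powr_minus divide_inverse)
    finally show ?thesis by simp
  qed simp
  then show ?thesis by (intro exI[of _ 1]) auto
next
  case False
  have "(\<Sum>k=1..n. real k powr (-e)) \<le> (1 / (1 - e)) * real n powr (1 - e)" for n :: nat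
  proof (induction n)
    case (Suc n)
    let ?y = "real (Suc n)" and ?x = "real n / real (Suc n)"
    have x: "?x powr (1 - e) \<le> e + (1 - e) * ?x"
    proof (cases "n = 0")
      case False
      then show ?thesis
        using Youngs_inequality_0[of e "1 - e" 1 ?x] \<open>\<not> e \<le> 0\<close> assms by simp
    qed (use False in simp)
    have y0: "?y > 0" by simp
    have "real n powr (1 - e) = ?y powr (1 - e) * ?x powr (1 - e)"
      using y0 by (subst powr_mult[symmetric]) auto
    also have "\<dots> \<le> ?y powr (1 - e) * (e + (1 - e) * ?x)"
      using x by (intro mult_left_mono) auto
    also have "e + (1 - e) * ?x = 1 - (1 - e) / ?y"
      by (simp add: field_simps)
    also have "?y powr (1 - e) * (1 - (1 - e) / ?y) = ?y powr (1 - e) - (1 - e) * ?y powr (-e)"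
    proof -
      have "?y powr (1 - e) = ?y * ?y powr (-e)"
        using y0 by (simp add: powr_diff powr_minus divide_inverse)
      then show ?thesis using y0 by (simp add: field_simps)
    qed
    finally have "?y powr (-e) \<le> (?y powr (1 - e) - real n powr (1 - e)) / (1 - e)"
      using assms by (subst pos_le_divide_eq) (auto simp: mult.commute)
    with Suc show ?case by (simp add: diff_divide_distrib)
  qed simp
  then show ?thesis using assms by (intro exI[of _ "1 / (1 - e)"]) auto
qed

text \<open>Young's inequality is applied pointwise, to \<open>f\<close> and \<open>g\<close> divided by their norms.\<close>

lemma
  fixes f g :: "'a \<Rightarrow> real" and p q :: real
  assumes pq: "p > 1" "q > 1" "1/p + 1/q = 1"
    and f [measurable]: "f \<in> borel_measurable M" and fp: "integrable M (\<lambda>x. \<bar>f x\<bar> powr p)"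
    and g [measurable]: "g \<in> borel_measurable M" and gq: "integrable M (\<lambda>x. \<bar>g x\<bar> powr q)"
  shows Holder_integrable: "integrable M (\<lambda>x. f x * g x)"
    and Holder_inequality: "\<bar>\<integral>x. f x * g x \<partial>M\<bar> \<le>
      (\<integral>x. \<bar>f x\<bar> powr p \<partial>M) powr (1/p) * (\<integral>x. \<bar>g x\<bar> powr q \<partial>M) powr (1/q)"
proof -
  have int: "integrable M (\<lambda>x. \<bar>f x\<bar> powr p / p + \<bar>g x\<bar> powr q / q)"
    using fp gq by auto
  show fg: "integrable M (\<lambda>x. f x * g x)"
    using int
  proof (rule Bochner_Integration.integrable_bound)
    show "AE x in M. norm (f x * g x) \<le> norm (\<bar>f x\<bar> powr p / p + \<bar>g x\<bar> powr q / q)"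
    proof (rule AE_I2)
      fix x
      have "\<bar>f x\<bar> * \<bar>g x\<bar> \<le> \<bar>f x\<bar> powr p / p + \<bar>g x\<bar> powr q / q"
        using pq by (intro Youngs_inequality) auto
      then show "norm (f x * g x) \<le> norm (\<bar>f x\<bar> powr p / p + \<bar>g x\<bar> powr q / q)"
        by (simp add: abs_mult)
    qed
  qed measurable
  let ?A = "\<integral>x. \<bar>f x\<bar> powr p \<partial>M" and ?B = "\<integral>x. \<bar>g x\<bar> powr q \<partial>M"
  have A0: "?A \<ge> 0" and B0: "?B \<ge> 0" by auto
  show "\<bar>\<integral>x. f x * g x \<partial>M\<bar> \<le> ?A powr (1/p) * ?B powr (1/q)"
  proof (cases "?A = 0 \<or> ?B = 0")
    case True
    then have "AE x in M. f x * g x = 0"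
    proof
      assume "?A = 0"
      then have "AE x in M. \<bar>f x\<bar> powr p = 0"
        using fp by (subst (asm) integral_nonneg_eq_0_iff_AE) auto
      then show ?thesis by eventually_elim auto
    next
      assume "?B = 0"
      then have "AE x in M. \<bar>g x\<bar> powr q = 0"
        using gq by (subst (asm) integral_nonneg_eq_0_iff_AE) auto
      then show ?thesis by eventually_elim auto
    qed
    then have "(\<integral>x. f x * g x \<partial>M) = (\<integral>x. 0 \<partial>M)"
      by (intro integral_cong_AE) auto
    then show ?thesis by simp
  next
    case False
    define a where "a = ?A powr (1/p)"
    define b where "b = ?B powr (1/q)"
    have ab: "a > 0" "b > 0" using False by (auto simp: a_def b_def)
    have ap: "a powr p = ?A" and bq: "b powr q = ?B"
      using pq A0 B0 by (auto simp: a_def b_def powr_powr)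
    have "\<bar>\<integral>x. f x * g x \<partial>M\<bar> / (a * b) \<le> (\<integral>x. \<bar>f x * g x\<bar> \<partial>M) / (a * b)"
      using ab by (intro divide_right_mono integral_abs_bound) auto
    also have "\<dots> = (\<integral>x. \<bar>f x * g x\<bar> / (a * b) \<partial>M)" by simp
    also have "\<dots> \<le> (\<integral>x. (\<bar>f x\<bar> powr p / ?A) / p + (\<bar>g x\<bar> powr q / ?B) / q \<partial>M)"
    proof (rule integral_mono)
      fix x
      have "(\<bar>f x\<bar> / a) * (\<bar>g x\<bar> / b) \<le> (\<bar>f x\<bar> / a) powr p / p + (\<bar>g x\<bar> / b) powr q / q"
        using pq ab by (intro Youngs_inequality) auto
      then show "\<bar>f x * g x\<bar> / (a * b) \<le> (\<bar>f x\<bar> powr p / ?A) / p + (\<bar>g x\<bar> powr q / ?B) / q"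
        using ab by (simp add: abs_mult powr_divide ap bq)
    qed (use fg fp gq in auto)
    also have "\<dots> = 1/p + 1/q"
      using fp gq False by (subst Bochner_Integration.integral_add) auto
    finally show ?thesis using pq ab by (simp add: a_def b_def)
  qed
qed

lemma borel_measurable_fst_snd [measurable]:
  "(fst :: 'a::second_countable_topology \<times> 'b::second_countable_topology \<Rightarrow> 'a) \<in> borel_measurable borel"
  "(snd :: 'a::second_countable_topology \<times> 'b::second_countable_topology \<Rightarrow> 'b) \<in> borel_measurable borel"
  by (simp_all add: borel_prod[symmetric])

lemma
  fixes f :: "'a::euclidean_space \<Rightarrow> real" and g :: "'b::euclidean_space \<Rightarrow> real"
  assumes f: "integrable lborel f" and g: "integrable lborel g"
  shows integrable_tensor: "integrable lborel (\<lambda>z. f (fst z) * g (snd z))"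
    and integral_tensor: "(LBINT z. f (fst z) * g (snd z)) =
      (LBINT x. f x) * (LBINT x. g x)"
proof -
  have [measurable]: "f \<in> borel_measurable borel" "g \<in> borel_measurable borel"
    using f g by (auto dest: borel_measurable_integrable)
  have i: "integrable (lborel \<Otimes>\<^sub>M lborel) (\<lambda>z. f (fst z) * g (snd z))"
    using f g by (intro lborel_pair.Fubini_integrable) (auto simp: abs_mult)
  then show "integrable lborel (\<lambda>z. f (fst z) * g (snd z))"
    by (simp add: lborel_prod)
  show "(LBINT z. f (fst z) * g (snd z)) = (LBINT x. f x) * (LBINT x. g x)"
    using lborel_pair.integral_fst'[OF i] by (simp add: lborel_prod)
qed

text \<open>Integrating out the second variable turns the form into \<open>\<integral> u H\<close>, which for \<open>|u| \<le> A\<close> is at most \<open>A * \<integral> |H|\<close>; the sign of \<open>H\<close> is \<open>1\<close> on \<open>S\<close> and \<open>-1\<close> on its complement. So in a bilinear form each bounded argument can be replaced by a sign function.\<close>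

lemma bounded_bilinear_form_fst:
  fixes F :: "'a::euclidean_space \<times> 'b::euclidean_space \<Rightarrow> real"
  assumes F: "integrable lborel F"
    and u [measurable]: "u \<in> borel_measurable borel" and uA: "\<And>x. \<bar>u x\<bar> \<le> A"
    and v [measurable]: "v \<in> borel_measurable borel" and vB: "\<And>x. \<bar>v x\<bar> \<le> B"
  shows "\<exists>S\<in>sets borel. \<bar>LBINT z. u (fst z) * v (snd z) * F z\<bar> \<le>
    A * (LBINT z. (indicator S (fst z) - indicator (- S) (fst z)) * v (snd z) * F z)"
proof -
  have [measurable]: "F \<in> borel_measurable borel"
    using F by (auto dest: borel_measurable_integrable)
  have intv: "integrable lborel (\<lambda>z. v (snd z) * F z)"
  proof (rule Bochner_Integration.integrable_bound[of _ "\<lambda>z. B * F z"])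
    show "AE z in lborel. norm (v (snd z) * F z) \<le> norm (B * F z)"
    proof (rule AE_I2)
      fix z :: "'a \<times> 'b"
      have "\<bar>v (snd z)\<bar> * \<bar>F z\<bar> \<le> \<bar>B\<bar> * \<bar>F z\<bar>"
        using vB[of "snd z"] by (intro mult_right_mono) auto
      then show "norm (v (snd z) * F z) \<le> norm (B * F z)"
        by (simp add: abs_mult)
    qed
  qed (use F in auto)
  have bnd: "integrable lborel (\<lambda>z. w (fst z) * v (snd z) * F z) \<and>
      (LBINT z. w (fst z) * v (snd z) * F z) =
      (LBINT x. w x * (LBINT y. v y * F (x, y)))"
    if [measurable]: "w \<in> borel_measurable borel" and wA: "\<And>x. \<bar>w x\<bar> \<le> A'"
    for w :: "'a \<Rightarrow> real" and A'
  proof -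
    have i: "integrable lborel (\<lambda>z. w (fst z) * v (snd z) * F z)"
    proof (rule Bochner_Integration.integrable_bound[of _ "\<lambda>z. A' * (v (snd z) * F z)"])
      show "AE z in lborel. norm (w (fst z) * v (snd z) * F z) \<le> norm (A' * (v (snd z) * F z))"
      proof (rule AE_I2)
        fix z :: "'a \<times> 'b"
        have "\<bar>w (fst z)\<bar> * \<bar>v (snd z) * F z\<bar> \<le> \<bar>A'\<bar> * \<bar>v (snd z) * F z\<bar>"
          using wA[of "fst z"] by (intro mult_right_mono) auto
        then show "norm (w (fst z) * v (snd z) * F z) \<le> norm (A' * (v (snd z) * F z))"
          by (simp add: abs_mult mult.assoc)
      qed
    qed (use intv in auto)
    moreover have "(LBINT x. (LBINT y. w x * v y * F (x, y))) =
      (LBINT z. w (fst z) * v (snd z) * F z)"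
      using lborel_pair.integral_fst'[of "\<lambda>z. w (fst z) * v (snd z) * F z"] i
      by (simp add: lborel_prod)
    ultimately show ?thesis by (simp add: mult.assoc)
  qed
  define H where "H = (\<lambda>x. LBINT y. v y * F (x, y))"
  have intH: "integrable lborel H"
    unfolding H_def using lborel_pair.integrable_fst'[of "\<lambda>z. v (snd z) * F z"] intv
    by (simp add: lborel_prod)
  then have [measurable]: "H \<in> borel_measurable borel"
    by (auto dest: borel_measurable_integrable)
  define S where "S = {x. 0 \<le> H x}"
  have S [measurable]: "S \<in> sets borel"
    unfolding S_def by measurable
  have "\<bar>LBINT x. u x * H x\<bar> \<le> (LBINT x. \<bar>u x * H x\<bar>)" by (rule integral_abs_bound)
  also have "\<dots> \<le> (LBINT x. A * \<bar>H x\<bar>)"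
    using intH uA
    by (intro integral_mono' integrable_mult_right integrable_abs)
      (auto simp: abs_mult intro!: mult_right_mono mult_nonneg_nonneg intro: order_trans[OF abs_ge_zero])
  also have "\<dots> = A * (LBINT x. (indicator S x - indicator (- S) x) * H x)"
    by (subst integral_mult_right_zero)
      (intro arg_cong[where f="\<lambda>x. A * x"] Bochner_Integration.integral_cong, auto simp: S_def indicator_def)
  finally show ?thesis
    using bnd[of u A] bnd[of "\<lambda>x. indicator S x - indicator (- S) x" 1] uA S
    by (intro bexI[of _ S]) (auto simp: H_def indicator_def)
qed

lemma bounded_bilinear_form_snd:
  fixes F :: "'a::euclidean_space \<times> 'b::euclidean_space \<Rightarrow> real"
  assumes F: "integrable lborel F"
    and u [measurable]: "u \<in> borel_measurable borel" and uA: "\<And>x. \<bar>u x\<bar> \<le> A"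
    and v [measurable]: "v \<in> borel_measurable borel" and vB: "\<And>x. \<bar>v x\<bar> \<le> B"
  shows "\<exists>S\<in>sets borel. \<bar>LBINT z. u (fst z) * v (snd z) * F z\<bar> \<le>
    B * (LBINT z. u (fst z) * (indicator S (snd z) - indicator (- S) (snd z)) * F z)"
proof -
  have [measurable]: "F \<in> borel_measurable borel"
    using F by (auto dest: borel_measurable_integrable)
  have swap: "(LBINT z. G (snd z, fst z)) = (LBINT z. G z)"
    if "G \<in> borel_measurable borel" for G :: "'a \<times> 'b \<Rightarrow> real"
    using lborel_pair.integral_product_swap[of G] that
    by (simp add: lborel_prod case_prod_beta')
  have "integrable lborel (\<lambda>z. F (snd z, fst z))"
    using lborel_pair.integrable_product_swap[of F] F
    by (simp add: lborel_prod case_prod_beta')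
  from bounded_bilinear_form_fst[OF this v vB u uA] obtain S where [measurable]: "S \<in> sets borel"
    and S: "\<bar>LBINT z. v (fst z) * u (snd z) * F (snd z, fst z)\<bar> \<le>
     B * (LBINT z. (indicator S (fst z) - indicator (- S) (fst z)) * u (snd z) * F (snd z, fst z))"
    by auto
  have "(LBINT z. v (fst z) * u (snd z) * F (snd z, fst z)) =
      (LBINT z. u (fst z) * v (snd z) * F z)"
    by (subst swap[symmetric], measurable) (simp add: mult_ac)
  moreover have "(LBINT z. (indicator S (fst z) - indicator (- S) (fst z)) * u (snd z) * F (snd z, fst z))
     = (LBINT z. u (fst z) * (indicator S (snd z) - indicator (- S) (snd z)) * F z)"
    by (subst swap[symmetric], measurable) (simp add: mult_ac)
  ultimately show ?thesis using S by (intro bexI[of _ S]) auto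
qed

text \<open>After both arguments have been replaced by sign functions, the form is a signed sum over four rectangles, each of which is at most \<open>\<alpha>\<close>. With \<open>F\<close> the difference of a joint density and the product of its marginals this is the covariance inequality for bounded variables with mixing coefficient \<open>\<alpha>\<close>.\<close>

lemma bounded_bilinear_form_le:
  fixes F :: "'a::euclidean_space \<times> 'b::euclidean_space \<Rightarrow> real"
  assumes F: "integrable lborel F"
    and mix: "\<And>S S'. S \<in> sets borel \<Longrightarrow> S' \<in> sets borel \<Longrightarrow>
      \<bar>LBINT z. indicator S (fst z) * indicator S' (snd z) * F z\<bar> \<le> \<alpha>"
    and u: "u \<in> borel_measurable borel" and uA: "\<And>x. \<bar>u x\<bar> \<le> A"
    and v: "v \<in> borel_measurable borel" and vB: "\<And>x. \<bar>v x\<bar> \<le> B"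
  shows "\<bar>LBINT z. u (fst z) * v (snd z) * F z\<bar> \<le> 4 * \<alpha> * A * B"
proof -
  have [measurable]: "F \<in> borel_measurable borel"
    using F by (auto dest: borel_measurable_integrable)
  have AB: "A \<ge> 0" "B \<ge> 0"
    using uA[of undefined] vB[of undefined] by auto
  obtain S where S [measurable]: "S \<in> sets borel" and 1: "\<bar>LBINT z. u (fst z) * v (snd z) * F z\<bar> \<le>
    A * (LBINT z. (indicator S (fst z) - indicator (- S) (fst z)) * v (snd z) * F z)"
    using bounded_bilinear_form_fst[OF F u uA v vB] by blast
  have s1: "\<bar>indicator S x - indicator (- S) x\<bar> \<le> (1::real)" for x
    by (auto simp: indicator_def)
  have s2: "(\<lambda>x. indicator S x - indicator (- S) x :: real) \<in> borel_measurable borel"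
    by measurable
  obtain S' where S' [measurable]: "S' \<in> sets borel" and 2:
    "\<bar>LBINT z. (indicator S (fst z) - indicator (- S) (fst z)) * v (snd z) * F z\<bar> \<le>
    B * (LBINT z. (indicator S (fst z) - indicator (- S) (fst z)) *
       (indicator S' (snd z) - indicator (- S') (snd z)) * F z)"
    using bounded_bilinear_form_snd[OF F s2 s1 v vB] by auto
  have i: "integrable lborel (\<lambda>z. indicator P (fst z) * indicator Q (snd z) * F z)"
    if [measurable]: "P \<in> sets borel" "Q \<in> sets borel" for P Q
    using F by (rule Bochner_Integration.integrable_bound) (auto simp: indicator_def)
  have "(LBINT z. (indicator S (fst z) - indicator (- S) (fst z)) *
       (indicator S' (snd z) - indicator (- S') (snd z)) * F z) =
     (LBINT z. indicator S (fst z) * indicator S' (snd z) * F z)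
     - (LBINT z. indicator S (fst z) * indicator (- S') (snd z) * F z)
     - (LBINT z. indicator (- S) (fst z) * indicator S' (snd z) * F z)
     + (LBINT z. indicator (- S) (fst z) * indicator (- S') (snd z) * F z)"
    using i[OF S S'] i[OF S, of "- S'"] i[of "- S" S'] i[of "- S" "- S'"] S S'
    by (simp add: left_diff_distrib right_diff_distrib)
  also have "\<dots> \<le> 4 * \<alpha>"
    using mix[OF S S'] mix[OF S, of "- S'"] mix[of "- S" S'] mix[of "- S" "- S'"] S S'
    by (auto simp: abs_le_iff)
  finally have 3: "(LBINT z. (indicator S (fst z) - indicator (- S) (fst z)) *
       (indicator S' (snd z) - indicator (- S') (snd z)) * F z) \<le> 4 * \<alpha>" .
  have "A * (LBINT z. (indicator S (fst z) - indicator (- S) (fst z)) * v (snd z) * F z) \<le> A * (B * (4 * \<alpha>))"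
    using 2 3 AB by (intro mult_left_mono) (auto intro!: order_trans[OF _ mult_left_mono[OF 3]])
  with 1 show ?thesis by (simp add: mult_ac)
qed

lemma Holder_bilinear_form:
  fixes F :: "'a::euclidean_space \<times> 'b::euclidean_space \<Rightarrow> real" and P s :: real
  assumes Ps: "P > 1" "s > 1" "1/P + 1/s = 1"
    and F [measurable]: "F \<in> borel_measurable borel" and FP: "integrable lborel (\<lambda>z. \<bar>F z\<bar> powr P)"
    and u [measurable]: "u \<in> borel_measurable borel" and us: "integrable lborel (\<lambda>x. \<bar>u x\<bar> powr s)"
    and v [measurable]: "v \<in> borel_measurable borel" and vs: "integrable lborel (\<lambda>x. \<bar>v x\<bar> powr s)"
  shows "integrable lborel (\<lambda>z. u (fst z) * v (snd z) * F z)"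
    and "\<bar>LBINT z. u (fst z) * v (snd z) * F z\<bar> \<le>
      (LBINT z. \<bar>F z\<bar> powr P) powr (1/P) *
      ((LBINT x. \<bar>u x\<bar> powr s) * (LBINT x. \<bar>v x\<bar> powr s)) powr (1/s)"
proof -
  have eq: "\<bar>u (fst z) * v (snd z)\<bar> powr s = \<bar>u (fst z)\<bar> powr s * \<bar>v (snd z)\<bar> powr s" for z
    by (simp add: abs_mult powr_mult)
  have I: "integrable lborel (\<lambda>z. \<bar>u (fst z) * v (snd z)\<bar> powr s)"
    using integrable_tensor[OF us vs] by (simp add: eq)
  have e: "(LBINT z. \<bar>u (fst z) * v (snd z)\<bar> powr s) =
     (LBINT x. \<bar>u x\<bar> powr s) * (LBINT x. \<bar>v x\<bar> powr s)"
    using integral_tensor[OF us vs] by (simp add: eq)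
  have meas: "(\<lambda>z. u (fst z) * v (snd z)) \<in> borel_measurable lborel" by simp
  have Fm: "F \<in> borel_measurable lborel" by simp
  have sP: "1/s + 1/P = 1" using Ps by simp
  show "integrable lborel (\<lambda>z. u (fst z) * v (snd z) * F z)"
    by (rule Holder_integrable[OF Ps(2,1) sP meas I Fm FP])
  show "\<bar>LBINT z. u (fst z) * v (snd z) * F z\<bar> \<le>
      (LBINT z. \<bar>F z\<bar> powr P) powr (1/P) *
      ((LBINT x. \<bar>u x\<bar> powr s) * (LBINT x. \<bar>v x\<bar> powr s)) powr (1/s)"
    using Holder_inequality[OF Ps(2,1) sP meas I Fm FP] by (simp add: e mult.commute)
qed

section \<open>Interpolation between mixing and integrability\<close>

lemma powr_le_add_powr:
  fixes x :: real
  assumes "0 \<le> x" "a \<le> s" "s \<le> b"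
  shows "x powr s \<le> x powr a + x powr b"
proof (cases "x \<le> 1")
  case True
  have "x powr s \<le> x powr a"
    using True assms by (cases "x = 0") (auto intro: powr_mono')
  then show ?thesis by (simp add: add_increasing2)
next
  case False
  then have "x powr s \<le> x powr b"
    using assms by (intro powr_mono) auto
  then show ?thesis by (simp add: add_increasing)
qed

text \<open>The factor \<open>1 / (1 - 2 powr (1 - 2/s))\<close> is the sum of the geometric series over the levels, squared because both arguments are decomposed.\<close>

definition interp_const :: "real \<Rightarrow> real \<Rightarrow> real" where
  "interp_const p s =
     4 powr (1 - 2/p) * (2 powr (2/s - 2/p))\<^sup>2 * (1 / (1 - 2 powr (1 - 2/s)))\<^sup>2"

text \<open>The levels \<open>|k| \<le> 1\<close>, \<open>1 < |k| \<le> 2\<close>, \<open>2 < |k| \<le> 4\<close>, \<dots> are disjoint; the set in the lemma is level \<open>i\<close>, with everything below \<open>1\<close> collected in level \<open>0\<close>.\<close>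

lemma level_sum_eq:
  fixes k u :: "'a \<Rightarrow> real"
  shows "(\<Sum>i\<le>n. u x * indicator {x. (i = 0 \<or> 2 ^ (i - 1) < \<bar>k x\<bar>) \<and> \<bar>k x\<bar> \<le> 2 ^ i} x) =
    u x * indicator {x. \<bar>k x\<bar> \<le> 2 ^ n} x"
proof (induction n)
  case (Suc n)
  have step: "u x * indicator {x. a \<ge> \<bar>k x\<bar>} x + u x * indicator {x. (Suc n = 0 \<or> a < \<bar>k x\<bar>) \<and> \<bar>k x\<bar> \<le> b} x =
      u x * indicator {x. \<bar>k x\<bar> \<le> b} x" if "a \<le> b" for a b :: real
    using that by (auto simp: indicator_def)
  show ?case
    unfolding sum.atMost_Suc Suc.IH diff_Suc_1 by (rule step) simp
qed simp

text \<open>The piece of \<open>u\<close> on the level \<open>|k| \<approx> 2\<^sup>i\<close> is bounded by \<open>2\<^sup>i\<close> and has \<open>L\<^sup>s\<close> norm of order \<open>(m * 2 powr (- i (p - s))) powr (1/s)\<close>. Hence the form on a pair of levels is bounded both by the mixing inequality for bounded functions and by Hoelder's inequality. The geometric mean with weights \<open>1 - 2/p\<close> and \<open>2/p\<close> decays like \<open>2 powr (- (2/s - 1) (i + j))\<close>, which is summable since \<open>s < 2\<close>. The weights are chosen so that \<open>\<alpha>\<close> enters with the exponent of Davydov's inequality.\<close>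

lemma mixing_interpolation:
  fixes F :: "'a::euclidean_space \<times> 'a \<Rightarrow> real" and k u :: "'a \<Rightarrow> real"
  assumes p: "p > 2" and Ps: "P > 2" "s > 1" "1/P + 1/s = 1"
    and F: "integrable lborel F" and FP: "integrable lborel (\<lambda>z. \<bar>F z\<bar> powr P)"
    and FN: "(LBINT z. \<bar>F z\<bar> powr P) powr (1/P) \<le> N"
    and mix: "\<And>S S'. S \<in> sets borel \<Longrightarrow> S' \<in> sets borel \<Longrightarrow>
      \<bar>LBINT z. indicator S (fst z) * indicator S' (snd z) * F z\<bar> \<le> \<alpha>"
    and k [measurable]: "k \<in> borel_measurable borel" and u [measurable]: "u \<in> borel_measurable borel"
    and uk: "\<And>x. \<bar>u x\<bar> \<le> \<bar>k x\<bar>"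
    and k1: "integrable lborel (\<lambda>x. \<bar>k x\<bar>)" "(LBINT x. \<bar>k x\<bar>) \<le> m"
    and kp: "integrable lborel (\<lambda>x. \<bar>k x\<bar> powr p)" "(LBINT x. \<bar>k x\<bar> powr p) \<le> m"
  shows "\<bar>LBINT z. u (fst z) * u (snd z) * F z\<bar> \<le>
    interp_const p s * \<alpha> powr (1 - 2/p) * N powr (2/p) * m powr (4 / (p * s))"
proof -
  have [measurable]: "F \<in> borel_measurable borel"
    using F by (auto dest: borel_measurable_integrable)
  have P1: "P > 1" using Ps by simp
  have "1/P < 1/2" using Ps by (simp add: field_simps)
  then have "1/s > 1/2" using Ps by linarith
  then have s2: "s < 2" using Ps by (simp add: field_simps)
  have \<alpha>0: "\<alpha> \<ge> 0" using mix[of "{}" "{}"] by auto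
  have N0: "N \<ge> 0" by (rule order_trans[OF powr_ge_zero FN])
  have m0: "m \<ge> 0" by (rule order_trans[OF _ k1(2)]) simp
  define E where "E = (\<lambda>i::nat. {x. (i = 0 \<or> 2 ^ (i - 1) < \<bar>k x\<bar>) \<and> \<bar>k x\<bar> \<le> 2 ^ i})"
  have [measurable]: "E i \<in> sets borel" for i
    by (cases "i = 0") (simp_all add: E_def)
  define w where "w = (\<lambda>i x. u x * indicator (E i) x)"
  have w [measurable]: "w i \<in> borel_measurable borel" for i unfolding w_def by measurable
  have w_le: "\<bar>w i x\<bar> \<le> 2 ^ i" for i x
    using uk[of x] by (auto simp: w_def E_def indicator_def intro: order_trans)
  define d where "d = (\<lambda>i::nat. 2 powr ((1 - real i) * (p - s)))"
  have d0: "0 \<le> d i" for i by (simp add: d_def)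
  have w_powr_le: "\<bar>w i x\<bar> powr s \<le> d i * (if i = 0 then \<bar>k x\<bar> else \<bar>k x\<bar> powr p)" for i x
  proof (cases "x \<in> E i \<and> k x \<noteq> 0")
    case False
    then have "w i x = 0" using uk[of x] by (auto simp: w_def)
    then show ?thesis by (simp add: d_def)
  next
    case True
    have 1: "\<bar>w i x\<bar> powr s \<le> \<bar>k x\<bar> powr s"
      using uk[of x] Ps by (intro powr_mono2) (auto simp: w_def indicator_def)
    show ?thesis
    proof (cases "i = 0")
      case i: True
      have "\<bar>k x\<bar> powr s \<le> \<bar>k x\<bar> powr 1"
        using True i Ps by (intro powr_mono') (auto simp: E_def)
      also have "\<dots> \<le> d i * \<bar>k x\<bar>"
      proof -
        have "1 \<le> d i" using i p s2 by (simp add: d_def ge_one_powr_ge_zero)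
        then show ?thesis using True by (simp add: mult_right_mono[of 1 "d i" "\<bar>k x\<bar>", simplified])
      qed
      finally show ?thesis using 1 i by simp
    next
      case i: False
      have "\<bar>k x\<bar> powr s = \<bar>k x\<bar> powr (s - p) * \<bar>k x\<bar> powr p"
        by (simp add: powr_add[symmetric])
      also have "\<dots> \<le> (2 ^ (i - 1)) powr (s - p) * \<bar>k x\<bar> powr p"
        using True i p s2 by (intro mult_right_mono powr_mono2') (auto simp: E_def)
      also have "(2 ^ (i - 1)) powr (s - p) = d i"
        using i by (simp add: d_def powr_realpow[symmetric] powr_powr of_nat_diff algebra_simps)
      finally show ?thesis using 1 i by simp
    qed
  qed
  have wint: "integrable lborel (\<lambda>x. \<bar>w i x\<bar> powr s)"
    and wI: "(LBINT x. \<bar>w i x\<bar> powr s) \<le> m * d i" for i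
  proof -
    have ki: "integrable lborel (\<lambda>x. d i * (if i = 0 then \<bar>k x\<bar> else \<bar>k x\<bar> powr p))"
      using k1 kp by (cases "i = 0") auto
    show 1: "integrable lborel (\<lambda>x. \<bar>w i x\<bar> powr s)"
      using ki
      by (rule Bochner_Integration.integrable_bound)
        (use w_powr_le[of i] in \<open>auto simp: abs_mult abs_of_nonneg[OF d0] intro!: AE_I2\<close>)
    have "(LBINT x. \<bar>w i x\<bar> powr s) \<le> (LBINT x. d i * (if i = 0 then \<bar>k x\<bar> else \<bar>k x\<bar> powr p))"
      using 1 ki w_powr_le by (intro integral_mono)
    also have "\<dots> \<le> d i * m"
      using k1 kp by (cases "i = 0") (auto simp: d_def)
    finally show "(LBINT x. \<bar>w i x\<bar> powr s) \<le> m * d i" by (simp add: mult.commute)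
  qed
  define I where "I = (\<lambda>i j. LBINT z. w i (fst z) * w j (snd z) * F z)"
  have I_int: "integrable lborel (\<lambda>z. w i (fst z) * w j (snd z) * F z)" for i j
    using Holder_bilinear_form(1)[OF P1 Ps(2,3) _ FP w wint w wint] by simp
  define r where "r = 2 powr (1 - 2/s)"
  have r: "0 < r" "r < 1"
    using s2 Ps by (auto simp: r_def powr_less_one field_simps)
  define c where "c = 4 powr (1 - 2/p) * (2 powr (2/s - 2/p))\<^sup>2 * \<alpha> powr (1 - 2/p) *
     N powr (2/p) * m powr (4 / (p * s))"
  have c0: "c \<ge> 0" by (simp add: c_def)
  have I_le: "\<bar>I i j\<bar> \<le> c * (r ^ i * r ^ j)" for i j
  proof -
    let ?a = "4 * \<alpha> * 2 ^ i * 2 ^ j" and ?b = "N * ((m * d i) * (m * d j)) powr (1/s)"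
    have a: "\<bar>I i j\<bar> \<le> ?a"
      unfolding I_def by (rule bounded_bilinear_form_le[OF F mix w w_le w w_le])
    have "\<bar>I i j\<bar> \<le> (LBINT z. \<bar>F z\<bar> powr P) powr (1/P) *
      ((LBINT x. \<bar>w i x\<bar> powr s) * (LBINT x. \<bar>w j x\<bar> powr s)) powr (1/s)"
      unfolding I_def using Holder_bilinear_form(2)[OF P1 Ps(2,3) _ FP w wint w wint] by simp
    also have "\<dots> \<le> ?b"
      using FN wI N0 m0 Ps
      by (intro mult_mono powr_mono2) (auto simp: d_def)
    finally have b: "\<bar>I i j\<bar> \<le> ?b" .
    \<comment> \<open>Both bounds hold, hence so does their geometric mean.\<close>
    have "\<bar>I i j\<bar> = \<bar>I i j\<bar> powr (1 - 2/p) * \<bar>I i j\<bar> powr (2/p)"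
      by (cases "I i j = 0") (auto simp: powr_add[symmetric])
    also have "\<dots> \<le> ?a powr (1 - 2/p) * ?b powr (2/p)"
      using a b p by (intro mult_mono powr_mono2) auto
    also have "?a powr (1 - 2/p) = 4 powr (1 - 2/p) * \<alpha> powr (1 - 2/p) * 2 powr ((real i + real j) * (1 - 2/p))"
      using \<alpha>0 by (simp add: powr_mult powr_realpow[symmetric] powr_powr powr_add[symmetric] algebra_simps)
    also have "?b powr (2/p) = N powr (2/p) * m powr (4 / (p * s)) *
        2 powr ((2 - (real i + real j)) * (p - s) * (2 / (p * s)))"
    proof -
      have "?b powr (2/p) = N powr (2/p) * ((m * m) * (d i * d j)) powr (2 / (p * s))"
        using m0 N0 d0 by (simp add: powr_mult powr_powr mult_ac)
      also have "d i * d j = 2 powr ((2 - (real i + real j)) * (p - s))"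
        by (simp add: d_def powr_add[symmetric] algebra_simps)
      also have "((m * m) * 2 powr ((2 - (real i + real j)) * (p - s))) powr (2 / (p * s)) =
          m powr (4 / (p * s)) * 2 powr ((2 - (real i + real j)) * (p - s) * (2 / (p * s)))"
        using m0 by (simp add: powr_mult powr_powr powr_add[symmetric])
      finally show ?thesis by (simp add: mult_ac)
    qed
    also have "4 powr (1 - 2/p) * \<alpha> powr (1 - 2/p) * 2 powr ((real i + real j) * (1 - 2/p)) *
       (N powr (2/p) * m powr (4 / (p * s)) * 2 powr ((2 - (real i + real j)) * (p - s) * (2 / (p * s))))
      = 4 powr (1 - 2/p) * \<alpha> powr (1 - 2/p) * N powr (2/p) * m powr (4 / (p * s)) *
        2 powr ((real i + real j) * (1 - 2/p) + (2 - (real i + real j)) * (p - s) * (2 / (p * s)))"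
      by (simp add: powr_add mult_ac)
    also have "(real i + real j) * (1 - 2/p) + (2 - (real i + real j)) * (p - s) * (2 / (p * s)) =
       (2/s - 2/p) * 2 + (1 - 2/s) * (real i + real j)"
      using p Ps by (simp add: field_simps)
    also have "2 powr ((2/s - 2/p) * 2 + (1 - 2/s) * (real i + real j)) = (2 powr (2/s - 2/p))\<^sup>2 * (r ^ i * r ^ j)"
      using r by (simp add: powr_add r_def powr_realpow[symmetric] powr_powr ring_distribs)
    finally show ?thesis by (simp add: c_def mult_ac)
  qed
  define U where "U = (\<lambda>n x. \<Sum>i\<le>n. w i x)"
  have U_eq: "U n x = u x * indicator {x. \<bar>k x\<bar> \<le> 2 ^ n} x" for n x
    unfolding U_def w_def E_def by (rule level_sum_eq)
  have [measurable]: "U n \<in> borel_measurable borel" for n unfolding U_def by measurable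
  have U_le: "\<bar>LBINT z. U n (fst z) * U n (snd z) * F z\<bar> \<le> c * (1 / (1 - r))\<^sup>2" for n
  proof -
    have "(LBINT z. U n (fst z) * U n (snd z) * F z) =
      (LBINT z. (\<Sum>i\<le>n. \<Sum>j\<le>n. w i (fst z) * w j (snd z) * F z))"
    proof -
      have "U n x * U n y * t = (\<Sum>i\<le>n. \<Sum>j\<le>n. w i x * w j y * t)" for x y t
        unfolding U_def by (subst sum_product) (simp add: sum_distrib_right)
      then show ?thesis by simp
    qed
    also have "\<dots> = (\<Sum>i\<le>n. \<Sum>j\<le>n. I i j)"
      using I_int by (simp add: I_def Bochner_Integration.integral_sum)
    finally have "\<bar>LBINT z. U n (fst z) * U n (snd z) * F z\<bar> \<le> (\<Sum>i\<le>n. \<Sum>j\<le>n. \<bar>I i j\<bar>)"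
      by (auto intro!: order_trans[OF sum_abs] sum_mono)
    also have "\<dots> \<le> (\<Sum>i\<le>n. \<Sum>j\<le>n. c * (r ^ i * r ^ j))"
      by (intro sum_mono I_le)
    also have "\<dots> = c * (\<Sum>i\<le>n. r ^ i)\<^sup>2"
      unfolding power2_eq_square by (subst sum_product) (simp add: sum_distrib_left)
    also have "\<dots> \<le> c * (1 / (1 - r))\<^sup>2"
    proof -
      have "(\<Sum>i\<le>n. r ^ i) \<le> (\<Sum>i. r ^ i)"
        using r by (intro sum_le_suminf summable_geometric) auto
      also have "\<dots> = 1 / (1 - r)" using r by (intro suminf_geometric) auto
      finally show ?thesis using r c0 by (intro mult_left_mono power_mono sum_nonneg) auto
    qed
    finally show ?thesis .
  qed
  have us: "integrable lborel (\<lambda>x. \<bar>u x\<bar> powr s)"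
  proof (rule Bochner_Integration.integrable_bound)
    show "integrable lborel (\<lambda>x. \<bar>k x\<bar> + \<bar>k x\<bar> powr p)" using k1 kp by simp
    have "\<bar>u x\<bar> powr s \<le> \<bar>k x\<bar> + \<bar>k x\<bar> powr p" for x
      using powr_le_add_powr[of "\<bar>k x\<bar>" 1 s p] powr_mono2[of s "\<bar>u x\<bar>" "\<bar>k x\<bar>"] uk[of x] Ps s2 p
      by simp
    then show "AE x in lborel. norm (\<bar>u x\<bar> powr s) \<le> norm (\<bar>k x\<bar> + \<bar>k x\<bar> powr p)"
      by (auto intro!: AE_I2 intro: order_trans[OF _ abs_ge_self])
  qed measurable
  \<comment> \<open>The bound is uniform in the truncation level, which is now removed by dominated convergence.\<close>
  have "(\<lambda>n. LBINT z. U n (fst z) * U n (snd z) * F z) \<longlonglongrightarrow>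
     (LBINT z. u (fst z) * u (snd z) * F z)"
  proof (rule integral_dominated_convergence)
    show "integrable lborel (\<lambda>z. \<bar>u (fst z) * u (snd z) * F z\<bar>)"
      using Holder_bilinear_form(1)[OF P1 Ps(2,3) _ FP u us u us] by simp
    have lim: "(\<lambda>n. U n x) \<longlonglongrightarrow> u x" for x
    proof (rule tendsto_eventually)
      obtain n where n: "\<bar>k x\<bar> < 2 ^ n"
        using real_arch_pow[of 2] by auto
      show "\<forall>\<^sub>F n in sequentially. U n x = u x"
      proof (rule eventually_sequentiallyI)
        fix j assume "n \<le> j"
        then have "(2::real) ^ n \<le> 2 ^ j" by simp
        with n have "\<bar>k x\<bar> \<le> 2 ^ j" by linarith
        then show "U j x = u x" by (simp add: U_eq)
      qed
    qed
    show "AE z in lborel. (\<lambda>n. U n (fst z) * U n (snd z) * F z) \<longlonglongrightarrow> u (fst z) * u (snd z) * F z"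
      by (intro AE_I2 tendsto_intros lim)
    show "AE z in lborel. norm (U n (fst z) * U n (snd z) * F z) \<le> \<bar>u (fst z) * u (snd z) * F z\<bar>" for n
      by (intro AE_I2) (auto simp: U_eq indicator_def)
  qed measurable
  then have "(\<lambda>n. \<bar>LBINT z. U n (fst z) * U n (snd z) * F z\<bar>) \<longlonglongrightarrow>
     \<bar>LBINT z. u (fst z) * u (snd z) * F z\<bar>"
    by (rule tendsto_rabs)
  then have "\<bar>LBINT z. u (fst z) * u (snd z) * F z\<bar> \<le> c * (1 / (1 - r))\<^sup>2"
    by (rule LIMSEQ_le_const2) (use U_le in auto)
  then show ?thesis by (simp add: c_def r_def interp_const_def mult_ac)
qed

section \<open>Product kernels\<close>

lemma
  fixes h :: "'a::euclidean_space \<Rightarrow> real"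
  assumes [measurable]: "h \<in> borel_measurable borel" and b: "b > 0"
  shows integrable_affine_iff: "integrable lborel (\<lambda>x. h (z + b *\<^sub>R x)) \<longleftrightarrow> integrable lborel h"
    and integral_affine: "(LBINT x. h x) = b ^ DIM('a) * (LBINT x. h (z + b *\<^sub>R x))"
proof -
  have L: "(lborel :: 'a measure) = density (distr lborel borel (\<lambda>x. z + b *\<^sub>R x)) (\<lambda>_. ennreal (b ^ DIM('a)))"
    using lborel_affine[of b z] b by simp
  have "integrable lborel h \<longleftrightarrow> integrable (density (distr lborel borel (\<lambda>x. z + b *\<^sub>R x)) (\<lambda>_. ennreal (b ^ DIM('a)))) h"
    using L by simp
  also have "\<dots> \<longleftrightarrow> integrable lborel (\<lambda>x. h (z + b *\<^sub>R x))"
    using b by (subst integrable_density) (auto simp: integrable_distr_eq)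
  finally show "integrable lborel (\<lambda>x. h (z + b *\<^sub>R x)) \<longleftrightarrow> integrable lborel h" by simp
  have "(LBINT x. h x) = (\<integral>x. h x \<partial>density (distr lborel borel (\<lambda>x. z + b *\<^sub>R x)) (\<lambda>_. ennreal (b ^ DIM('a))))"
    using L by simp
  also have "\<dots> = b ^ DIM('a) * (LBINT x. h (z + b *\<^sub>R x))"
    using b by (subst integral_density) (auto simp: integral_distr)
  finally show "(LBINT x. h x) = b ^ DIM('a) * (LBINT x. h (z + b *\<^sub>R x))" .
qed

text \<open>Lebesgue measure on a Euclidean space is the image of the product measure indexed by the basis, and the basis vectors of \<open>real^'d\<close> are the \<open>axis i 1\<close>; so the product formula only has to be reindexed.\<close>

lemma
  fixes g :: "'d::finite \<Rightarrow> real \<Rightarrow> real"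
  assumes g: "\<And>i. integrable lborel (g i)"
  shows integrable_vec_prod: "integrable lborel (\<lambda>w::real^'d. \<Prod>i\<in>UNIV. g i (w $ i))"
    and integral_vec_prod: "(LBINT (w::real^'d). (\<Prod>i\<in>UNIV. g i (w $ i))) = (\<Prod>i\<in>UNIV. (LBINT u. g i u))"
proof -
  have [measurable]: "g i \<in> borel_measurable borel" for i
    using g by (auto dest: borel_measurable_integrable)
  define ix where "ix = (\<lambda>b::real^'d. THE i. b = axis i 1)"
  have ix: "ix (axis i 1) = i" for i
    by (auto simp: ix_def axis_eq_axis)
  have B: "(Basis :: (real^'d) set) = (\<lambda>i. axis i 1) ` UNIV"
    by (auto simp: Basis_vec_def)
  have inj: "inj (\<lambda>i. axis i 1 :: real^'d)"
    by (auto simp: inj_on_def axis_eq_axis)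
  have prod_eq: "(\<Prod>b\<in>Basis. h (ix b) b) = (\<Prod>i\<in>UNIV. h i (axis i 1))"
    for h :: "'d \<Rightarrow> (real^'d) \<Rightarrow> real"
    by (simp add: B prod.reindex[OF inj] ix)
  have nth: "(\<Sum>b\<in>Basis. x b *\<^sub>R b) $ i = x (axis i 1)" for x :: "real^'d \<Rightarrow> real" and i
    by (subst inner_sum_left_Basis[of "axis i 1" x, symmetric]) (auto simp: inner_axis)
  interpret product_sigma_finite "\<lambda>_::real^'d. lborel :: real measure" ..
  have m: "(\<lambda>x. \<Sum>b\<in>Basis. x b *\<^sub>R b) \<in> (\<Pi>\<^sub>M b\<in>(Basis :: (real^'d) set). lborel) \<rightarrow>\<^sub>M borel"
    by measurable
  have meas: "(\<lambda>w::real^'d. \<Prod>i\<in>UNIV. g i (w $ i)) \<in> borel_measurable borel"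
    by measurable
  have eq: "(\<Prod>i\<in>UNIV. g i ((\<Sum>b\<in>Basis. x b *\<^sub>R b) $ i)) = (\<Prod>b\<in>Basis. g (ix b) (x b))"
    for x :: "real^'d \<Rightarrow> real"
    using prod_eq[of "\<lambda>i b. g i (x b)"] by (simp add: nth del: sum_component)
  show "integrable lborel (\<lambda>w::real^'d. \<Prod>i\<in>UNIV. g i (w $ i))"
    using product_integrable_prod[of "Basis :: (real^'d) set" "\<lambda>b. g (ix b)"] g
    by (subst lborel_eq) (simp add: integrable_distr_eq[OF m meas] eq del: sum_component)
  show "(LBINT (w::real^'d). (\<Prod>i\<in>UNIV. g i (w $ i))) = (\<Prod>i\<in>UNIV. (LBINT u. g i u))"
    using product_integral_prod[of "Basis :: (real^'d) set" "\<lambda>b. g (ix b)"] g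
      prod_eq[of "\<lambda>i b. LBINT u. g i u"]
    by (subst lborel_eq) (simp add: integral_distr[OF m meas] eq del: sum_component)
qed

text \<open>Index lists describe monomials with repetition. Collecting equal indices gives the form in which Fubini's theorem applies.\<close>

lemma prod_list_nth_eq_prod_power:
  fixes w :: "real^'d::finite"
  shows "prod_list (map (\<lambda>i. w $ i) is) = (\<Prod>i\<in>UNIV. (w $ i) ^ count_list is i)"
proof (induction "is")
  case (Cons a "is")
  have "(\<Prod>i\<in>UNIV. (w $ i) ^ count_list (a # is) i) =
      (\<Prod>i\<in>UNIV. (if i = a then w $ i else 1) * (w $ i) ^ count_list is i)"
    by (intro prod.cong) auto
  also have "\<dots> = w $ a * (\<Prod>i\<in>UNIV. (w $ i) ^ count_list is i)"
    by (simp add: prod.distrib prod.delta)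
  finally show ?case using Cons by simp
qed simp

lemma abs_prod_list_nth_le:
  fixes w :: "real^'d::finite"
  shows "\<bar>prod_list (map (\<lambda>i. w $ i) is)\<bar> \<le> norm w ^ length is"
  by (induction "is") (auto simp: abs_mult intro!: mult_mono component_le_norm_cart)

lemma norm_power_le_sum:
  fixes w :: "real^'d::finite"
  shows "norm w ^ r \<le> real CARD('d) ^ r * (\<Sum>i\<in>UNIV. \<bar>w $ i\<bar> ^ r)"
proof -
  have "Max (range (\<lambda>i. \<bar>w $ i\<bar>)) \<in> range (\<lambda>i. \<bar>w $ i\<bar>)" by (intro Max_in) auto
  then obtain j where j: "Max (range (\<lambda>i. \<bar>w $ i\<bar>)) = \<bar>w $ j\<bar>" by (rule imageE)
  have le: "\<bar>w $ i\<bar> \<le> \<bar>w $ j\<bar>" for i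
    unfolding j[symmetric] by (intro Max_ge) auto
  have "norm w \<le> (\<Sum>i\<in>UNIV. \<bar>w $ i\<bar>)" by (rule norm_le_l1_cart)
  also have "\<dots> \<le> real CARD('d) * \<bar>w $ j\<bar>"
    using sum_bounded_above[of UNIV "\<lambda>i. \<bar>w $ i\<bar>" "\<bar>w $ j\<bar>"] le by simp
  finally have "norm w ^ r \<le> (real CARD('d) * \<bar>w $ j\<bar>) ^ r" by (intro power_mono) auto
  also have "\<dots> = real CARD('d) ^ r * \<bar>w $ j\<bar> ^ r" by (simp add: power_mult_distrib)
  also have "\<bar>w $ j\<bar> ^ r \<le> (\<Sum>i\<in>UNIV. \<bar>w $ i\<bar> ^ r)"
    by (rule member_le_sum) auto
  finally show ?thesis by (simp add: mult_left_mono)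
qed

text \<open>The integral of \<open>K\<close> against a monomial is a product of one-dimensional integrals. If its degree lies between \<open>1\<close> and \<open>r - 1\<close>, some coordinate occurs with an exponent in that range, and its factor vanishes.\<close>

lemma
  fixes K :: "real^'d::finite \<Rightarrow> real"
  assumes K: "multiplicative_kernel r S K"
  shows multiplicative_kernel_order_pos: "1 \<le> r"
    and multiplicative_kernel_integrable: "integrable lborel K"
    and multiplicative_kernel_integral: "(LBINT w. K w) = 1"
    and multiplicative_kernel_moment_integrable: "integrable lborel (\<lambda>w. \<bar>K w\<bar> * norm w ^ r)"
    and multiplicative_kernel_monomial:
      "1 \<le> length is \<Longrightarrow> length is < r \<Longrightarrow>
        has_bochner_integral lborel (\<lambda>w. K w * prod_list (map (\<lambda>i. w $ i) is)) 0"
proof -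
  from K obtain l where Keq: "K = (\<lambda>w. \<Prod>i\<in>UNIV. l (w $ i))"
    and l: "has_bochner_integral lborel l 1"
    and lk: "\<And>i. i \<in> {1..<r} \<Longrightarrow> has_bochner_integral lborel (\<lambda>u. u ^ i * l u) 0"
    and lr: "integrable lborel (\<lambda>u. \<bar>u\<bar> ^ r * l u)" and r: "1 \<le> r"
    unfolding multiplicative_kernel_def by auto
  show "1 \<le> r" by fact
  have li: "integrable lborel l" and lI: "(LBINT u. l u) = 1"
    using l by (auto simp: has_bochner_integral_iff)
  have [measurable]: "l \<in> borel_measurable borel"
    using li by (auto dest: borel_measurable_integrable)
  show Ki: "integrable lborel K"
    unfolding Keq by (rule integrable_vec_prod) (rule li)
  then have [measurable]: "K \<in> borel_measurable borel"
    by (auto dest: borel_measurable_integrable)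
  show "(LBINT w. K w) = 1"
    unfolding Keq by (subst integral_vec_prod) (simp_all add: li lI)
  have i1: "integrable lborel (\<lambda>w. \<bar>K w\<bar> * \<bar>w $ j\<bar> ^ r)" for j
  proof -
    have "integrable lborel (\<lambda>w::real^'d. \<Prod>i\<in>UNIV. (\<lambda>u. \<bar>l u\<bar> * (if i = j then \<bar>u\<bar> ^ r else 1)) (w $ i))"
    proof (rule integrable_vec_prod)
      fix i show "integrable lborel (\<lambda>u. \<bar>l u\<bar> * (if i = j then \<bar>u\<bar> ^ r else 1))"
        using integrable_abs[OF li] integrable_abs[OF lr] by (cases "i = j") (auto simp: abs_mult mult.commute)
    qed
    then show ?thesis by (simp add: Keq prod.distrib abs_prod prod.delta)
  qed
  show "integrable lborel (\<lambda>w. \<bar>K w\<bar> * norm w ^ r)"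
  proof (rule Bochner_Integration.integrable_bound)
    show "integrable lborel (\<lambda>w. real CARD('d) ^ r * (\<Sum>j\<in>UNIV. \<bar>K w\<bar> * \<bar>w $ j\<bar> ^ r))"
      by (intro integrable_mult_right Bochner_Integration.integrable_sum i1)
    show "AE w in lborel. norm (\<bar>K w\<bar> * norm w ^ r) \<le>
        norm (real CARD('d) ^ r * (\<Sum>j\<in>UNIV. \<bar>K w\<bar> * \<bar>w $ j\<bar> ^ r))"
    proof (rule AE_I2)
      fix w :: "real^'d"
      have "\<bar>K w\<bar> * norm w ^ r \<le> \<bar>K w\<bar> * (real CARD('d) ^ r * (\<Sum>j\<in>UNIV. \<bar>w $ j\<bar> ^ r))"
        by (intro mult_left_mono norm_power_le_sum) auto
      also have "\<dots> = real CARD('d) ^ r * (\<Sum>j\<in>UNIV. \<bar>K w\<bar> * \<bar>w $ j\<bar> ^ r)"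
        by (simp add: sum_distrib_left mult_ac)
      finally show "norm (\<bar>K w\<bar> * norm w ^ r) \<le>
          norm (real CARD('d) ^ r * (\<Sum>j\<in>UNIV. \<bar>K w\<bar> * \<bar>w $ j\<bar> ^ r))"
        by simp
    qed
  qed measurable
  show "has_bochner_integral lborel (\<lambda>w. K w * prod_list (map (\<lambda>i. w $ i) is)) 0"
    if is1: "1 \<le> length is" and isr: "length is < r"
  proof -
    let ?g = "\<lambda>i u. u ^ count_list is i * l u"
    have c: "count_list is i < r" for i
      using count_le_length[of "is" i] isr by simp
    have gi: "integrable lborel (?g i)" for i
    proof (cases "count_list is i = 0")
      case False
      then show ?thesis using lk[of "count_list is i"] c[of i] by (auto simp: has_bochner_integral_iff)
    qed (use li in simp)
    obtain a where a: "count_list is a \<noteq> 0"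
      using is1 by (metis count_list_0_iff hd_in_set length_0_conv not_one_le_zero)
    have g0: "(LBINT u. ?g a u) = 0"
      using lk[of "count_list is a"] c[of a] a by (auto simp: has_bochner_integral_iff)
    have eq: "K w * prod_list (map (\<lambda>i. w $ i) is) = (\<Prod>i\<in>UNIV. ?g i (w $ i))" for w
      by (simp add: Keq prod_list_nth_eq_prod_power prod.distrib mult.commute)
    have "(LBINT (w::real^'d). (\<Prod>i\<in>UNIV. ?g i (w $ i))) = (\<Prod>i\<in>UNIV. (LBINT u. ?g i u))"
      by (rule integral_vec_prod) (rule gi)
    also have "\<dots> = 0" using g0 by (intro prod_zero) auto
    finally show ?thesis
      using integrable_vec_prod[of ?g, OF gi] by (simp add: has_bochner_integral_iff eq)
  qed
qed

section \<open>Smooth functions and the bias of kernel smoothing\<close>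

text \<open>The homogeneous part of degree \<open>k\<close> of the Taylor polynomial.\<close>

definition taylor_term :: "(real^'d \<Rightarrow> real) \<Rightarrow> real^'d \<Rightarrow> nat \<Rightarrow> real^'d \<Rightarrow> real" where
  "taylor_term g x k v =
     (\<Sum>is | length is = k. iterated_partial is g x * prod_list (map (\<lambda>i. v $ i) is)) / fact k"

definition taylor_term_const :: "(real^'d \<Rightarrow> real) \<Rightarrow> real^'d \<Rightarrow> nat \<Rightarrow> real" where
  "taylor_term_const g x k = (\<Sum>is | length is = k. \<bar>iterated_partial is g x\<bar>) / fact k"

lemma taylor_poly_eq_sum: "taylor_poly n g x v = (\<Sum>k=1..n. taylor_term g x k v)"
  by (simp add: taylor_poly_def taylor_term_def)

lemma taylor_term_scale:
  fixes v :: "real^'d::finite"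
  shows "taylor_term g x k (c *\<^sub>R v) = c ^ k * taylor_term g x k v"
proof -
  have p: "prod_list (map (\<lambda>i. (c *\<^sub>R v) $ i) is) = c ^ length is * prod_list (map (\<lambda>i. v $ i) is)"
    for "is" :: "'d list"
    by (induction "is") (auto simp: mult_ac)
  show ?thesis
    unfolding taylor_term_def p
    by (simp add: sum_distrib_left mult_ac)
qed

lemma abs_taylor_term_le:
  fixes v :: "real^'d::finite"
  shows "\<bar>taylor_term g x k v\<bar> \<le> taylor_term_const g x k * norm v ^ k"
proof -
  have "\<bar>\<Sum>is | length is = k. iterated_partial is g x * prod_list (map (\<lambda>i. v $ i) is)\<bar> \<le>
     (\<Sum>is | length is = k. \<bar>iterated_partial is g x\<bar> * norm v ^ k)"
    using abs_prod_list_nth_le[of v]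
    by (intro order_trans[OF sum_abs] sum_mono) (auto simp: abs_mult intro!: mult_left_mono)
  then show ?thesis
    by (simp add: taylor_term_def taylor_term_const_def sum_distrib_right divide_right_mono)
qed

lemma taylor_term_const_nonneg: "0 \<le> taylor_term_const g x k"
  by (simp add: taylor_term_const_def sum_nonneg)

text \<open>The quotient in the definition of the class is cleared; at increment \<open>0\<close>, where it carries no information, both sides vanish.\<close>

lemma smooth_classE:
  fixes g :: "real^'d::finite \<Rightarrow> real"
  assumes g: "g \<in> smooth_class s \<Delta>"
  obtains m \<delta> where "real m - 1 < s" "s \<le> real m" "\<delta> > 0"
    "\<And>x v. norm v < \<delta> \<Longrightarrow>
       \<bar>g (x + v) - g x - (\<Sum>k=1..m - 1. taylor_term g x k v)\<bar> \<le> \<Delta> * norm v powr s"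
proof -
  from g obtain m \<delta> where m: "real m - 1 < s" "s \<le> real m" and \<delta>: "\<delta> > 0"
    and le: "\<And>x y. norm (y - x) < \<delta> \<Longrightarrow>
      \<bar>g y - g x - taylor_poly (m - 1) g x (y - x)\<bar> / norm (y - x) powr s \<le> \<Delta>"
    unfolding smooth_class_def by blast
  have "\<bar>g (x + v) - g x - (\<Sum>k=1..m - 1. taylor_term g x k v)\<bar> \<le> \<Delta> * norm v powr s"
    if v: "norm v < \<delta>" for x v
  proof (cases "v = 0")
    case True
    have "taylor_term g x k 0 = 0" if "k \<in> {1..m - 1}" for k
      using abs_taylor_term_le[of g x k 0] that by (auto simp: power_0_left split: if_splits)
    then show ?thesis using True by simp
  next
    case False
    then show ?thesis
      using le[of "x + v" x] v by (simp add: divide_le_eq taylor_poly_eq_sum)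
  qed
  with m \<delta> show ?thesis by (rule that)
qed

text \<open>Richardson extrapolation: evaluating a polynomial \<open>P\<close> of degree at most \<open>n\<close> at \<open>v, v/2, v/4, \<dots>\<close> and combining with these coefficients recovers \<open>P(0)\<close>. The step from \<open>n\<close> to \<open>n + 1\<close> takes the combination for \<open>v/2\<close>, subtracts \<open>2 powr (- n - 1)\<close> times the one for \<open>v\<close>, which cancels the new degree, and renormalises.\<close>

lemma extrapolation_coefficients:
  "\<exists>c::nat \<Rightarrow> real. (\<Sum>j\<le>n. c j) = 1 \<and> (\<forall>k\<in>{1..n}. (\<Sum>j\<le>n. c j * (1/2) ^ (j * k)) = 0)"
proof (induction n)
  case 0
  show ?case by (intro exI[of _ "\<lambda>_. 1"]) auto
next
  case (Suc n)
  then obtain c :: "nat \<Rightarrow> real" where c: "(\<Sum>j\<le>n. c j) = 1"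
    "\<And>k. k \<in> {1..n} \<Longrightarrow> (\<Sum>j\<le>n. c j * (1/2) ^ (j * k)) = 0" by blast
  define \<theta> :: real where "\<theta> = (1/2) ^ Suc n"
  have \<theta>: "\<theta> < 1" unfolding \<theta>_def by (rule power_Suc_less_one) auto
  define c' where "c' = (\<lambda>j. ((if j = 0 then 0 else c (j - 1)) - \<theta> * (if j \<le> n then c j else 0)) / (1 - \<theta>))"
  have S: "(\<Sum>j\<le>Suc n. c' j * (1/2) ^ (j * k)) =
     ((1/2) ^ k - \<theta>) * (\<Sum>j\<le>n. c j * (1/2) ^ (j * k)) / (1 - \<theta>)" for k
  proof -
    have "(\<Sum>j\<le>Suc n. (if j = 0 then 0 else c (j - 1)) * (1/2) ^ (j * k)) =
       (\<Sum>j\<le>n. c j * (1/2) ^ (Suc j * k))"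
      by (subst sum.atMost_Suc_shift) simp
    also have "\<dots> = (1/2) ^ k * (\<Sum>j\<le>n. c j * (1/2) ^ (j * k))"
      by (simp add: sum_distrib_left power_add mult_ac)
    finally have 1: "(\<Sum>j\<le>Suc n. (if j = 0 then 0 else c (j - 1)) * (1/2) ^ (j * k)) =
      (1/2) ^ k * (\<Sum>j\<le>n. c j * (1/2) ^ (j * k))" .
    have 2: "(\<Sum>j\<le>Suc n. (if j \<le> n then c j else 0) * (1/2) ^ (j * k)) = (\<Sum>j\<le>n. c j * (1/2) ^ (j * k))"
      by simp
    have "(\<Sum>j\<le>Suc n. c' j * (1/2) ^ (j * k)) =
      ((\<Sum>j\<le>Suc n. (if j = 0 then 0 else c (j - 1)) * (1/2) ^ (j * k)) -
       \<theta> * (\<Sum>j\<le>Suc n. (if j \<le> n then c j else 0) * (1/2) ^ (j * k))) / (1 - \<theta>)"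
      unfolding c'_def sum_distrib_left sum_subtractf[symmetric] sum_divide_distrib
      by (intro sum.cong) (auto simp: field_simps)
    then show ?thesis unfolding 1 2 by (simp add: left_diff_distrib)
  qed
  have "(\<Sum>j\<le>Suc n. c' j) = 1"
    using S[of 0] c(1) \<theta> by simp
  moreover have "(\<Sum>j\<le>Suc n. c' j * (1/2) ^ (j * k)) = 0" if "k \<in> {1..Suc n}" for k
    using S[of k] c(2)[of k] that by (cases "k = Suc n") (auto simp: \<theta>_def)
  ultimately show ?case by blast
qed

text \<open>Near \<open>x\<close> the function is, up to a bounded error, a polynomial with value \<open>f x\<close> at increment \<open>0\<close>. Extrapolation recovers this value from the values of \<open>f\<close> at \<open>x + v, x + v/2, \<dots>\<close>, so \<open>|f x|\<close> is bounded by a combination of these plus a constant. Averaging over \<open>v\<close> in a ball bounds it by a multiple of the integral of \<open>|f|\<close>, uniformly in \<open>x\<close>.\<close>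

lemma smooth_class_integrable_imp_bounded:
  fixes f :: "real^'d::finite \<Rightarrow> real"
  assumes f: "f \<in> smooth_class s \<Delta>" and s: "s > 0" and \<Delta>: "\<Delta> > 0" and int: "integrable lborel f"
  shows "\<exists>B. \<forall>x. \<bar>f x\<bar> \<le> B"
proof -
  obtain m \<delta> where \<delta>: "\<delta> > 0" and T: "\<And>x v. norm v < \<delta> \<Longrightarrow>
       \<bar>f (x + v) - f x - (\<Sum>k=1..m - 1. taylor_term f x k v)\<bar> \<le> \<Delta> * norm v powr s"
    using smooth_classE[OF f] by metis
  obtain c :: "nat \<Rightarrow> real" where c1: "(\<Sum>j\<le>m - 1. c j) = 1"
    and c0: "\<And>k. k \<in> {1..m - 1} \<Longrightarrow> (\<Sum>j\<le>m - 1. c j * (1/2) ^ (j * k)) = 0"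
    using extrapolation_coefficients[of "m - 1"] by blast
  have [measurable]: "f \<in> borel_measurable borel"
    using int by (auto dest: borel_measurable_integrable)
  let ?B = "ball (0::real^'d) \<delta>" and ?N = "LBINT x. \<bar>f x\<bar>"
  define D where "D = \<Delta> * \<delta> powr s"
  have point: "\<bar>f x\<bar> \<le> (\<Sum>j\<le>m - 1. \<bar>c j\<bar> * (\<bar>f (x + (1/2) ^ j *\<^sub>R v)\<bar> + D))" if v: "norm v < \<delta>" for x v
  proof -
    let ?v = "\<lambda>j. (1/2::real) ^ j *\<^sub>R v"
    have nv: "norm (?v j) < \<delta>" for j
    proof -
      have "norm (?v j) \<le> 1 * norm v"
        by (simp add: power_le_one mult_left_le_one_le)
      then show ?thesis using v by simp
    qed
    have "(\<Sum>j\<le>m - 1. c j * (\<Sum>k=1..m - 1. taylor_term f x k (?v j))) =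
      (\<Sum>k=1..m - 1. taylor_term f x k v * (\<Sum>j\<le>m - 1. c j * (1/2) ^ (j * k)))"
      unfolding sum_distrib_left
      by (subst sum.swap) (simp add: taylor_term_scale power_mult mult_ac)
    also have "\<dots> = 0" using c0 by simp
    finally have T0: "(\<Sum>j\<le>m - 1. c j * (\<Sum>k=1..m - 1. taylor_term f x k (?v j))) = 0" .
    have "f x = (\<Sum>j\<le>m - 1. c j) * f x"
      by (simp only: c1 mult_1)
    also have "\<dots> = (\<Sum>j\<le>m - 1. c j * f x) + (\<Sum>j\<le>m - 1. c j * (\<Sum>k=1..m - 1. taylor_term f x k (?v j)))"
      by (simp only: T0 sum_distrib_right add_0_right)
    also have "\<dots> = (\<Sum>j\<le>m - 1. c j * (f x + (\<Sum>k=1..m - 1. taylor_term f x k (?v j))))"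
      by (simp only: sum.distrib[symmetric] distrib_left)
    finally have "\<bar>f x\<bar> \<le> (\<Sum>j\<le>m - 1. \<bar>c j\<bar> * \<bar>f x + (\<Sum>k=1..m - 1. taylor_term f x k (?v j))\<bar>)"
      by (metis (no_types, lifting) sum_abs abs_mult sum.cong)
    also have "\<dots> \<le> (\<Sum>j\<le>m - 1. \<bar>c j\<bar> * (\<bar>f (x + ?v j)\<bar> + D))"
    proof (intro sum_mono mult_left_mono)
      fix j
      have "\<Delta> * norm (?v j) powr s \<le> D"
        unfolding D_def using \<Delta> nv[of j] s by (intro mult_left_mono powr_mono2) (auto simp: less_imp_le)
      then show "\<bar>f x + (\<Sum>k=1..m - 1. taylor_term f x k (?v j))\<bar> \<le> \<bar>f (x + ?v j)\<bar> + D"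
        using T[OF nv[of j], of x] by linarith
    qed auto
    finally show ?thesis .
  qed
  have vol: "measure lborel ?B > 0"
    using content_ball_pos[OF \<delta>, of "0::real^'d"] by simp
  have iB: "integrable lborel (\<lambda>v. indicator ?B v * a)" for a :: real
    by (intro integrable_mult_left integrable_real_indicator emeasure_lborel_ball_finite) simp
  \<comment> \<open>The factor \<open>(2 ^ j) ^ d\<close> comes from the change of variables \<open>v \<mapsto> x + v / 2 ^ j\<close>.\<close>
  define E where "E = (\<Sum>j\<le>m - 1. \<bar>c j\<bar> * ((2 ^ j) ^ CARD('d) * ?N + D * measure lborel ?B))"
  have "\<bar>f x\<bar> \<le> E / measure lborel ?B" for x
  proof -
    have fj: "integrable lborel (\<lambda>v. \<bar>f (x + (1/2) ^ j *\<^sub>R v)\<bar>)"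
      and fI: "(LBINT v. \<bar>f (x + (1/2) ^ j *\<^sub>R v)\<bar>) = (2 ^ j) ^ CARD('d) * ?N" for j
    proof -
      show "integrable lborel (\<lambda>v. \<bar>f (x + (1/2) ^ j *\<^sub>R v)\<bar>)"
        using integrable_affine_iff[of f "(1/2) ^ j" x] int by auto
      show "(LBINT v. \<bar>f (x + (1/2) ^ j *\<^sub>R v)\<bar>) = (2 ^ j) ^ CARD('d) * ?N"
        using integral_affine[of "\<lambda>x. \<bar>f x\<bar>" "(1/2) ^ j" x]
        by (simp add: power_divide field_simps)
    qed
    have "measure lborel ?B * \<bar>f x\<bar> = (LBINT v. indicator ?B v * \<bar>f x\<bar>)"
      using iB[of 1] by simp
    also have "\<dots> \<le> (LBINT v. (\<Sum>j\<le>m - 1. \<bar>c j\<bar> * (\<bar>f (x + (1/2) ^ j *\<^sub>R v)\<bar> + indicator ?B v * D)))"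
    proof (rule integral_mono)
      fix v
      show "indicator ?B v * \<bar>f x\<bar> \<le> (\<Sum>j\<le>m - 1. \<bar>c j\<bar> * (\<bar>f (x + (1/2) ^ j *\<^sub>R v)\<bar> + indicator ?B v * D))"
        using point[of v x] by (cases "v \<in> ?B") (auto intro!: sum_nonneg)
    qed (intro iB fj Bochner_Integration.integrable_sum integrable_mult_right Bochner_Integration.integrable_add)+
    also have "\<dots> = E"
      unfolding E_def using fj iB
      by (subst Bochner_Integration.integral_sum)
        (auto simp: fI mult_ac intro!: integrable_mult_right Bochner_Integration.integrable_add)
    finally show ?thesis using vol by (simp add: field_simps)
  qed
  then show ?thesis by blast
qed

text \<open>Used to trade the powers of an increment that occur in a Taylor expansion for the single power \<open>\<rho>\<close>: higher powers inside the ball of radius \<open>\<delta>\<close>, lower ones outside it.\<close>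

lemma powr_le_of_same_side:
  fixes t \<delta> :: real
  assumes "0 \<le> t" "0 < \<delta>" "0 < \<rho>" "(t \<le> \<delta> \<and> \<rho> \<le> a) \<or> (\<delta> \<le> t \<and> a \<le> \<rho>)"
  shows "t powr a \<le> \<delta> powr (a - \<rho>) * t powr \<rho>"
proof (cases "t = 0")
  case False
  have "(t / \<delta>) powr a \<le> (t / \<delta>) powr \<rho>"
    using assms(4)
  proof (elim disjE conjE)
    assume "t \<le> \<delta>" "\<rho> \<le> a"
    then show ?thesis using assms(1,2) by (intro powr_mono') auto
  next
    assume "\<delta> \<le> t" "a \<le> \<rho>"
    then show ?thesis using assms(2) by (intro powr_mono) auto
  qed
  then show ?thesis
    using assms False by (simp add: powr_divide powr_diff field_simps)
qed (use assms in auto)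

lemma multiplicative_kernel_powr_moment:
  fixes K :: "real^'d::finite \<Rightarrow> real"
  assumes K: "multiplicative_kernel r S K" and \<rho>: "0 < \<rho>" "\<rho> \<le> real r"
  shows "integrable lborel (\<lambda>w. \<bar>K w\<bar> * norm w powr \<rho>)"
proof (rule Bochner_Integration.integrable_bound)
  have Ki: "integrable lborel K" by (rule multiplicative_kernel_integrable[OF K])
  then have [measurable]: "K \<in> borel_measurable borel"
    by (auto dest: borel_measurable_integrable)
  show "integrable lborel (\<lambda>w. \<bar>K w\<bar> + \<bar>K w\<bar> * norm w ^ r)"
    using Ki multiplicative_kernel_moment_integrable[OF K] by auto
  show "AE w in lborel. norm (\<bar>K w\<bar> * norm w powr \<rho>) \<le> norm (\<bar>K w\<bar> + \<bar>K w\<bar> * norm w ^ r)"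
  proof (rule AE_I2)
    fix w :: "real^'d"
    have "norm w powr \<rho> \<le> norm w powr 0 + norm w powr real r"
      using \<rho> by (intro powr_le_add_powr) auto
    also have "\<dots> \<le> 1 + norm w ^ r"
      by (cases "w = 0") (auto simp: powr_realpow)
    finally have "\<bar>K w\<bar> * norm w powr \<rho> \<le> \<bar>K w\<bar> * (1 + norm w ^ r)"
      by (intro mult_left_mono) auto
    then show "norm (\<bar>K w\<bar> * norm w powr \<rho>) \<le> norm (\<bar>K w\<bar> + \<bar>K w\<bar> * norm w ^ r)"
      by (simp add: distrib_left)
  qed
  show "(\<lambda>w. \<bar>K w\<bar> * norm w powr \<rho>) \<in> borel_measurable lborel" by measurable
qed

text \<open>Markov's inequality for the moment of order \<open>\<rho>\<close>.\<close>

lemma multiplicative_kernel_tail: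
  fixes K :: "real^'d::finite \<Rightarrow> real"
  assumes K: "multiplicative_kernel r S K" and \<rho>: "0 < \<rho>" "\<rho> \<le> real r"
    and \<delta>: "0 < \<delta>" and b: "0 < b"
  shows "(LBINT w. \<bar>K w\<bar> * indicator {w. \<delta> \<le> norm (b *\<^sub>R w)} w) \<le>
    (LBINT w. \<bar>K w\<bar> * norm w powr \<rho>) / \<delta> powr \<rho> * b powr \<rho>"
proof -
  have Ki: "integrable lborel K" by (rule multiplicative_kernel_integrable[OF K])
  then have [measurable]: "K \<in> borel_measurable borel"
    by (auto dest: borel_measurable_integrable)
  have mi: "integrable lborel (\<lambda>w. \<bar>K w\<bar> * norm w powr \<rho>)"
    by (rule multiplicative_kernel_powr_moment[OF K \<rho>])
  have "(LBINT w. \<bar>K w\<bar> * indicator {w. \<delta> \<le> norm (b *\<^sub>R w)} w) \<le>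
    (LBINT w. (b / \<delta>) powr \<rho> * (\<bar>K w\<bar> * norm w powr \<rho>))"
  proof (rule integral_mono)
    show "integrable lborel (\<lambda>w. \<bar>K w\<bar> * indicator {w. \<delta> \<le> norm (b *\<^sub>R w)} w)"
      using integrable_abs[OF Ki] by (rule Bochner_Integration.integrable_bound) (auto simp: indicator_def)
    show "integrable lborel (\<lambda>w. (b / \<delta>) powr \<rho> * (\<bar>K w\<bar> * norm w powr \<rho>))"
      using mi by simp
    fix w :: "real^'d"
    show "\<bar>K w\<bar> * indicator {w. \<delta> \<le> norm (b *\<^sub>R w)} w \<le> (b / \<delta>) powr \<rho> * (\<bar>K w\<bar> * norm w powr \<rho>)"
    proof (cases "\<delta> \<le> norm (b *\<^sub>R w)")
      case True
      have "1 \<le> (b / \<delta> * norm w) powr \<rho>"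
        using True b \<delta> \<rho> by (intro ge_one_powr_ge_zero) (auto simp: field_simps)
      also have "\<dots> = (b / \<delta>) powr \<rho> * norm w powr \<rho>"
        using b \<delta> by (subst powr_mult) auto
      finally have "\<bar>K w\<bar> * 1 \<le> \<bar>K w\<bar> * ((b / \<delta>) powr \<rho> * norm w powr \<rho>)"
        by (intro mult_left_mono) auto
      then show ?thesis using True by (simp add: mult_ac)
    qed simp
  qed
  also have "\<dots> = (b / \<delta>) powr \<rho> * (LBINT w. \<bar>K w\<bar> * norm w powr \<rho>)"
    by (rule integral_mult_right_zero)
  finally show ?thesis using b \<delta> by (simp add: powr_divide mult_ac)
qed

text \<open>Let \<open>E v\<close> be the error when \<open>g (z + v)\<close> is replaced by its Taylor polynomial truncated at degree \<open>n = min (m - 1) (r - 1)\<close>. Those terms integrate to \<open>0\<close> against \<open>K\<close>. Each degree kept is at most \<open>\<rho>\<close> and each degree dropped at least \<open>\<rho>\<close>, so \<open>|E v|\<close> is bounded by a multiple of \<open>|v| powr \<rho>\<close> for all \<open>v\<close>: near \<open>0\<close> by the remainder estimate, away from \<open>0\<close> because \<open>g\<close> is bounded. The moment of order \<open>\<rho>\<close> of the kernel then gives the claim.\<close>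

lemma smooth_class_kernel_bias:
  fixes g K :: "real^'d::finite \<Rightarrow> real"
  assumes K: "multiplicative_kernel r S K"
    and g: "g \<in> smooth_class s \<Delta>" and s: "s > 0" and \<Delta>: "\<Delta> > 0"
    and B: "\<And>x. \<bar>g x\<bar> \<le> B" and [measurable]: "g \<in> borel_measurable borel"
  shows "\<exists>C\<ge>0. \<forall>b>0. \<bar>(LBINT w. K w * g (z + b *\<^sub>R w)) - g z\<bar> \<le> C * b powr min (real r) s"
proof -
  let ?\<rho> = "min (real r) s"
  have r: "1 \<le> r" and Ki: "integrable lborel K" and K1: "(LBINT w. K w) = 1"
    by (rule multiplicative_kernel_order_pos[OF K] multiplicative_kernel_integrable[OF K]
        multiplicative_kernel_integral[OF K])+
  have \<rho>: "0 < ?\<rho>" "?\<rho> \<le> real r" using r s by auto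
  have [measurable]: "K \<in> borel_measurable borel"
    using Ki by (auto dest: borel_measurable_integrable)
  have B0: "B \<ge> 0" using B[of 0] by simp
  obtain m \<delta> where m: "real m - 1 < s" "s \<le> real m" and \<delta>: "\<delta> > 0"
    and T: "\<And>x v. norm v < \<delta> \<Longrightarrow>
       \<bar>g (x + v) - g x - (\<Sum>k=1..m - 1. taylor_term g x k v)\<bar> \<le> \<Delta> * norm v powr s"
    using smooth_classE[OF g] by metis
  define n where "n = min (m - 1) (r - 1)"
  define A where "A = taylor_term_const g z"
  have A0: "0 \<le> A k" for k by (simp add: A_def taylor_term_const_nonneg)
  define E where "E = (\<lambda>v. g (z + v) - g z - (\<Sum>k=1..n. taylor_term g z k v))"
  define C where "C = \<Delta> * \<delta> powr (s - ?\<rho>) + 2 * B * \<delta> powr (- ?\<rho>) + (\<Sum>k=1..m - 1. A k * \<delta> powr (real k - ?\<rho>))"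
  have C0: "C \<ge> 0"
    unfolding C_def using \<Delta> B0 A0 by (intro add_nonneg_nonneg sum_nonneg mult_nonneg_nonneg) auto
  have term_le: "\<bar>taylor_term g z k v\<bar> \<le> A k * \<delta> powr (real k - ?\<rho>) * norm v powr ?\<rho>"
    if "(norm v \<le> \<delta> \<and> ?\<rho> \<le> real k) \<or> (\<delta> \<le> norm v \<and> real k \<le> ?\<rho>)" "k \<ge> 1" for k v
  proof -
    have "\<bar>taylor_term g z k v\<bar> \<le> A k * norm v ^ k"
      unfolding A_def by (rule abs_taylor_term_le)
    also have "norm v ^ k = norm v powr real k"
      using that(2) by (cases "v = 0") (auto simp: powr_realpow)
    also have "A k * norm v powr real k \<le> A k * (\<delta> powr (real k - ?\<rho>) * norm v powr ?\<rho>)"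
      using that \<delta> \<rho> A0 by (intro mult_left_mono powr_le_of_same_side) auto
    finally show ?thesis by (simp add: mult.assoc)
  qed
  have E_le: "\<bar>E v\<bar> \<le> C * norm v powr ?\<rho>" for v
  proof (cases "norm v < \<delta>")
    case True
    have split: "(\<Sum>k=1..m - 1. taylor_term g z k v) =
       (\<Sum>k=1..n. taylor_term g z k v) + (\<Sum>k\<in>{n<..m - 1}. taylor_term g z k v)"
      by (subst sum.union_disjoint[symmetric]) (auto simp: n_def intro!: sum.cong)
    have "\<bar>\<Sum>k\<in>{n<..m - 1}. taylor_term g z k v\<bar> \<le>
       (\<Sum>k\<in>{n<..m - 1}. A k * \<delta> powr (real k - ?\<rho>) * norm v powr ?\<rho>)"
    proof (intro order_trans[OF sum_abs] sum_mono term_le disjI1 conjI)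
      fix k assume k: "k \<in> {n<..m - 1}"
      then have "r \<le> k" by (auto simp: n_def)
      then show "?\<rho> \<le> real k" by auto
    qed (use True in auto)
    also have "\<dots> \<le> (\<Sum>k=1..m - 1. A k * \<delta> powr (real k - ?\<rho>) * norm v powr ?\<rho>)"
      using A0 by (intro sum_mono2) auto
    finally have 1: "\<bar>\<Sum>k\<in>{n<..m - 1}. taylor_term g z k v\<bar> \<le>
       (\<Sum>k=1..m - 1. A k * \<delta> powr (real k - ?\<rho>)) * norm v powr ?\<rho>"
      by (simp only: sum_distrib_right)
    have "norm v powr s \<le> \<delta> powr (s - ?\<rho>) * norm v powr ?\<rho>"
      using True \<delta> \<rho> by (intro powr_le_of_same_side) auto
    then have "\<Delta> * norm v powr s \<le> \<Delta> * (\<delta> powr (s - ?\<rho>) * norm v powr ?\<rho>)"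
      using \<Delta> by (intro mult_left_mono) auto
    then have "\<bar>E v\<bar> \<le> \<Delta> * (\<delta> powr (s - ?\<rho>) * norm v powr ?\<rho>) +
      (\<Sum>k=1..m - 1. A k * \<delta> powr (real k - ?\<rho>)) * norm v powr ?\<rho>"
      using T[OF True, of z] 1 unfolding E_def split by linarith
    also have "\<dots> = (\<Delta> * \<delta> powr (s - ?\<rho>) + (\<Sum>k=1..m - 1. A k * \<delta> powr (real k - ?\<rho>))) * norm v powr ?\<rho>"
      by (simp add: distrib_right mult.assoc)
    also have "\<dots> \<le> C * norm v powr ?\<rho>"
      unfolding C_def using B0 by (intro mult_right_mono) auto
    finally show ?thesis .
  next
    case False
    then have v: "\<delta> \<le> norm v" by simp
    have "\<bar>\<Sum>k=1..n. taylor_term g z k v\<bar> \<le>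
       (\<Sum>k=1..n. A k * \<delta> powr (real k - ?\<rho>) * norm v powr ?\<rho>)"
    proof (intro order_trans[OF sum_abs] sum_mono term_le disjI2 conjI)
      fix k assume k: "k \<in> {1..n}"
      then have "k \<le> m - 1" "k \<le> r - 1" "1 \<le> k" by (auto simp: n_def)
      then show "real k \<le> ?\<rho>" using m r by auto
    qed (use v in auto)
    also have "\<dots> \<le> (\<Sum>k=1..m - 1. A k * \<delta> powr (real k - ?\<rho>) * norm v powr ?\<rho>)"
      using A0 by (intro sum_mono2) (auto simp: n_def)
    finally have 1: "\<bar>\<Sum>k=1..n. taylor_term g z k v\<bar> \<le>
       (\<Sum>k=1..m - 1. A k * \<delta> powr (real k - ?\<rho>)) * norm v powr ?\<rho>"
      by (simp only: sum_distrib_right)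
    have "norm v powr 0 \<le> \<delta> powr (0 - ?\<rho>) * norm v powr ?\<rho>"
      using v \<delta> \<rho> by (intro powr_le_of_same_side) auto
    then have "1 \<le> \<delta> powr (- ?\<rho>) * norm v powr ?\<rho>"
      using v \<delta> by (cases "v = 0") auto
    then have "2 * B * 1 \<le> 2 * B * (\<delta> powr (- ?\<rho>) * norm v powr ?\<rho>)"
      using B0 by (intro mult_left_mono) auto
    then have "\<bar>E v\<bar> \<le> 2 * B * (\<delta> powr (- ?\<rho>) * norm v powr ?\<rho>) +
       (\<Sum>k=1..m - 1. A k * \<delta> powr (real k - ?\<rho>)) * norm v powr ?\<rho>"
      using 1 B[of "z + v"] B[of z] unfolding E_def by linarith
    also have "\<dots> = (2 * B * \<delta> powr (- ?\<rho>) + (\<Sum>k=1..m - 1. A k * \<delta> powr (real k - ?\<rho>))) * norm v powr ?\<rho>"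
      by (simp add: distrib_right mult.assoc)
    also have "\<dots> \<le> C * norm v powr ?\<rho>"
      unfolding C_def using \<Delta> by (intro mult_right_mono) auto
    finally show ?thesis .
  qed
  define M where "M = (LBINT w. \<bar>K w\<bar> * norm w powr ?\<rho>)"
  have Mi: "integrable lborel (\<lambda>w. \<bar>K w\<bar> * norm w powr ?\<rho>)"
    by (rule multiplicative_kernel_powr_moment[OF K \<rho>])
  have M0: "M \<ge> 0" unfolding M_def by (intro integral_nonneg_AE) auto
  have main: "\<bar>(LBINT w. K w * g (z + b *\<^sub>R w)) - g z\<bar> \<le> C * M * b powr ?\<rho>" if b: "b > 0" for b
  proof -
    have t0: "has_bochner_integral lborel (\<lambda>w. K w * taylor_term g z k (b *\<^sub>R w)) 0"
      if k: "k \<in> {1..n}" for k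
    proof -
      have "1 \<le> k" "k < r" using k r by (auto simp: n_def)
      then have "has_bochner_integral lborel (\<lambda>w. K w * prod_list (map (\<lambda>i. w $ i) is)) 0"
        if "is \<in> {is. length is = k}" for "is"
        using that by (intro multiplicative_kernel_monomial[OF K]) auto
      then have "has_bochner_integral lborel (\<lambda>w. \<Sum>is | length is = k. (b ^ k / fact k * iterated_partial is g z) *
          (K w * prod_list (map (\<lambda>i. w $ i) is))) (\<Sum>is | length is = k. (b ^ k / fact k * iterated_partial is g z) * 0)"
        by (intro has_bochner_integral_sum has_bochner_integral_mult_right) auto
      moreover have "(\<Sum>is | length is = k. (b ^ k / fact k * iterated_partial is g z) *
          (K w * prod_list (map (\<lambda>i. w $ i) is))) = K w * taylor_term g z k (b *\<^sub>R w)" for w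
        unfolding taylor_term_scale by (simp add: taylor_term_def sum_distrib_left sum_divide_distrib mult_ac)
      ultimately show ?thesis by simp
    qed
    have sum0: "has_bochner_integral lborel (\<lambda>w. \<Sum>k=1..n. K w * taylor_term g z k (b *\<^sub>R w)) (\<Sum>k=1..n. 0)"
      by (intro has_bochner_integral_sum t0) auto
    have Kg: "integrable lborel (\<lambda>w. K w * g (z + b *\<^sub>R w))"
    proof (rule Bochner_Integration.integrable_bound)
      show "integrable lborel (\<lambda>w. B * K w)" using Ki by simp
      show "AE w in lborel. norm (K w * g (z + b *\<^sub>R w)) \<le> norm (B * K w)"
        using B B0 by (intro AE_I2) (auto simp: abs_mult mult.commute[of B] intro!: mult_left_mono)
    qed measurable
    have Kc: "integrable lborel (\<lambda>w. K w * g z)" using Ki by simp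
    have eq: "K w * E (b *\<^sub>R w) = (K w * g (z + b *\<^sub>R w) - K w * g z) - (\<Sum>k=1..n. K w * taylor_term g z k (b *\<^sub>R w))" for w
      by (simp add: E_def right_diff_distrib sum_distrib_left)
    have Ei: "integrable lborel (\<lambda>w. K w * E (b *\<^sub>R w))"
      unfolding eq using Kg Kc sum0 by (intro Bochner_Integration.integrable_diff) (auto simp: has_bochner_integral_iff)
    have "(LBINT w. K w * E (b *\<^sub>R w)) = ((LBINT w. K w * g (z + b *\<^sub>R w)) - (LBINT w. K w * g z)) - 0"
      unfolding eq using Kg Kc sum0
      by (subst Bochner_Integration.integral_diff) (auto simp: has_bochner_integral_iff)
    then have "\<bar>(LBINT w. K w * g (z + b *\<^sub>R w)) - g z\<bar> = \<bar>LBINT w. K w * E (b *\<^sub>R w)\<bar>"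
      by (simp add: K1)
    also have "\<dots> \<le> (LBINT w. \<bar>K w * E (b *\<^sub>R w)\<bar>)" by (rule integral_abs_bound)
    also have "\<dots> \<le> (LBINT w. (C * b powr ?\<rho>) * (\<bar>K w\<bar> * norm w powr ?\<rho>))"
    proof (rule integral_mono)
      fix w :: "real^'d"
      have "\<bar>K w\<bar> * \<bar>E (b *\<^sub>R w)\<bar> \<le> \<bar>K w\<bar> * (C * norm (b *\<^sub>R w) powr ?\<rho>)"
        by (intro mult_left_mono E_le) auto
      also have "norm (b *\<^sub>R w) powr ?\<rho> = b powr ?\<rho> * norm w powr ?\<rho>"
        using b by (simp add: powr_mult)
      finally show "\<bar>K w * E (b *\<^sub>R w)\<bar> \<le> (C * b powr ?\<rho>) * (\<bar>K w\<bar> * norm w powr ?\<rho>)"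
        by (simp add: abs_mult mult_ac)
    qed (use Ei Mi in auto)
    also have "\<dots> = C * M * b powr ?\<rho>" using Mi by (simp add: M_def)
    finally show ?thesis .
  qed
  then show ?thesis using C0 M0 by (intro exI[of _ "C * M"]) auto
qed

text \<open>In the remainder estimate the increment is compared with positive powers of \<open>|v|\<close> only.\<close>

lemma smooth_class_isCont:
  fixes g :: "real^'d::finite \<Rightarrow> real"
  assumes g: "g \<in> smooth_class s \<Delta>" and s: "s > 0"
  shows "isCont g z"
proof -
  obtain m \<delta> where \<delta>: "\<delta> > 0" and T: "\<And>x v. norm v < \<delta> \<Longrightarrow>
       \<bar>g (x + v) - g x - (\<Sum>k=1..m - 1. taylor_term g x k v)\<bar> \<le> \<Delta> * norm v powr s"
    using smooth_classE[OF g] by metis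
  define E where "E = (\<lambda>v::real^'d. (\<Sum>k=1..m - 1. taylor_term_const g z k * norm v ^ k) + \<Delta> * norm v powr s)"
  have pow: "((\<lambda>v::real^'d. norm v powr s) \<longlongrightarrow> 0) (at 0)"
    using s by (intro tendsto_zero_powrI[OF _ tendsto_const]) (auto intro: tendsto_norm_zero)
  have nrm: "((\<lambda>v::real^'d. norm v) \<longlongrightarrow> norm (0::real^'d)) (at 0)"
    by (rule tendsto_norm[OF tendsto_ident_at])
  have "(E \<longlongrightarrow> (\<Sum>k=1..m - 1. taylor_term_const g z k * norm (0::real^'d) ^ k) + \<Delta> * 0) (at 0)"
    unfolding E_def by (intro tendsto_add tendsto_sum tendsto_mult tendsto_const tendsto_power nrm pow)
  moreover have "(\<Sum>k=1..m - 1. taylor_term_const g z k * norm (0::real^'d) ^ k) + \<Delta> * 0 = 0"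
    by (simp add: power_0_left)
  ultimately have E: "(E \<longlongrightarrow> 0) (at 0)" by simp
  have "((\<lambda>v. g (z + v) - g z) \<longlongrightarrow> 0) (at 0)"
  proof (rule Lim_null_comparison[OF _ E])
    show "\<forall>\<^sub>F v in at 0. norm (g (z + v) - g z) \<le> E v"
      unfolding eventually_at
    proof (intro exI[of _ \<delta>] conjI ballI impI)
      fix v :: "real^'d" assume "v \<noteq> 0 \<and> dist v 0 < \<delta>"
      then have v: "norm v < \<delta>" by simp
      have "\<bar>\<Sum>k=1..m - 1. taylor_term g z k v\<bar> \<le> (\<Sum>k=1..m - 1. taylor_term_const g z k * norm v ^ k)"
        by (intro order_trans[OF sum_abs] sum_mono abs_taylor_term_le)
      then show "norm (g (z + v) - g z) \<le> E v"
        using T[OF v, of z] unfolding E_def real_norm_def by linarith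
    qed (use \<delta> in auto)
  qed
  then have "((\<lambda>v. (g (z + v) - g z) + g z) \<longlongrightarrow> 0 + g z) (at 0)"
    by (intro tendsto_add tendsto_const)
  then show ?thesis by (simp add: isCont_iff)
qed

section \<open>Sums of covariance bounds over all lags\<close>

text \<open>For \<open>w < 1\<close> the sum is of order \<open>T powr (1 - w)\<close>. For \<open>w \<ge> 1\<close> it is bounded by a multiple of \<open>T powr \<kappa>\<close>, for any \<open>\<kappa> > 0\<close>, and the factor \<open>b powr \<epsilon>\<close> compensates for this: \<open>\<kappa>\<close> is chosen so small that the result is at most the geometric mean of \<open>b powr (- E) / T\<close> and \<open>b powr (2 * \<rho>)\<close> with weights \<open>1 - \<kappa>\<close> and \<open>\<kappa>\<close>.\<close>

lemma weighted_sum_rate: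
  fixes w E \<epsilon> \<rho> :: real
  assumes \<epsilon>: "\<epsilon> > 0" and \<rho>: "\<rho> > 0"
  shows "\<exists>C\<ge>0. \<forall>b T R. 0 < b \<longrightarrow> b \<le> 1 \<longrightarrow> 1 \<le> T \<longrightarrow> b powr (2 * \<rho>) \<le> R \<longrightarrow>
     b powr (- E) * real T powr (- min w 1) \<le> R \<longrightarrow>
     b powr (- E + \<epsilon>) * (\<Sum>k=1..T. real k powr (- w)) / real T \<le> C * R"
proof (cases "w < 1")
  case True
  obtain C where C: "C \<ge> 0" "\<And>n::nat. (\<Sum>k=1..n. real k powr (-w)) \<le> C * real n powr (1 - w)"
    using sum_powr_le[OF True] by blast
  have "b powr (- E + \<epsilon>) * (\<Sum>k=1..T. real k powr (- w)) / real T \<le> C * R"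
    if b: "0 < b" "b \<le> 1" and T: "1 \<le> T" and R: "b powr (- E) * real T powr (- min w 1) \<le> R" for b T R
  proof -
    have "b powr (- E + \<epsilon>) * (\<Sum>k=1..T. real k powr (- w)) / real T \<le>
        b powr (- E) * (C * real T powr (1 - w)) / real T"
      using b C(2)[of T] \<epsilon>
      by (intro divide_right_mono mult_mono powr_mono') (auto intro!: sum_nonneg)
    also have "\<dots> = C * (b powr (- E) * real T powr (- min w 1))"
      using T True by (simp add: powr_diff powr_minus field_simps)
    also have "\<dots> \<le> C * R" using C(1) R by (intro mult_left_mono) auto
    finally show ?thesis .
  qed
  then show ?thesis using C(1) by blast
next
  case False
  define \<kappa> where "\<kappa> = min 1 (\<epsilon> / (\<bar>E\<bar> + 2 * \<rho>))"
  have \<kappa>: "0 < \<kappa>" "\<kappa> \<le> 1" "\<kappa> * (E + 2 * \<rho>) \<le> \<epsilon>"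
  proof -
    show "0 < \<kappa>" "\<kappa> \<le> 1" using \<epsilon> \<rho> by (auto simp: \<kappa>_def)
    then have "\<kappa> * (E + 2 * \<rho>) \<le> \<kappa> * (\<bar>E\<bar> + 2 * \<rho>)" by (intro mult_left_mono) auto
    also have "\<dots> \<le> \<epsilon> / (\<bar>E\<bar> + 2 * \<rho>) * (\<bar>E\<bar> + 2 * \<rho>)"
      using \<rho> by (intro mult_right_mono) (auto simp: \<kappa>_def)
    also have "\<dots> = \<epsilon>" using \<rho> by (simp add: field_simps)
    finally show "\<kappa> * (E + 2 * \<rho>) \<le> \<epsilon>" .
  qed
  obtain C where C: "C \<ge> 0" "\<And>n::nat. (\<Sum>k=1..n. real k powr (-(1 - \<kappa>))) \<le> C * real n powr (1 - (1 - \<kappa>))"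
    using sum_powr_le[of "1 - \<kappa>"] \<kappa> by auto
  have "b powr (- E + \<epsilon>) * (\<Sum>k=1..T. real k powr (- w)) / real T \<le> C * R"
    if b: "0 < b" "b \<le> 1" and T: "1 \<le> T" and R1: "b powr (2 * \<rho>) \<le> R"
      and R: "b powr (- E) * real T powr (- min w 1) \<le> R" for b T R
  proof -
    have R0: "0 \<le> R" using R1 by (rule order_trans[rotated]) simp
    have "(\<Sum>k=1..T. real k powr (- w)) \<le> (\<Sum>k=1..T. real k powr (-(1 - \<kappa>)))"
      using False \<kappa> by (intro sum_mono powr_mono) auto
    also have "\<dots> \<le> C * real T powr \<kappa>" using C(2)[of T] by simp
    finally have S: "(\<Sum>k=1..T. real k powr (- w)) \<le> C * real T powr \<kappa>" .
    have "b powr (- E + \<epsilon>) * (\<Sum>k=1..T. real k powr (- w)) / real T \<le>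
       b powr (- E + \<kappa> * (E + 2 * \<rho>)) * (C * real T powr \<kappa>) / real T"
      using b S \<kappa> by (intro divide_right_mono mult_mono powr_mono') (auto intro!: sum_nonneg)
    also have "\<dots> = C * ((b powr (- E) * real T powr (- 1)) powr (1 - \<kappa>) * (b powr (2 * \<rho>)) powr \<kappa>)"
    proof -
      have e: "- E + \<kappa> * (E + 2 * \<rho>) = - E * (1 - \<kappa>) + 2 * \<rho> * \<kappa>" by (simp add: algebra_simps)
      have t: "real T powr \<kappa> / real T = real T powr (- 1 * (1 - \<kappa>))"
        using T by (simp add: powr_diff)
      have p: "(b powr (- E) * real T powr (- 1)) powr (1 - \<kappa>) =
          b powr (- E * (1 - \<kappa>)) * real T powr (- 1 * (1 - \<kappa>))"
        by (simp only: powr_mult powr_powr)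
      have "b powr (- E + \<kappa> * (E + 2 * \<rho>)) * (C * real T powr \<kappa>) / real T =
         C * (b powr (- E + \<kappa> * (E + 2 * \<rho>)) * (real T powr \<kappa> / real T))" by simp
      also have "\<dots> = C * ((b powr (- E) * real T powr (- 1)) powr (1 - \<kappa>) * (b powr (2 * \<rho>)) powr \<kappa>)"
        unfolding e t p powr_powr powr_add by (simp only: mult_ac)
      finally show ?thesis .
    qed
    also have "\<dots> \<le> C * (R powr (1 - \<kappa>) * R powr \<kappa>)"
      using R R1 False \<kappa> C(1) R0 by (intro mult_left_mono mult_mono powr_mono2) auto
    also have "R powr (1 - \<kappa>) * R powr \<kappa> = R"
      using R0 by (simp add: powr_add[symmetric])
    finally show ?thesis .
  qed
  then show ?thesis using C(1) by blast
qed

text \<open>\<open>R\<close> is at least each of the three terms of the rate of convergence, for a bandwidth \<open>b \<le> 1\<close>; \<open>N\<close> stands for the dimension and \<open>w\<close> for \<open>q * v\<close>.\<close>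

definition rate_bound :: "real \<Rightarrow> real \<Rightarrow> real \<Rightarrow> real \<Rightarrow> real \<Rightarrow> real \<Rightarrow> real \<Rightarrow> nat \<Rightarrow> real \<Rightarrow> bool" where
  "rate_bound N \<rho> q q' w u b T R \<longleftrightarrow> 0 < b \<and> b \<le> 1 \<and> 1 \<le> T \<and> b powr (2 * \<rho>) \<le> R \<and>
     b powr (- N) * real T powr (- min u 1) \<le> R \<and>
     b powr (- (N * (1 + q + q' * (1 - max w 1)))) * real T powr (- min w 1) \<le> R"

lemma rate_boundD:
  assumes "rate_bound N \<rho> q q' w u b T R"
  shows "0 \<le> R" "b powr \<rho> \<le> sqrt R" "b powr (- N) / real T \<le> R"
proof -
  have b: "0 < b" "1 \<le> T" "b powr (2 * \<rho>) \<le> R" and R: "b powr (- N) * real T powr (- min u 1) \<le> R"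
    using assms by (auto simp: rate_bound_def)
  show "0 \<le> R" using b(3) by (rule order_trans[rotated]) simp
  have "b powr \<rho> = sqrt (b powr (2 * \<rho>))"
    by (rule real_sqrt_unique[symmetric]) (simp_all add: power2_eq_square powr_add[symmetric])
  then show "b powr \<rho> \<le> sqrt R" using b(3) by simp
  have "b powr (- N) / real T = b powr (- N) * real T powr (- 1)"
    using b by (simp add: powr_minus divide_inverse)
  also have "\<dots> \<le> b powr (- N) * real T powr (- min u 1)"
    using b by (intro mult_left_mono powr_mono) auto
  finally show "b powr (- N) / real T \<le> R" using R by simp
qed

text \<open>The two bounds for the covariance at lag \<open>k\<close>: the first from the joint integrability of the densities, the second interpolated with the mixing bound.\<close>

definition lag_bound :: "real \<Rightarrow> real \<Rightarrow> real \<Rightarrow> real \<Rightarrow> real \<Rightarrow> real \<Rightarrow> real" where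
  "lag_bound N q q\<^sub>F w b k =
     min (b powr (- (N * (1 - q\<^sub>F)))) (b powr (- (N * (1 + q - (1 - q) * q\<^sub>F))) * k powr (- w))"

text \<open>For \<open>w < 1\<close> the second bound is used at every lag. For \<open>w \<ge> 1\<close> the first bound is used up to the lag \<open>k0 = b powr (- (N * q'))\<close>, where it sums up to at most \<open>b powr (- N)\<close>. Beyond \<open>k0\<close> the estimate \<open>k powr (- w) \<le> k0 powr (1 - w) / k\<close> produces the exponent of \<open>b\<close> in the third term of the rate, and the remaining harmonic sum is absorbed by \<open>weighted_sum_rate\<close>.\<close>

lemma mixing_sum_rate:
  assumes N: "N > 0" and \<rho>: "\<rho> > 0" and q: "0 < q" "q < 1" and qF: "0 < q\<^sub>F" and q': "0 \<le> q'" "q' \<le> q\<^sub>F"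
  shows "\<exists>C\<ge>0. \<forall>b T R. rate_bound N \<rho> q q' w u b T R \<longrightarrow>
     (\<Sum>k=1..T. lag_bound N q q\<^sub>F w b (real k)) / real T \<le> C * R"
proof -
  define E where "E = N * (1 + q + q' * (1 - max w 1))"
  define \<epsilon> where "\<epsilon> = N * ((1 - q) * q\<^sub>F)"
  have \<epsilon>: "\<epsilon> > 0" using N q qF by (simp add: \<epsilon>_def)
  obtain C where C0: "C \<ge> 0" and C: "\<And>b T R. 0 < b \<Longrightarrow> b \<le> 1 \<Longrightarrow> 1 \<le> T \<Longrightarrow> b powr (2 * \<rho>) \<le> R \<Longrightarrow>
     b powr (- E) * real T powr (- min (min w 1) 1) \<le> R \<Longrightarrow>
     b powr (- E + \<epsilon>) * (\<Sum>k=1..T. real k powr (- min w 1)) / real T \<le> C * R"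
    using weighted_sum_rate[OF \<epsilon> \<rho>, of E "min w 1"] by blast
  have "(\<Sum>k=1..T. lag_bound N q q\<^sub>F w b (real k)) / real T \<le> (C + 1) * R" (is "(\<Sum>k=1..T. ?m k) / real T \<le> _")
    if rate: "rate_bound N \<rho> q q' w u b T R" for b T R
  proof -
    have b: "0 < b" "b \<le> 1" and T: "1 \<le> T" and R1: "b powr (2 * \<rho>) \<le> R"
      and R3: "b powr (- (N * (1 + q + q' * (1 - max w 1)))) * real T powr (- min w 1) \<le> R"
      using rate by (simp_all add: rate_bound_def)
    define k0 where "k0 = b powr (- (N * q'))"
    have k0: "k0 \<ge> 1" unfolding k0_def
      using b N q' powr_mono'[of "- (N * q')" 0 b] by (auto simp: mult_nonneg_nonneg)
    have m_le: "?m k \<le> b powr (- (N * (1 - q\<^sub>F))) * of_bool (real k \<le> k0) + b powr (- E + \<epsilon>) * real k powr (- min w 1)"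
      if k: "k \<in> {1..T}" for k
    proof (cases "real k \<le> k0")
      case True
      then show ?thesis unfolding lag_bound_def by (intro min.coboundedI1) simp
    next
      case False
      have "b powr (- (N * (1 + q - (1 - q) * q\<^sub>F))) * real k powr (- w) \<le> b powr (- E + \<epsilon>) * real k powr (- min w 1)"
      proof (cases "w < 1")
        case True
        then show ?thesis by (simp add: E_def \<epsilon>_def algebra_simps)
      next
        case w: False
        have "real k powr (- w) = real k powr ((1 - w) + (- 1))" by simp
        also have "\<dots> = real k powr (1 - w) * real k powr (- 1)" by (rule powr_add)
        also have "\<dots> \<le> k0 powr (1 - w) * real k powr (- 1)"
          using False k0 w by (intro mult_right_mono powr_mono2') auto
        also have "k0 powr (1 - w) = b powr (- (N * q') * (1 - w))"
          by (simp add: k0_def powr_powr)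
        finally have "b powr (- (N * (1 + q - (1 - q) * q\<^sub>F))) * real k powr (- w) \<le>
          b powr (- (N * (1 + q - (1 - q) * q\<^sub>F))) * (b powr (- (N * q') * (1 - w)) * real k powr (- 1))"
          by (intro mult_left_mono) auto
        also have "\<dots> = b powr (- (N * (1 + q - (1 - q) * q\<^sub>F)) + - (N * q') * (1 - w)) * real k powr (- 1)"
          by (simp only: powr_add mult.assoc)
        also have "- (N * (1 + q - (1 - q) * q\<^sub>F)) + - (N * q') * (1 - w) = - E + \<epsilon>"
          using w by (simp add: E_def \<epsilon>_def algebra_simps max_def)
        finally show ?thesis using w by simp
      qed
      then show ?thesis unfolding lag_bound_def by (intro min.coboundedI2) (simp add: add_increasing)
    qed
    have "(\<Sum>k=1..T. of_bool (real k \<le> k0) :: real) \<le> k0"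
    proof -
      have "{1..T} \<inter> {k. real k \<le> k0} \<subseteq> {1..nat \<lfloor>k0\<rfloor>}"
        by (auto simp: le_nat_floor)
      then have "card ({1..T} \<inter> {k. real k \<le> k0}) \<le> nat \<lfloor>k0\<rfloor>"
        using card_mono[of "{1..nat \<lfloor>k0\<rfloor>}"] by fastforce
      also have "real (nat \<lfloor>k0\<rfloor>) \<le> k0" using k0 by simp
      finally show ?thesis by (simp add: of_bool_def sum.If_cases)
    qed
    then have c: "b powr (- (N * (1 - q\<^sub>F))) * (\<Sum>k=1..T. of_bool (real k \<le> k0)) \<le> b powr (- N)"
    proof -
      assume "(\<Sum>k=1..T. of_bool (real k \<le> k0) :: real) \<le> k0"
      then have "b powr (- (N * (1 - q\<^sub>F))) * (\<Sum>k=1..T. of_bool (real k \<le> k0)) \<le> b powr (- (N * (1 - q\<^sub>F))) * k0"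
        by (intro mult_left_mono) auto
      also have "\<dots> = b powr (- N + N * (q\<^sub>F - q'))"
        by (simp add: k0_def powr_add[symmetric] algebra_simps)
      also have "\<dots> \<le> b powr (- N)"
        using b N q' by (intro powr_mono') auto
      finally show ?thesis .
    qed
    have "(\<Sum>k=1..T. ?m k) \<le>
      (\<Sum>k=1..T. b powr (- (N * (1 - q\<^sub>F))) * of_bool (real k \<le> k0) + b powr (- E + \<epsilon>) * real k powr (- min w 1))"
      by (intro sum_mono m_le)
    also have "\<dots> = b powr (- (N * (1 - q\<^sub>F))) * (\<Sum>k=1..T. of_bool (real k \<le> k0)) +
       b powr (- E + \<epsilon>) * (\<Sum>k=1..T. real k powr (- min w 1))"
      by (simp only: sum.distrib sum_distrib_left)
    finally have "(\<Sum>k=1..T. ?m k) / real T \<le> b powr (- N) / real T +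
        b powr (- E + \<epsilon>) * (\<Sum>k=1..T. real k powr (- min w 1)) / real T"
      using c by (simp add: divide_right_mono flip: add_divide_distrib)
    also have "b powr (- N) / real T \<le> R" by (rule rate_boundD(3)[OF rate])
    also have "b powr (- E + \<epsilon>) * (\<Sum>k=1..T. real k powr (- min w 1)) / real T \<le> C * R"
      using R1 R3 b T by (intro C) (auto simp: E_def)
    finally show ?thesis by (simp add: distrib_right add.commute)
  qed
  then show ?thesis using C0 by (intro exI[of _ "C + 1"]) auto
qed

section \<open>Averages with summable covariances\<close>

lemma integrable_mult_of_squares:
  fixes a b :: "'a \<Rightarrow> real"
  assumes [measurable]: "a \<in> borel_measurable M" "b \<in> borel_measurable M"
    and "integrable M (\<lambda>x. (a x)\<^sup>2)" "integrable M (\<lambda>x. (b x)\<^sup>2)"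
  shows "integrable M (\<lambda>x. a x * b x)"
proof (rule Bochner_Integration.integrable_bound)
  show "integrable M (\<lambda>x. (a x)\<^sup>2 + (b x)\<^sup>2)" using assms by auto
  show "AE x in M. norm (a x * b x) \<le> norm ((a x)\<^sup>2 + (b x)\<^sup>2)"
  proof (rule AE_I2)
    fix x
    have "2 * \<bar>a x\<bar> * \<bar>b x\<bar> \<le> (a x)\<^sup>2 + (b x)\<^sup>2"
      using sum_squares_bound[of "\<bar>a x\<bar>" "\<bar>b x\<bar>"] by simp
    moreover have "0 \<le> \<bar>a x\<bar> * \<bar>b x\<bar>" by simp
    ultimately have "\<bar>a x\<bar> * \<bar>b x\<bar> \<le> (a x)\<^sup>2 + (b x)\<^sup>2" by linarith
    then show "norm (a x * b x) \<le> norm ((a x)\<^sup>2 + (b x)\<^sup>2)" by (simp add: abs_mult)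
  qed
qed measurable

text \<open>The mean of the absolute value is at most the root of the second moment. In the double sum each lag occurs at most twice in every row.\<close>

lemma (in prob_space) abs_mean_le_of_second_moments:
  fixes Y :: "nat \<Rightarrow> 'a \<Rightarrow> real"
  assumes Ym [measurable]: "\<And>t. Y t \<in> borel_measurable M"
    and Y2: "\<And>t. integrable M (\<lambda>\<omega>. (Y t \<omega>)\<^sup>2)"
    and diag: "\<And>t. (LINT \<omega>|M. (Y t \<omega>)\<^sup>2) \<le> c0"
    and off: "\<And>t \<tau>. t < \<tau> \<Longrightarrow> (LINT \<omega>|M. Y t \<omega> * Y \<tau> \<omega>) \<le> B (\<tau> - t)"
    and B: "\<And>k. 0 \<le> B k" and T: "1 \<le> T"
  shows "integrable M (\<lambda>\<omega>. (\<Sum>t=1..T. Y t \<omega>) / real T)"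
    and "(LINT \<omega>|M. \<bar>(\<Sum>t=1..T. Y t \<omega>) / real T\<bar>) \<le> sqrt ((c0 + 2 * (\<Sum>k=1..T. B k)) / real T)"
proof -
  have YY: "integrable M (\<lambda>\<omega>. Y t \<omega> * Y \<tau> \<omega>)" for t \<tau>
    by (rule integrable_mult_of_squares[OF Ym Ym Y2 Y2])
  define b where "b = (\<lambda>t \<tau>::nat. if t = \<tau> then c0 else B (if t < \<tau> then \<tau> - t else t - \<tau>))"
  have EY: "(LINT \<omega>|M. Y t \<omega> * Y \<tau> \<omega>) \<le> b t \<tau>" for t \<tau>
    using off[of t \<tau>] off[of \<tau> t] diag[of t]
    by (cases t \<tau> rule: linorder_cases) (auto simp: b_def power2_eq_square mult.commute)
  have row: "(\<Sum>\<tau>=1..T. b t \<tau>) \<le> c0 + 2 * (\<Sum>k=1..T. B k)" if t: "t \<in> {1..T}" for t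
  proof -
    have "{1..T} = {1..<t} \<union> ({t} \<union> {t<..T})" using t by auto
    then have "(\<Sum>\<tau>=1..T. b t \<tau>) = (\<Sum>\<tau>\<in>{1..<t} \<union> ({t} \<union> {t<..T}). b t \<tau>)" by (simp only:)
    also have "\<dots> = (\<Sum>\<tau>\<in>{1..<t}. b t \<tau>) + (b t t + (\<Sum>\<tau>\<in>{t<..T}. b t \<tau>))"
      by (subst sum.union_disjoint) auto
    also have "(\<Sum>\<tau>\<in>{1..<t}. b t \<tau>) = (\<Sum>k\<in>(\<lambda>\<tau>. t - \<tau>) ` {1..<t}. B k)"
      by (subst sum.reindex) (auto simp: b_def inj_on_def intro!: sum.cong)
    also have "\<dots> \<le> (\<Sum>k=1..T. B k)"
      using t B by (intro sum_mono2) auto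
    also have "(\<Sum>\<tau>\<in>{t<..T}. b t \<tau>) = (\<Sum>k\<in>(\<lambda>\<tau>. \<tau> - t) ` {t<..T}. B k)"
      by (subst sum.reindex) (auto simp: b_def inj_on_def intro!: sum.cong)
    also have "\<dots> \<le> (\<Sum>k=1..T. B k)"
      using t B by (intro sum_mono2) auto
    finally show ?thesis by (simp add: b_def)
  qed
  let ?S = "\<lambda>\<omega>. (\<Sum>t=1..T. Y t \<omega>)"
  have sq: "(?S \<omega>)\<^sup>2 = (\<Sum>t=1..T. \<Sum>\<tau>=1..T. Y t \<omega> * Y \<tau> \<omega>)" for \<omega>
    unfolding power2_eq_square by (rule sum_product)
  have S2: "integrable M (\<lambda>\<omega>. (?S \<omega>)\<^sup>2)"
    unfolding sq by (intro Bochner_Integration.integrable_sum YY)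
  have "(LINT \<omega>|M. (?S \<omega>)\<^sup>2) = (\<Sum>t=1..T. \<Sum>\<tau>=1..T. LINT \<omega>|M. Y t \<omega> * Y \<tau> \<omega>)"
    unfolding sq using YY by (simp add: Bochner_Integration.integral_sum)
  also have "\<dots> \<le> (\<Sum>t=1..T. \<Sum>\<tau>=1..T. b t \<tau>)"
    by (intro sum_mono EY)
  also have "\<dots> \<le> (\<Sum>t=1..T. c0 + 2 * (\<Sum>k=1..T. B k))"
    by (intro sum_mono row)
  finally have ES2: "(LINT \<omega>|M. (?S \<omega>)\<^sup>2) \<le> real T * (c0 + 2 * (\<Sum>k=1..T. B k))" by simp
  have Yi: "integrable M (Y t)" for t
    by (rule square_integrable_imp_integrable[OF Ym Y2])
  have Si: "integrable M ?S" by (intro Bochner_Integration.integrable_sum Yi)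
  then show "integrable M (\<lambda>\<omega>. ?S \<omega> / real T)" by simp
  have "(LINT \<omega>|M. \<bar>?S \<omega>\<bar>)\<^sup>2 \<le> (LINT \<omega>|M. \<bar>?S \<omega>\<bar>\<^sup>2)"
    using variance_eq[of "\<lambda>\<omega>. \<bar>?S \<omega>\<bar>"] Si S2 variance_positive[of "\<lambda>\<omega>. \<bar>?S \<omega>\<bar>"] by simp
  also have "\<dots> \<le> real T * (c0 + 2 * (\<Sum>k=1..T. B k))" using ES2 by simp
  finally have le: "(LINT \<omega>|M. \<bar>?S \<omega>\<bar>)\<^sup>2 \<le> real T * (c0 + 2 * (\<Sum>k=1..T. B k))" .
  have "(LINT \<omega>|M. \<bar>?S \<omega> / real T\<bar>) = (LINT \<omega>|M. \<bar>?S \<omega>\<bar>) / real T" by simp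
  also have "\<dots> = sqrt (((LINT \<omega>|M. \<bar>?S \<omega>\<bar>) / real T)\<^sup>2)"
    by (simp add: integral_nonneg_AE)
  also have "\<dots> \<le> sqrt ((c0 + 2 * (\<Sum>k=1..T. B k)) / real T)"
    using le T by (intro real_sqrt_le_mono) (simp add: power_divide power2_eq_square field_simps)
  finally show "(LINT \<omega>|M. \<bar>?S \<omega> / real T\<bar>) \<le> sqrt ((c0 + 2 * (\<Sum>k=1..T. B k)) / real T)" .
qed

section \<open>Kernel averages of a mixing process\<close>

text \<open>Change of variables from the probability space to Lebesgue measure.\<close>

lemma
  fixes w f :: "'b::euclidean_space \<Rightarrow> real"
  assumes D: "has_density M W f" and w: "w \<in> borel_measurable borel"
  shows has_density_integrable_iff: "integrable M (\<lambda>\<omega>. w (W \<omega>)) \<longleftrightarrow> integrable lborel (\<lambda>x. f x * w x)"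
    and has_density_integral: "(LINT \<omega>|M. w (W \<omega>)) = (LBINT x. f x * w x)"
proof -
  from D have d: "distributed M lborel W (\<lambda>x. ennreal (f x))" and f0: "\<And>x. 0 \<le> f x"
    and [measurable]: "f \<in> borel_measurable borel"
    by (auto simp: has_density_def)
  have W [measurable]: "W \<in> borel_measurable M" using distributed_measurable[OF d] by simp
  have "integrable M (\<lambda>\<omega>. w (W \<omega>)) \<longleftrightarrow> integrable (distr M lborel W) w"
    using w by (subst integrable_distr_eq) auto
  also have "\<dots> \<longleftrightarrow> integrable lborel (\<lambda>x. f x * w x)"
    unfolding distributed_distr_eq_density[OF d] using w f0
    by (subst integrable_density) auto
  finally show "integrable M (\<lambda>\<omega>. w (W \<omega>)) \<longleftrightarrow> integrable lborel (\<lambda>x. f x * w x)" .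
  show "(LINT \<omega>|M. w (W \<omega>)) = (LBINT x. f x * w x)"
    using distributed_integral[OF d, of w] w f0 by simp
qed

text \<open>The part of the assumptions that concerns the process \<open>Z\<close> and the kernel alone.\<close>

locale mixing_kernel_sample = prob_space M
  for M :: "'w measure" +
  fixes Z :: "int \<Rightarrow> 'w \<Rightarrow> real^'d::finite" and f K :: "real^'d \<Rightarrow> real"
    and f2 F :: "int \<Rightarrow> int \<Rightarrow> (real^'d) \<times> (real^'d) \<Rightarrow> real"
    and p q p\<^sub>F q\<^sub>F v S :: real and r :: nat
  assumes density: "\<And>t. has_density M (Z t) f"
    and pair_density: "\<And>t \<tau>. t \<noteq> \<tau> \<Longrightarrow> has_density M (\<lambda>\<omega>. (Z t \<omega>, Z \<tau> \<omega>)) (f2 t \<tau>)"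
    and F_eq: "\<And>t \<tau>. F t \<tau> = (\<lambda>x. f2 t \<tau> x - tensor f f x)"
    and mixing: "two_mixing M Z v"
    and p: "p > 2" and q: "q = 1 - 2 / p" and p\<^sub>F: "p\<^sub>F > 2" and q\<^sub>F: "q\<^sub>F = 1 - 2 / p\<^sub>F"
    and F_Lp: "\<exists>C. \<forall>t \<tau>. t \<noteq> \<tau> \<longrightarrow> in_Lp p\<^sub>F (F t \<tau>) \<and> Lp_norm p\<^sub>F (F t \<tau>) \<le> C"
    and K: "multiplicative_kernel r S K" and K_Lp: "in_Lp p K"
begin

lemma f_measurable [measurable]: "f \<in> borel_measurable borel"
  and f_nonneg: "0 \<le> f x"
  using density[of 0] by (auto simp: has_density_def)

lemma Z_measurable [measurable]: "Z t \<in> borel_measurable M"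
proof -
  have "distributed M lborel (Z t) (\<lambda>x. ennreal (f x))" using density by (auto simp: has_density_def)
  from distributed_measurable[OF this] show ?thesis by simp
qed

lemma K_integrable: "integrable lborel K"
  by (rule multiplicative_kernel_integrable[OF K])

lemma K_measurable [measurable]: "K \<in> borel_measurable borel"
  using K_integrable by (auto dest: borel_measurable_integrable)

lemma K_powr_integrable: "integrable lborel (\<lambda>x. \<bar>K x\<bar> powr p)"
  using K_Lp by (simp add: in_Lp_def)

lemma q_bounds: "0 < q" "q < 1" "0 < q\<^sub>F" "q\<^sub>F < 1"
  using p p\<^sub>F by (auto simp: q q\<^sub>F)

lemma f_integrable: "integrable lborel f"
  using has_density_integrable_iff[OF density, of "\<lambda>_. 1" 0] by simp

text \<open>This is why \<open>F\<close> governs covariances: for square integrable weights the right-hand side is \<open>Cov(a(Z\<^sub>t), b(Z\<^sub>\<tau>))\<close>.\<close>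

lemma pair_deviation:
  assumes t: "t \<noteq> \<tau>" and a [measurable]: "a \<in> borel_measurable borel" and b [measurable]: "b \<in> borel_measurable borel"
    and ai: "integrable lborel (\<lambda>x. f x * a x)" and bi: "integrable lborel (\<lambda>x. f x * b x)"
    and ab: "integrable M (\<lambda>\<omega>. a (Z t \<omega>) * b (Z \<tau> \<omega>))"
  shows "(LBINT z. a (fst z) * b (snd z) * F t \<tau> z) =
    (LINT \<omega>|M. a (Z t \<omega>) * b (Z \<tau> \<omega>)) - (LBINT x. f x * a x) * (LBINT x. f x * b x)"
proof -
  have m: "(\<lambda>z. a (fst z) * b (snd z)) \<in> borel_measurable borel" by measurable
  have 1: "integrable lborel (\<lambda>z. f2 t \<tau> z * (a (fst z) * b (snd z)))"
    using has_density_integrable_iff[OF pair_density[OF t] m] ab by simp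
  have 2: "(LBINT z. f2 t \<tau> z * (a (fst z) * b (snd z))) = (LINT \<omega>|M. a (Z t \<omega>) * b (Z \<tau> \<omega>))"
    using has_density_integral[OF pair_density[OF t] m] by simp
  have "(LBINT z. a (fst z) * b (snd z) * F t \<tau> z) =
     (LBINT z. f2 t \<tau> z * (a (fst z) * b (snd z)) - f (fst z) * a (fst z) * (f (snd z) * b (snd z)))"
    by (intro Bochner_Integration.integral_cong) (auto simp: F_eq tensor_def algebra_simps)
  also have "\<dots> = (LBINT z. f2 t \<tau> z * (a (fst z) * b (snd z))) -
     (LBINT z. f (fst z) * a (fst z) * (f (snd z) * b (snd z)))"
    using 1 integrable_tensor[OF ai bi] by (rule Bochner_Integration.integral_diff)
  finally show ?thesis
    using integral_tensor[OF ai bi] by (simp add: 2)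
qed

lemma F_integrable:
  assumes t: "t \<noteq> \<tau>"
  shows "integrable lborel (F t \<tau>)"
proof -
  have "integrable lborel (f2 t \<tau>)"
    using has_density_integrable_iff[OF pair_density[OF t], of "\<lambda>_. 1"] by simp
  moreover have "integrable lborel (tensor f f)"
    using integrable_tensor[OF f_integrable f_integrable] by (simp add: tensor_def case_prod_beta')
  ultimately show ?thesis unfolding F_eq by (rule Bochner_Integration.integrable_diff)
qed

text \<open>For indicator functions the form with kernel \<open>F\<close> is \<open>P(A \<inter> B) - P(A) P(B)\<close>, and preimages under \<open>Z t\<close> belong to its sigma-algebra.\<close>

lemma F_mixing:
  "\<exists>C\<ge>0. \<forall>t \<tau>. t \<noteq> \<tau> \<longrightarrow> (\<forall>A\<in>sets borel. \<forall>B\<in>sets borel.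
     \<bar>LBINT z. indicator A (fst z) * indicator B (snd z) * F t \<tau> z\<bar> \<le> C * real_of_int \<bar>t - \<tau>\<bar> powr (- v))"
proof -
  from mixing obtain C where C: "\<forall>t \<tau>. t \<noteq> \<tau> \<longrightarrow>
     (\<forall>A\<in>sets (rv_sigma M (Z t)). \<forall>B\<in>sets (rv_sigma M (Z \<tau>)).
       \<bar>measure M (A \<inter> B) - measure M A * measure M B\<bar> \<le> C * real_of_int \<bar>t - \<tau>\<bar> powr (- v))"
    unfolding two_mixing_def by (elim exE)
  have main: "\<bar>LBINT z. indicator A (fst z) * indicator B (snd z) * F t \<tau> z\<bar> \<le> C * real_of_int \<bar>t - \<tau>\<bar> powr (- v)"
    if t: "t \<noteq> \<tau>" and A [measurable]: "A \<in> sets borel" and B [measurable]: "B \<in> sets borel" for t \<tau> A B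
  proof -
    let ?A = "Z t -` A \<inter> space M" and ?B = "Z \<tau> -` B \<inter> space M"
    have i: "integrable lborel (\<lambda>x. f x * indicator D x)" if [measurable]: "D \<in> sets borel" for D
      using f_integrable by (rule Bochner_Integration.integrable_bound) (auto simp: indicator_def)
    have ab: "(LINT \<omega>|M. indicator A (Z t \<omega>) * indicator B (Z \<tau> \<omega>)) = (measure M (?A \<inter> ?B) :: real)"
    proof -
      have "(LINT \<omega>|M. indicator A (Z t \<omega>) * indicator B (Z \<tau> \<omega>)) = (LINT \<omega>|M. (indicator (?A \<inter> ?B) \<omega> :: real))"
        by (intro Bochner_Integration.integral_cong) (auto simp: indicator_def)
      then show ?thesis by simp
    qed
    have one: "(LBINT x. f x * indicator D x) = measure M (Z i -` D \<inter> space M)"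
      if [measurable]: "D \<in> sets borel" for D i
    proof -
      have "(LBINT x. f x * indicator D x) = (LINT \<omega>|M. indicator D (Z i \<omega>))"
        by (subst has_density_integral[OF density[of i]]) auto
      also have "\<dots> = (LINT \<omega>|M. indicator (Z i -` D \<inter> space M) \<omega>)"
        by (intro Bochner_Integration.integral_cong) (auto simp: indicator_def)
      finally show ?thesis by simp
    qed
    have int: "integrable M (\<lambda>\<omega>. indicator A (Z t \<omega>) * indicator B (Z \<tau> \<omega>) :: real)"
      by (rule integrable_const_bound[of _ 1]) (auto simp: indicator_def)
    have "(LBINT z. indicator A (fst z) * indicator B (snd z) * F t \<tau> z) =
       measure M (?A \<inter> ?B) - measure M ?A * measure M ?B"
      using pair_deviation[OF t _ _ i[OF A] i[OF B] int] ab one[OF A, of t] one[OF B, of \<tau>] by simp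
    moreover have "?A \<in> sets (rv_sigma M (Z t))" "?B \<in> sets (rv_sigma M (Z \<tau>))"
      unfolding rv_sigma_def by (rule in_vimage_algebra, fact)+
    ultimately show ?thesis using C t by simp
  qed
  have "0 \<le> C" using main[of 0 1 "{}" "{}"] by simp
  with main show ?thesis by (intro exI[of _ C] conjI allI impI ballI)
qed

text \<open>After rescaling, \<open>u\<close> is dominated by \<open>k x = K ((x - z) / b)\<close>, whose integral and whose integral of the power \<open>p\<close> are both of order \<open>b\<^sup>d\<close>, so Hoelder's inequality and \<open>mixing_interpolation\<close> apply with \<open>m\<close> of this order. The prefactor \<open>b powr (- 2 * d)\<close> of the two kernels combines with the powers of \<open>m\<close> to the exponents in \<open>lag_bound\<close>.\<close>

lemma bilinear_form_bounds:
  "\<exists>C\<ge>0. \<forall>t \<tau> b u A. t \<noteq> \<tau> \<longrightarrow> 0 < b \<longrightarrow> 0 < A \<longrightarrow> u \<in> borel_measurable borel \<longrightarrow>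
     (\<forall>x. \<bar>u x\<bar> \<le> A * \<bar>scaled_kernel K b (x - z)\<bar>) \<longrightarrow>
     \<bar>LBINT x. u (fst x) * u (snd x) * F t \<tau> x\<bar> \<le> C * A\<^sup>2 * lag_bound (real CARD('d)) q q\<^sub>F (q * v) b (real_of_int \<bar>t - \<tau>\<bar>)"
proof -
  from F_mixing obtain C\<alpha> where C\<alpha>0: "C\<alpha> \<ge> 0" and C\<alpha>': "\<forall>t \<tau>. t \<noteq> \<tau> \<longrightarrow> (\<forall>A\<in>sets borel. \<forall>B\<in>sets borel.
     \<bar>LBINT z. indicator A (fst z) * indicator B (snd z) * F t \<tau> z\<bar> \<le> C\<alpha> * real_of_int \<bar>t - \<tau>\<bar> powr (- v))"
    by (elim exE conjE)
  have C\<alpha>: "\<bar>LBINT z. indicator A (fst z) * indicator B (snd z) * F t \<tau> z\<bar> \<le> C\<alpha> * real_of_int \<bar>t - \<tau>\<bar> powr (- v)"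
    if "t \<noteq> \<tau>" "A \<in> sets borel" "B \<in> sets borel" for t \<tau> A B
    using C\<alpha>' that by simp
  from F_Lp obtain N where N': "\<forall>t \<tau>. t \<noteq> \<tau> \<longrightarrow> in_Lp p\<^sub>F (F t \<tau>) \<and> Lp_norm p\<^sub>F (F t \<tau>) \<le> N"
    by (elim exE)
  have FLp: "in_Lp p\<^sub>F (F t \<tau>)" and N: "Lp_norm p\<^sub>F (F t \<tau>) \<le> N" if "t \<noteq> \<tau>" for t \<tau>
    using N' that by simp_all
  have N0: "0 \<le> N" using N[of 0 1] by (rule order_trans[rotated]) (simp_all add: Lp_norm_def)
  \<comment> \<open>the conjugate exponent of \<open>p\<^sub>F\<close>; it is below \<open>2\<close> because \<open>p\<^sub>F > 2\<close>\<close>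
  define s where "s = p\<^sub>F / (p\<^sub>F - 1)"
  have s: "s > 1" "1 / p\<^sub>F + 1 / s = 1" "1 / s = (1 + q\<^sub>F) / 2"
    using p\<^sub>F by (auto simp: s_def q\<^sub>F field_simps)
  have s2: "s < 2" using p\<^sub>F by (simp add: s_def field_simps)
  have q': "1 - q = 2 / p" "1 - 2 / p = q" by (simp_all add: q)
  define m0 where "m0 = (LBINT x. \<bar>K x\<bar>) + (LBINT x. \<bar>K x\<bar> powr p)"
  have m0: "(LBINT x. \<bar>K x\<bar>) \<le> m0" "(LBINT x. \<bar>K x\<bar> powr p) \<le> m0" "m0 \<ge> 0"
    by (auto simp: m0_def)
  define C1 where "C1 = N * (m0 * m0) powr (1 / s)"
  define C2 where "C2 = interp_const p s * C\<alpha> powr q * N powr (2/p) * m0 powr (4 / (p * s))"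
  have C1: "C1 \<ge> 0" using N0 by (simp add: C1_def)
  let ?d = "real CARD('d)"
  have main: "\<bar>LBINT x. u (fst x) * u (snd x) * F t \<tau> x\<bar> \<le> A\<^sup>2 * (C1 * b powr (- (?d * (1 - q\<^sub>F)))) \<and>
     \<bar>LBINT x. u (fst x) * u (snd x) * F t \<tau> x\<bar> \<le>
       A\<^sup>2 * (C2 * (b powr (- (?d * (1 + q - (1 - q) * q\<^sub>F))) * real_of_int \<bar>t - \<tau>\<bar> powr (- (q * v))))"
    if t: "t \<noteq> \<tau>" and b: "0 < b" and A: "0 < A" and u [measurable]: "u \<in> borel_measurable borel"
      and uA: "\<And>x. \<bar>u x\<bar> \<le> A * \<bar>scaled_kernel K b (x - z)\<bar>" for t \<tau> b u A
  proof -
    define k where "k = (\<lambda>x. K ((x - z) /\<^sub>R b))"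
    define u' where "u' = (\<lambda>x. u x * b ^ CARD('d) / A)"
    have km [measurable]: "k \<in> borel_measurable borel" and um [measurable]: "u' \<in> borel_measurable borel"
      unfolding k_def u'_def by measurable
    have u'k: "\<bar>u' x\<bar> \<le> \<bar>k x\<bar>" for x
      using uA[of x] A b by (simp add: u'_def k_def scaled_kernel_def abs_mult field_simps)
    have k_eq: "k (z + b *\<^sub>R x) = K x" for x
      using b by (simp add: k_def)
    have scale: "integrable lborel (\<lambda>x. h (k x)) \<and> (LBINT x. h (k x)) = b ^ CARD('d) * (LBINT x. h (K x))"
      if "integrable lborel (\<lambda>x. h (K x))" and [measurable]: "h \<in> borel_measurable borel" for h :: "real \<Rightarrow> real"
      using that(1) integrable_affine_iff[of "\<lambda>x. h (k x)" b z] integral_affine[of "\<lambda>x. h (k x)" b z] b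
      by (simp add: k_eq)
    define m where "m = b ^ CARD('d) * m0"
    have bm: "b ^ CARD('d) = b powr ?d" using b by (simp add: powr_realpow)
    have m0': "m \<ge> 0" using b m0 by (simp add: m_def)
    have k1: "integrable lborel (\<lambda>x. \<bar>k x\<bar>)" "(LBINT x. \<bar>k x\<bar>) \<le> m"
      using scale[of abs] K_integrable m0 b by (auto simp: m_def intro: mult_left_mono)
    have kp: "integrable lborel (\<lambda>x. \<bar>k x\<bar> powr p)" "(LBINT x. \<bar>k x\<bar> powr p) \<le> m"
      using scale[of "\<lambda>x. \<bar>x\<bar> powr p"] K_powr_integrable m0 b by (auto simp: m_def intro: mult_left_mono)
    have us_le: "\<bar>u' x\<bar> powr s \<le> \<bar>k x\<bar> + \<bar>k x\<bar> powr p" for x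
      using powr_le_add_powr[of "\<bar>k x\<bar>" 1 s p] powr_mono2[of s "\<bar>u' x\<bar>" "\<bar>k x\<bar>"] u'k[of x] s s2 p by simp
    have us: "integrable lborel (\<lambda>x. \<bar>u' x\<bar> powr s)"
      by (rule Bochner_Integration.integrable_bound[OF Bochner_Integration.integrable_add[OF k1(1) kp(1)]])
        (use us_le in \<open>auto intro!: AE_I2\<close>)
    have usI: "(LBINT x. \<bar>u' x\<bar> powr s) \<le> m"
    proof -
      have "(LBINT x. \<bar>u' x\<bar> powr s) \<le> (LBINT x. \<bar>k x\<bar> + \<bar>k x\<bar> powr p)"
        using us k1 kp us_le by (intro integral_mono) auto
      also have "\<dots> = m"
        using k1 kp scale[of abs] scale[of "\<lambda>x. \<bar>x\<bar> powr p"] K_integrable K_powr_integrable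
        by (simp add: m_def m0_def distrib_left)
      finally show ?thesis .
    qed
    have Fi: "integrable lborel (F t \<tau>)" by (rule F_integrable[OF t])
    then have Fm: "F t \<tau> \<in> borel_measurable borel" by (auto dest: borel_measurable_integrable)
    have FP: "integrable lborel (\<lambda>x. \<bar>F t \<tau> x\<bar> powr p\<^sub>F)" using FLp[OF t] by (simp add: in_Lp_def)
    have FN: "(LBINT x. \<bar>F t \<tau> x\<bar> powr p\<^sub>F) powr (1 / p\<^sub>F) \<le> N"
      using N[OF t] by (simp add: Lp_norm_def)
    have p1: "p\<^sub>F > 1" using p\<^sub>F by simp
    let ?I = "\<bar>LBINT x. u' (fst x) * u' (snd x) * F t \<tau> x\<bar>"
    have H: "?I \<le> N * (m * m) powr (1/s)"
    proof -
      have "?I \<le> (LBINT x. \<bar>F t \<tau> x\<bar> powr p\<^sub>F) powr (1/p\<^sub>F) *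
        ((LBINT x. \<bar>u' x\<bar> powr s) * (LBINT x. \<bar>u' x\<bar> powr s)) powr (1/s)"
        by (rule Holder_bilinear_form(2)[OF p1 s(1,2) Fm FP _ us _ us]) measurable
      also have "\<dots> \<le> N * (m * m) powr (1/s)"
        using FN usI N0 s m0' by (intro mult_mono powr_mono2) auto
      finally show ?thesis .
    qed
    have D: "?I \<le> interp_const p s * (C\<alpha> * real_of_int \<bar>t - \<tau>\<bar> powr (- v)) powr (1 - 2/p) * N powr (2/p) * m powr (4 / (p * s))"
      by (rule mixing_interpolation[OF p p\<^sub>F s(1,2) Fi FP FN C\<alpha>[OF t] km um u'k k1 kp])
    have bb: "(A / b ^ CARD('d))\<^sup>2 = A\<^sup>2 * b powr (- 2 * ?d)"
    proof -
      have "(b powr ?d)\<^sup>2 = b powr (2 * ?d)" by (simp add: power2_eq_square powr_add[symmetric])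
      then show ?thesis using b by (simp add: bm power_divide powr_minus divide_inverse power_mult_distrib power_inverse)
    qed
    have "(LBINT x. u (fst x) * u (snd x) * F t \<tau> x) =
       (LBINT x. (A / b ^ CARD('d))\<^sup>2 * (u' (fst x) * u' (snd x) * F t \<tau> x))"
      using A b by (intro Bochner_Integration.integral_cong) (auto simp: u'_def power2_eq_square)
    also have "\<dots> = (A / b ^ CARD('d))\<^sup>2 * (LBINT x. u' (fst x) * u' (snd x) * F t \<tau> x)"
      by (rule integral_mult_right_zero)
    finally have uu: "\<bar>LBINT x. u (fst x) * u (snd x) * F t \<tau> x\<bar> = A\<^sup>2 * (b powr (- 2 * ?d) * ?I)"
      unfolding bb by (simp add: abs_mult mult.assoc)
    have e1: "b powr (- 2 * ?d) * (N * (m * m) powr (1/s)) = C1 * b powr (- (?d * (1 - q\<^sub>F)))"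
    proof -
      have "m * m = (m0 * m0) * b powr (2 * ?d)"
        by (simp add: m_def bm powr_add[symmetric] mult_ac)
      then have "b powr (- 2 * ?d) * (N * (m * m) powr (1/s)) = C1 * (b powr (- 2 * ?d) * b powr (2 * ?d * (1/s)))"
        by (simp only: powr_mult powr_powr C1_def mult_ac)
      also have "b powr (- 2 * ?d) * b powr (2 * ?d * (1/s)) = b powr (- (?d * (1 - q\<^sub>F)))"
      proof -
        have "- 2 * ?d + 2 * ?d * (1/s) = - (?d * (1 - q\<^sub>F))"
          unfolding s(3) by (simp add: field_simps)
        then show ?thesis by (simp only: powr_add[symmetric])
      qed
      finally show ?thesis .
    qed
    have e2: "b powr (- 2 * ?d) * (interp_const p s * (C\<alpha> * real_of_int \<bar>t - \<tau>\<bar> powr (- v)) powr q * N powr (2/p) * m powr (4 / (p * s)))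
       = C2 * (b powr (- (?d * (1 + q - (1 - q) * q\<^sub>F))) * real_of_int \<bar>t - \<tau>\<bar> powr (- (q * v)))"
    proof -
      have "b powr (- 2 * ?d) * (interp_const p s * (C\<alpha> * real_of_int \<bar>t - \<tau>\<bar> powr (- v)) powr q * N powr (2/p) * m powr (4 / (p * s)))
        = C2 * ((b powr (- 2 * ?d) * b powr (?d * (4 / (p * s)))) * real_of_int \<bar>t - \<tau>\<bar> powr (- v * q))"
        unfolding m_def bm C2_def by (simp only: powr_mult powr_powr mult_ac)
      also have "b powr (- 2 * ?d) * b powr (?d * (4 / (p * s))) = b powr (- (?d * (1 + q - (1 - q) * q\<^sub>F)))"
      proof -
        have s': "2 * (1 / s) = 1 + q\<^sub>F" using s(3) by simp
        have "4 / (p * s) = (2 / p) * (2 * (1 / s))" by simp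
        also have "\<dots> = (1 - q) * (1 + q\<^sub>F)"
          by (simp only: s' q'(1))
        finally have "- 2 * ?d + ?d * (4 / (p * s)) = - (?d * (1 + q - (1 - q) * q\<^sub>F))"
          by (simp only:) (simp add: algebra_simps)
        then show ?thesis by (simp only: powr_add[symmetric])
      qed
      finally show ?thesis by (simp add: mult.commute)
    qed
    show ?thesis
    proof
      show "\<bar>LBINT x. u (fst x) * u (snd x) * F t \<tau> x\<bar> \<le> A\<^sup>2 * (C1 * b powr (- (?d * (1 - q\<^sub>F))))"
        unfolding uu e1[symmetric] by (intro mult_left_mono H) auto
      show "\<bar>LBINT x. u (fst x) * u (snd x) * F t \<tau> x\<bar> \<le>
         A\<^sup>2 * (C2 * (b powr (- (?d * (1 + q - (1 - q) * q\<^sub>F))) * real_of_int \<bar>t - \<tau>\<bar> powr (- (q * v))))"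
        unfolding uu e2[symmetric] by (intro mult_left_mono D[unfolded q'(2)]) auto
    qed
  qed
  show ?thesis
  proof (intro exI[of _ "max C1 C2"] conjI allI impI)
    show "0 \<le> max C1 C2" using C1 by simp
    fix t \<tau> :: int and b A :: real and u :: "real^'d \<Rightarrow> real"
    assume t: "t \<noteq> \<tau>" and b: "0 < b" and A: "0 < A" and u: "u \<in> borel_measurable borel"
      and uA: "\<forall>x. \<bar>u x\<bar> \<le> A * \<bar>scaled_kernel K b (x - z)\<bar>"
    let ?I = "\<bar>LBINT x. u (fst x) * u (snd x) * F t \<tau> x\<bar>"
    let ?X = "b powr (- (?d * (1 - q\<^sub>F)))"
    let ?Y = "b powr (- (?d * (1 + q - (1 - q) * q\<^sub>F))) * real_of_int \<bar>t - \<tau>\<bar> powr (- (q * v))"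
    have "C1 * ?X \<le> max C1 C2 * ?X" "C2 * ?Y \<le> max C1 C2 * ?Y"
      by (intro mult_right_mono; simp)+
    then have "A\<^sup>2 * (C1 * ?X) \<le> A\<^sup>2 * (max C1 C2 * ?X)" "A\<^sup>2 * (C2 * ?Y) \<le> A\<^sup>2 * (max C1 C2 * ?Y)"
      by (intro mult_left_mono; simp)+
    then have "?I \<le> max C1 C2 * A\<^sup>2 * ?X" "?I \<le> max C1 C2 * A\<^sup>2 * ?Y"
      using main[OF t b A u] uA by (auto simp: mult_ac intro: order_trans)
    then show "?I \<le> max C1 C2 * A\<^sup>2 * lag_bound ?d q q\<^sub>F (q * v) b (real_of_int \<bar>t - \<tau>\<bar>)"
      by (simp add: lag_bound_def min_def)
  qed
qed

end

lemma
  fixes K g :: "real^'d::finite \<Rightarrow> real"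
  assumes [measurable]: "K \<in> borel_measurable borel" "g \<in> borel_measurable borel" and b: "b > 0"
  shows integrable_scaled_kernel_iff:
      "integrable lborel (\<lambda>x. scaled_kernel K b (x - z) * g x) \<longleftrightarrow> integrable lborel (\<lambda>w. K w * g (z + b *\<^sub>R w))"
    and integral_scaled_kernel:
      "(LBINT x. scaled_kernel K b (x - z) * g x) = (LBINT w. K w * g (z + b *\<^sub>R w))"
proof -
  have [measurable]: "(\<lambda>x. scaled_kernel K b (x - z)) \<in> borel_measurable borel"
    unfolding scaled_kernel_def by measurable
  have m: "(\<lambda>x. scaled_kernel K b (x - z) * g x) \<in> borel_measurable borel" by measurable
  have eq: "scaled_kernel K b (z + b *\<^sub>R w - z) * g (z + b *\<^sub>R w) = K w * g (z + b *\<^sub>R w) / b ^ CARD('d)" for w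
    using b by (simp add: scaled_kernel_def)
  show "integrable lborel (\<lambda>x. scaled_kernel K b (x - z) * g x) \<longleftrightarrow> integrable lborel (\<lambda>w. K w * g (z + b *\<^sub>R w))"
    using integrable_affine_iff[OF m b, of z] b unfolding eq by (simp add: divide_inverse integrable_mult_left_iff)
  show "(LBINT x. scaled_kernel K b (x - z) * g x) = (LBINT w. K w * g (z + b *\<^sub>R w))"
    using integral_affine[OF m b, of z] b unfolding eq by simp
qed

text \<open>The form in which the near part \<open>Y\<close>, the far part \<open>W\<close> and the bias \<open>k\<close> of a kernel average are put together.\<close>

lemma (in prob_space) abs_mean_split_le:
  fixes Y W :: "nat \<Rightarrow> 'a \<Rightarrow> real"
  assumes T: "1 \<le> T"
    and Yi: "integrable M (\<lambda>\<omega>. (\<Sum>t=1..T. Y t \<omega>) / real T)" and Y: "(LINT \<omega>|M. \<bar>(\<Sum>t=1..T. Y t \<omega>) / real T\<bar>) \<le> y"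
    and Wi: "\<And>t. integrable M (W t)" and W: "\<And>t. (LINT \<omega>|M. \<bar>W t \<omega>\<bar>) \<le> w"
    and L: "\<And>\<omega>. L \<omega> = (\<Sum>t=1..T. Y t \<omega>) / real T + (\<Sum>t=1..T. W t \<omega>) / real T + k"
  shows "integrable M L \<and> (LINT \<omega>|M. \<bar>L \<omega>\<bar>) \<le> y + w + \<bar>k\<bar>"
proof
  have LW: "L = (\<lambda>\<omega>. (\<Sum>t=1..T. Y t \<omega>) / real T + (\<Sum>t=1..T. W t \<omega>) / real T + k)"
    using L by (rule ext)
  show Li: "integrable M L"
    unfolding LW by (rule Bochner_Integration.integrable_add[OF Bochner_Integration.integrable_add[OF Yi]])
      (intro integrable_divide Bochner_Integration.integrable_sum Wi, simp)
  define V where "V = (\<lambda>\<omega>. (\<Sum>t=1..T. \<bar>W t \<omega>\<bar>) / real T)"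
  have Vi: "integrable M V"
    unfolding V_def by (intro integrable_divide Bochner_Integration.integrable_sum integrable_abs Wi)
  have L_le: "\<bar>L \<omega>\<bar> \<le> \<bar>(\<Sum>t=1..T. Y t \<omega>) / real T\<bar> + V \<omega> + \<bar>k\<bar>" for \<omega>
  proof -
    have "\<bar>(\<Sum>t=1..T. W t \<omega>) / real T\<bar> \<le> V \<omega>"
      unfolding V_def abs_divide using T by (intro divide_mono sum_abs) auto
    then show ?thesis unfolding L by linarith
  qed
  have "(LINT \<omega>|M. V \<omega>) = (\<Sum>t=1..T. LINT \<omega>|M. \<bar>W t \<omega>\<bar>) / real T"
    unfolding V_def using Wi by (simp add: Bochner_Integration.integral_sum)
  also have "\<dots> \<le> (\<Sum>t=1..T. w) / real T"
    by (intro divide_right_mono sum_mono W) auto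
  also have "\<dots> = w" using T by simp
  finally have VI: "(LINT \<omega>|M. V \<omega>) \<le> w" .
  have "(LINT \<omega>|M. \<bar>L \<omega>\<bar>) \<le> (LINT \<omega>|M. \<bar>(\<Sum>t=1..T. Y t \<omega>) / real T\<bar> + V \<omega> + \<bar>k\<bar>)"
    by (rule integral_mono[OF integrable_abs[OF Li] _ L_le])
      (intro Bochner_Integration.integrable_add integrable_abs Yi Vi integrable_const)
  also have "\<dots> = (LINT \<omega>|M. \<bar>(\<Sum>t=1..T. Y t \<omega>) / real T\<bar>) + (LINT \<omega>|M. V \<omega>) + \<bar>k\<bar>"
    using integrable_abs[OF Yi] Vi by (simp add: prob_space)
  finally show "(LINT \<omega>|M. \<bar>L \<omega>\<bar>) \<le> y + w + \<bar>k\<bar>" using Y VI by linarith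
qed

context mixing_kernel_sample
begin

text \<open>\<open>L b T = O(sqrt R)\<close> in mean, uniformly in the bandwidth and the sample size.\<close>

definition L1_rate :: "real \<Rightarrow> real \<Rightarrow> real \<Rightarrow> (real \<Rightarrow> nat \<Rightarrow> 'w \<Rightarrow> real) \<Rightarrow> bool" where
  "L1_rate \<rho> q' u L \<longleftrightarrow> (\<exists>C\<ge>0. \<forall>b T R. rate_bound (real CARD('d)) \<rho> q q' (q * v) u b T R \<longrightarrow>
     integrable M (L b T) \<and> (LINT \<omega>|M. \<bar>L b T \<omega>\<bar>) \<le> C * sqrt R)"

lemma scaled_kernel_measurable [measurable]: "scaled_kernel K b \<in> borel_measurable borel"
  unfolding scaled_kernel_def by measurable

lemma K_square_integrable: "integrable lborel (\<lambda>x. (K x)\<^sup>2)"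
proof (rule Bochner_Integration.integrable_bound)
  show "integrable lborel (\<lambda>x. \<bar>K x\<bar> + \<bar>K x\<bar> powr p)"
    using K_integrable K_powr_integrable by auto
  have "(K x)\<^sup>2 \<le> \<bar>K x\<bar> + \<bar>K x\<bar> powr p" for x
    using powr_le_add_powr[of "\<bar>K x\<bar>" 1 2 p] p
    by (cases "K x = 0") (auto simp: powr_numeral)
  then show "AE x in lborel. norm ((K x)\<^sup>2) \<le> norm (\<bar>K x\<bar> + \<bar>K x\<bar> powr p)"
    by (intro AE_I2) simp
qed measurable

text \<open>Substitution \<open>x = z + b w\<close>: the square of the scaled kernel costs a factor \<open>b powr (- d)\<close>, its absolute value costs none.\<close>

lemma
  assumes b: "b > 0" and u [measurable]: "u \<in> borel_measurable borel" and A: "0 \<le> A"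
    and uA: "\<And>x. \<bar>u x\<bar> \<le> A * \<bar>scaled_kernel K b (x - z)\<bar>" and fB: "\<And>x. f x \<le> B"
  shows local_second_moment_integrable: "integrable lborel (\<lambda>x. f x * (u x)\<^sup>2)"
    and local_second_moment_le: "(LBINT x. f x * (u x)\<^sup>2) \<le> B * A\<^sup>2 * (LBINT x. (K x)\<^sup>2) * b powr (- real CARD('d))"
    and local_first_moment_integrable: "integrable lborel (\<lambda>x. f x * u x)"
    and local_first_moment_le: "(LBINT x. f x * \<bar>u x\<bar>) \<le> B * A * (LBINT x. \<bar>K x\<bar>)"
proof -
  let ?k = "\<lambda>x. scaled_kernel K b (x - z)"
  have B: "0 \<le> B" using f_nonneg[of 0] fB[of 0] by simp
  have absk: "\<bar>?k x\<bar> = scaled_kernel (\<lambda>w. \<bar>K w\<bar>) b (x - z)" for x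
    using b by (simp add: scaled_kernel_def)
  have ki: "integrable lborel (\<lambda>x. \<bar>?k x\<bar>)" and kI: "(LBINT x. \<bar>?k x\<bar>) = (LBINT x. \<bar>K x\<bar>)"
    using integrable_scaled_kernel_iff[of "\<lambda>w. \<bar>K w\<bar>" "\<lambda>_. 1" b z] integral_scaled_kernel[of "\<lambda>w. \<bar>K w\<bar>" "\<lambda>_. 1" b z]
      b K_integrable by (auto simp: absk)
  have sqk: "(?k x)\<^sup>2 = scaled_kernel (\<lambda>w. (K w)\<^sup>2) b (x - z) * (1 / b ^ CARD('d))" for x
    using b by (simp add: scaled_kernel_def power_divide power2_eq_square)
  have k2i: "integrable lborel (\<lambda>x. (?k x)\<^sup>2)"
    and k2I: "(LBINT x. (?k x)\<^sup>2) = (LBINT x. (K x)\<^sup>2) * b powr (- real CARD('d))"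
  proof -
    show "integrable lborel (\<lambda>x. (?k x)\<^sup>2)"
      unfolding sqk using integrable_scaled_kernel_iff[of "\<lambda>w. (K w)\<^sup>2" "\<lambda>_. 1 / b ^ CARD('d)" b z] b K_square_integrable
      by simp
    show "(LBINT x. (?k x)\<^sup>2) = (LBINT x. (K x)\<^sup>2) * b powr (- real CARD('d))"
      unfolding sqk using integral_scaled_kernel[of "\<lambda>w. (K w)\<^sup>2" "\<lambda>_. 1 / b ^ CARD('d)" b z] b
      by (simp add: powr_minus powr_realpow divide_inverse)
  qed
  have u2: "f x * (u x)\<^sup>2 \<le> B * A\<^sup>2 * (?k x)\<^sup>2" for x
  proof -
    have "(u x)\<^sup>2 \<le> (A * \<bar>?k x\<bar>)\<^sup>2" using power_mono[OF uA abs_ge_zero, of x 2] by simp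
    then show ?thesis
      using fB[of x] f_nonneg[of x] B by (auto simp: power_mult_distrib mult.assoc intro: mult_mono)
  qed
  show i2: "integrable lborel (\<lambda>x. f x * (u x)\<^sup>2)"
  proof (rule Bochner_Integration.integrable_bound)
    show "integrable lborel (\<lambda>x. B * A\<^sup>2 * (?k x)\<^sup>2)" using k2i by simp
    show "AE x in lborel. norm (f x * (u x)\<^sup>2) \<le> norm (B * A\<^sup>2 * (?k x)\<^sup>2)"
      using u2 f_nonneg B by (intro AE_I2) (simp add: abs_mult)
  qed measurable
  have "(LBINT x. f x * (u x)\<^sup>2) \<le> (LBINT x. B * A\<^sup>2 * (?k x)\<^sup>2)"
    using i2 k2i u2 by (intro integral_mono) auto
  then show "(LBINT x. f x * (u x)\<^sup>2) \<le> B * A\<^sup>2 * (LBINT x. (K x)\<^sup>2) * b powr (- real CARD('d))"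
    by (simp add: k2I mult.assoc)
  have u1: "f x * \<bar>u x\<bar> \<le> B * A * \<bar>?k x\<bar>" for x
    using fB[of x] f_nonneg[of x] B uA[of x] by (auto simp: mult.assoc intro: mult_mono)
  show i1: "integrable lborel (\<lambda>x. f x * u x)"
  proof (rule Bochner_Integration.integrable_bound)
    show "integrable lborel (\<lambda>x. B * A * \<bar>?k x\<bar>)" using ki by simp
    show "AE x in lborel. norm (f x * u x) \<le> norm (B * A * \<bar>?k x\<bar>)"
      using u1 f_nonneg B A by (intro AE_I2) (simp add: abs_mult)
  qed measurable
  have "(LBINT x. f x * \<bar>u x\<bar>) \<le> (LBINT x. B * A * \<bar>?k x\<bar>)"
    using integrable_abs[OF i1] ki u1 f_nonneg by (intro integral_mono) (auto simp: abs_mult)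
  then show "(LBINT x. f x * \<bar>u x\<bar>) \<le> B * A * (LBINT x. \<bar>K x\<bar>)"
    by (simp add: kI)
qed

text \<open>The weight \<open>\<psi> x * K_b (x - z)\<close> is split at the boundary of the ball of radius \<open>\<delta>\<close>. Inside, \<open>\<psi>\<close> is bounded and second moments are used; outside, only first moments, in which \<open>\<psi>\<close> occurs multiplied by \<open>f\<close>.\<close>

definition near :: "real^'d \<Rightarrow> real \<Rightarrow> (real^'d \<Rightarrow> real) \<Rightarrow> real \<Rightarrow> real^'d \<Rightarrow> real" where
  "near z \<delta> \<psi> b x = (if norm (x - z) < \<delta> then \<psi> x * scaled_kernel K b (x - z) else 0)"

definition far :: "real^'d \<Rightarrow> real \<Rightarrow> (real^'d \<Rightarrow> real) \<Rightarrow> real \<Rightarrow> real^'d \<Rightarrow> real" where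
  "far z \<delta> \<psi> b x = (if norm (x - z) < \<delta> then 0 else \<psi> x * scaled_kernel K b (x - z))"

lemma near_plus_far: "\<psi> x * scaled_kernel K b (x - z) = near z \<delta> \<psi> b x + far z \<delta> \<psi> b x"
  by (simp add: near_def far_def)

lemma
  assumes [measurable]: "\<psi> \<in> borel_measurable borel"
  shows near_measurable [measurable]: "near z \<delta> \<psi> b \<in> borel_measurable borel"
    and far_measurable [measurable]: "far z \<delta> \<psi> b \<in> borel_measurable borel"
  unfolding near_def[abs_def] far_def[abs_def] by measurable

lemma near_le:
  assumes "0 \<le> A" "\<And>x. norm (x - z) < \<delta> \<Longrightarrow> \<bar>\<psi> x\<bar> \<le> A"
  shows "\<bar>near z \<delta> \<psi> b x\<bar> \<le> A * \<bar>scaled_kernel K b (x - z)\<bar>"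
  using assms by (auto simp: near_def abs_mult intro!: mult_right_mono)

text \<open>The product \<open>\<psi> * f\<close> is bounded by \<open>B\<close>, so what remains is the tail of the kernel beyond \<open>\<delta> / b\<close>. This has the same order \<open>b powr \<rho>\<close> as the bias.\<close>

lemma
  assumes b: "b > 0" and \<rho>: "0 < \<rho>" "\<rho> \<le> real r" and \<delta>: "\<delta> > 0"
    and [measurable]: "\<psi> \<in> borel_measurable borel" and B: "\<And>x. \<bar>\<psi> x * f x\<bar> \<le> B"
  shows far_integrable: "integrable lborel (\<lambda>x. f x * far z \<delta> \<psi> b x)"
    and far_integral_le: "(LBINT x. f x * \<bar>far z \<delta> \<psi> b x\<bar>) \<le>
      B * (LBINT w. \<bar>K w\<bar> * norm w powr \<rho>) / \<delta> powr \<rho> * b powr \<rho>"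
proof -
  let ?I = "\<lambda>x. indicator {x. \<delta> \<le> norm (x - z)} x :: real"
  let ?k = "\<lambda>x. scaled_kernel (\<lambda>w. \<bar>K w\<bar>) b (x - z)"
  have B0: "0 \<le> B" using B[of 0] by simp
  have absk: "\<bar>scaled_kernel K b (x - z)\<bar> = ?k x" for x
    using b by (simp add: scaled_kernel_def)
  have int: "integrable lborel (\<lambda>w. \<bar>K w\<bar> * ?I (z + b *\<^sub>R w))"
    using integrable_abs[OF K_integrable] by (rule Bochner_Integration.integrable_bound) (auto simp: indicator_def)
  then have ki: "integrable lborel (\<lambda>x. ?k x * ?I x)"
    using integrable_scaled_kernel_iff[of "\<lambda>w. \<bar>K w\<bar>" ?I b z] b by simp
  have "(LBINT x. ?k x * ?I x) = (LBINT w. \<bar>K w\<bar> * ?I (z + b *\<^sub>R w))"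
    using integral_scaled_kernel[of "\<lambda>w. \<bar>K w\<bar>" ?I b z] b by simp
  also have "\<dots> = (LBINT w. \<bar>K w\<bar> * indicator {w. \<delta> \<le> norm (b *\<^sub>R w)} w)"
    by (intro Bochner_Integration.integral_cong) (auto simp: indicator_def)
  also have "\<dots> \<le> (LBINT w. \<bar>K w\<bar> * norm w powr \<rho>) / \<delta> powr \<rho> * b powr \<rho>"
    by (rule multiplicative_kernel_tail[OF K \<rho> \<delta> b])
  finally have kI: "(LBINT x. ?k x * ?I x) \<le> (LBINT w. \<bar>K w\<bar> * norm w powr \<rho>) / \<delta> powr \<rho> * b powr \<rho>" .
  have le: "f x * \<bar>far z \<delta> \<psi> b x\<bar> \<le> B * (?k x * ?I x)" for x
  proof (cases "norm (x - z) < \<delta>")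
    case False
    have "\<bar>\<psi> x * f x\<bar> * ?k x \<le> B * ?k x"
      using B[of x] absk[of x, symmetric] by (intro mult_right_mono) auto
    then show ?thesis
      using False f_nonneg[of x] by (simp add: far_def abs_mult absk mult_ac)
  qed (simp add: far_def)
  show i: "integrable lborel (\<lambda>x. f x * far z \<delta> \<psi> b x)"
  proof (rule Bochner_Integration.integrable_bound)
    show "integrable lborel (\<lambda>x. B * (?k x * ?I x))" using ki by simp
    show "AE x in lborel. norm (f x * far z \<delta> \<psi> b x) \<le> norm (B * (?k x * ?I x))"
    proof (rule AE_I2)
      fix x
      have "norm (f x * far z \<delta> \<psi> b x) = f x * \<bar>far z \<delta> \<psi> b x\<bar>"
        using f_nonneg[of x] by (simp add: abs_mult)
      also have "\<dots> \<le> B * (?k x * ?I x)" by (rule le)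
      also have "\<dots> \<le> norm (B * (?k x * ?I x))" by simp
      finally show "norm (f x * far z \<delta> \<psi> b x) \<le> norm (B * (?k x * ?I x))" .
    qed
  qed measurable
  have "(LBINT x. f x * \<bar>far z \<delta> \<psi> b x\<bar>) \<le> (LBINT x. B * (?k x * ?I x))"
    using integrable_abs[OF i] f_nonneg ki le by (intro integral_mono) (auto simp: abs_mult)
  also have "\<dots> = B * (LBINT x. ?k x * ?I x)" by (rule integral_mult_right_zero)
  also have "\<dots> \<le> B * ((LBINT w. \<bar>K w\<bar> * norm w powr \<rho>) / \<delta> powr \<rho> * b powr \<rho>)"
    using kI B0 by (rule mult_left_mono)
  finally show "(LBINT x. f x * \<bar>far z \<delta> \<psi> b x\<bar>) \<le>
      B * (LBINT w. \<bar>K w\<bar> * norm w powr \<rho>) / \<delta> powr \<rho> * b powr \<rho>"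
    by (simp add: mult.assoc)
qed

text \<open>The near part is centred, and \<open>lag_bound\<close> controls its covariances. The far part and the bias are of order \<open>b powr \<rho> \<le> sqrt R\<close>. The centring constant \<open>\<mu>\<close> differs from the full expectation by the mean of the far part, which has the same order.\<close>

lemma kernel_mean_L1_rate:
  assumes \<psi> [measurable]: "\<psi> \<in> borel_measurable borel" and \<delta>: "\<delta> > 0"
    and A: "0 < A" "\<And>x. norm (x - z) < \<delta> \<Longrightarrow> \<bar>\<psi> x\<bar> \<le> A"
    and B: "\<And>x. \<bar>\<psi> x * f x\<bar> \<le> B" and fB: "\<And>x. f x \<le> Bf"
    and smooth: "(\<lambda>x. \<psi> x * f x) \<in> smooth_class s \<Delta>" and s: "s > 0" and \<Delta>: "\<Delta> > 0"
    and \<rho>: "\<rho> = min (real r) s" and q': "0 \<le> q'" "q' \<le> q\<^sub>F"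
  shows "L1_rate \<rho> q' u (\<lambda>b T \<omega>.
    (\<Sum>t=1..T. \<psi> (Z (int t) \<omega>) * scaled_kernel K b (Z (int t) \<omega> - z)) / real T - \<psi> z * f z)"
    (is "L1_rate _ _ _ ?L")
proof -
  let ?d = "real CARD('d)"
  have \<rho>0: "0 < \<rho>" "\<rho> \<le> real r"
    using multiplicative_kernel_order_pos[OF K] s by (auto simp: \<rho>)
  have Bf0: "0 \<le> Bf" using f_nonneg[of 0] fB[of 0] by simp
  have B0: "0 \<le> B" using B[of 0] by simp
  have "\<exists>C\<ge>0. \<forall>b>0. \<bar>(LBINT w. K w * (\<psi> (z + b *\<^sub>R w) * f (z + b *\<^sub>R w))) - \<psi> z * f z\<bar> \<le> C * b powr min (real r) s"
    by (rule smooth_class_kernel_bias[OF K smooth s \<Delta> B]) measurable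
  then obtain C1 where C1: "C1 \<ge> 0" "\<forall>b>0. \<bar>(LBINT w. K w * (\<psi> (z + b *\<^sub>R w) * f (z + b *\<^sub>R w))) - \<psi> z * f z\<bar> \<le> C1 * b powr min (real r) s"
    by (elim exE conjE)
  from bilinear_form_bounds[of z] obtain C2 where C2: "C2 \<ge> 0"
    "\<forall>t \<tau> b u A. t \<noteq> \<tau> \<longrightarrow> 0 < b \<longrightarrow> 0 < A \<longrightarrow> u \<in> borel_measurable borel \<longrightarrow>
     (\<forall>x. \<bar>u x\<bar> \<le> A * \<bar>scaled_kernel K b (x - z)\<bar>) \<longrightarrow>
     \<bar>LBINT x. u (fst x) * u (snd x) * F t \<tau> x\<bar> \<le> C2 * A\<^sup>2 * lag_bound (real CARD('d)) q q\<^sub>F (q * v) b (real_of_int \<bar>t - \<tau>\<bar>)"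
    by (elim exE conjE)
  have d0: "0 < ?d" by simp
  from mixing_sum_rate[OF d0 \<rho>0(1) q_bounds(1,2,3) q', of "q * v" u] obtain C3 where C3: "C3 \<ge> 0"
    "\<forall>b T R. rate_bound ?d \<rho> q q' (q * v) u b T R \<longrightarrow>
     (\<Sum>k=1..T. lag_bound ?d q q\<^sub>F (q * v) b (real k)) / real T \<le> C3 * R"
    by (elim exE conjE)
  define c1 where "c1 = Bf * A\<^sup>2 * (LBINT x. (K x)\<^sup>2)"
  have c1: "0 \<le> c1" using Bf0 by (simp add: c1_def)
  define cf where "cf = B * (LBINT w. \<bar>K w\<bar> * norm w powr \<rho>) / \<delta> powr \<rho>"
  have cf: "0 \<le> cf" using B0 by (auto simp: cf_def intro!: divide_nonneg_nonneg mult_nonneg_nonneg)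
  define C where "C = sqrt (c1 + 2 * (C2 * A\<^sup>2 * C3)) + cf + (C1 + cf)"
  have C0: "C \<ge> 0" using c1 cf C1(1) C2(1) C3(1) by (simp add: C_def)
  have main: "integrable M (?L b T) \<and> (LINT \<omega>|M. \<bar>?L b T \<omega>\<bar>) \<le> C * sqrt R"
    if rate: "rate_bound ?d \<rho> q q' (q * v) u b T R" for b T R
  proof -
    have b: "0 < b" "b \<le> 1" and T: "1 \<le> T" using rate by (auto simp: rate_bound_def)
    note R = rate_boundD[OF rate]
    let ?u = "near z \<delta> \<psi> b" and ?w = "far z \<delta> \<psi> b"
    have u_le: "\<bar>?u x\<bar> \<le> A * \<bar>scaled_kernel K b (x - z)\<bar>" for x
      using A by (intro near_le) auto
    have um: "?u \<in> borel_measurable borel" and wm: "?w \<in> borel_measurable borel" by measurable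
    note fu2 = local_second_moment_integrable[OF b(1) um less_imp_le[OF A(1)] u_le fB]
    note fu2_le = local_second_moment_le[OF b(1) um less_imp_le[OF A(1)] u_le fB]
    note fu = local_first_moment_integrable[OF b(1) um less_imp_le[OF A(1)] u_le fB]
    note fw = far_integrable[OF b(1) \<rho>0 \<delta> \<psi> B]
    note fw_le = far_integral_le[OF b(1) \<rho>0 \<delta> \<psi> B]
    define \<mu> where "\<mu> = (LBINT x. f x * ?u x)"
    define B' where "B' = (\<lambda>k::nat. C2 * A\<^sup>2 * lag_bound ?d q q\<^sub>F (q * v) b (real k))"
    have B'0: "0 \<le> B' k" for k using C2(1) by (simp add: B'_def lag_bound_def)
    have u2i: "integrable M (\<lambda>\<omega>. (?u (Z t \<omega>))\<^sup>2)" and u2I: "(LINT \<omega>|M. (?u (Z t \<omega>))\<^sup>2) = (LBINT x. f x * (?u x)\<^sup>2)" for t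
      using has_density_integrable_iff[OF density[of t], of "\<lambda>x. (?u x)\<^sup>2"] has_density_integral[OF density[of t], of "\<lambda>x. (?u x)\<^sup>2"] fu2
      by simp_all
    have ui: "integrable M (\<lambda>\<omega>. ?u (Z t \<omega>))" and uI: "(LINT \<omega>|M. ?u (Z t \<omega>)) = \<mu>" for t
      using has_density_integrable_iff[OF density[of t] um] has_density_integral[OF density[of t] um] fu
      by (simp_all add: \<mu>_def)
    have wi: "integrable M (\<lambda>\<omega>. ?w (Z t \<omega>))" for t
      using has_density_integrable_iff[OF density[of t] wm] fw by simp
    have wI: "(LINT \<omega>|M. \<bar>?w (Z t \<omega>)\<bar>) \<le> cf * b powr \<rho>" for t
      using has_density_integral[OF density[of t], of "\<lambda>x. \<bar>?w x\<bar>"] fw_le by (simp add: cf_def)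
    have uui: "integrable M (\<lambda>\<omega>. ?u (Z t \<omega>) * ?u (Z \<tau> \<omega>))" for t \<tau>
      using u2i by (intro integrable_mult_of_squares) auto
    define Y where "Y = (\<lambda>(t::nat) \<omega>. ?u (Z (int t) \<omega>) - \<mu>)"
    have Ym: "Y t \<in> borel_measurable M" for t unfolding Y_def by measurable
    have Y_prod: "integrable M (\<lambda>\<omega>. Y t \<omega> * Y \<tau> \<omega>) \<and>
       (LINT \<omega>|M. Y t \<omega> * Y \<tau> \<omega>) = (LINT \<omega>|M. ?u (Z (int t) \<omega>) * ?u (Z (int \<tau>) \<omega>)) - \<mu>\<^sup>2" for t \<tau>
    proof -
      have eq: "Y t \<omega> * Y \<tau> \<omega> = ?u (Z (int t) \<omega>) * ?u (Z (int \<tau>) \<omega>) - \<mu> * ?u (Z (int t) \<omega>) - \<mu> * ?u (Z (int \<tau>) \<omega>) + \<mu>\<^sup>2" for \<omega>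
        by (simp add: Y_def algebra_simps power2_eq_square)
      show ?thesis
        unfolding eq using uui ui by (simp add: uI prob_space power2_eq_square)
    qed
    have Y2: "integrable M (\<lambda>\<omega>. (Y t \<omega>)\<^sup>2)" for t
      using Y_prod[of t t] by (simp add: power2_eq_square)
    have diag: "(LINT \<omega>|M. (Y t \<omega>)\<^sup>2) \<le> c1 * b powr (- ?d)" for t
    proof -
      have "(LINT \<omega>|M. (Y t \<omega>)\<^sup>2) = (LBINT x. f x * (?u x)\<^sup>2) - \<mu>\<^sup>2"
        using Y_prod[of t t] u2I[of "int t"] by (simp add: power2_eq_square)
      also have "\<dots> \<le> (LBINT x. f x * (?u x)\<^sup>2)" by simp
      also have "\<dots> \<le> c1 * b powr (- ?d)" using fu2_le by (simp add: c1_def)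
      finally show ?thesis .
    qed
    have off: "(LINT \<omega>|M. Y t \<omega> * Y \<tau> \<omega>) \<le> B' (\<tau> - t)" if t: "t < \<tau>" for t \<tau>
    proof -
      have ne: "int t \<noteq> int \<tau>" using t by simp
      have "(LINT \<omega>|M. Y t \<omega> * Y \<tau> \<omega>) = (LBINT x. ?u (fst x) * ?u (snd x) * F (int t) (int \<tau>) x)"
        using pair_deviation[OF ne um um fu fu uui] Y_prod[of t \<tau>] by (simp add: \<mu>_def power2_eq_square)
      also have "\<dots> \<le> C2 * A\<^sup>2 * lag_bound ?d q q\<^sub>F (q * v) b (real_of_int \<bar>int t - int \<tau>\<bar>)"
        by (rule order_trans[OF abs_ge_self C2(2)[rule_format, OF ne b(1) A(1) um u_le]])
      also have "real_of_int \<bar>int t - int \<tau>\<bar> = real (\<tau> - t)" using t by simp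
      finally show ?thesis by (simp add: B'_def)
    qed
    have mean: "integrable M (\<lambda>\<omega>. (\<Sum>t=1..T. Y t \<omega>) / real T)"
      "(LINT \<omega>|M. \<bar>(\<Sum>t=1..T. Y t \<omega>) / real T\<bar>) \<le> sqrt ((c1 * b powr (- ?d) + 2 * (\<Sum>k=1..T. B' k)) / real T)"
      by (rule abs_mean_le_of_second_moments[of Y _ B', OF Ym Y2 diag off B'0 T], assumption)+
    have sumB: "(\<Sum>k=1..T. B' k) / real T \<le> C2 * A\<^sup>2 * (C3 * R)"
    proof -
      have "(\<Sum>k=1..T. B' k) / real T = C2 * A\<^sup>2 * ((\<Sum>k=1..T. lag_bound ?d q q\<^sub>F (q * v) b (real k)) / real T)"
        unfolding B'_def by (simp only: sum_distrib_left[symmetric] times_divide_eq_right)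
      also have "\<dots> \<le> C2 * A\<^sup>2 * (C3 * R)"
        using C3(2) rate C2(1) by (intro mult_left_mono) simp_all
      finally show ?thesis .
    qed
    have "(c1 * b powr (- ?d) + 2 * (\<Sum>k=1..T. B' k)) / real T =
        c1 * (b powr (- ?d) / real T) + 2 * ((\<Sum>k=1..T. B' k) / real T)"
      by (simp add: add_divide_distrib)
    also have "\<dots> \<le> c1 * R + 2 * (C2 * A\<^sup>2 * (C3 * R))"
      using sumB R(3) c1 by (intro add_mono mult_left_mono) auto
    also have "\<dots> = (c1 + 2 * (C2 * A\<^sup>2 * C3)) * R" by (simp add: algebra_simps)
    finally have "sqrt ((c1 * b powr (- ?d) + 2 * (\<Sum>k=1..T. B' k)) / real T) \<le> sqrt ((c1 + 2 * (C2 * A\<^sup>2 * C3)) * R)"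
      by (rule real_sqrt_le_mono)
    then have Ymean: "(LINT \<omega>|M. \<bar>(\<Sum>t=1..T. Y t \<omega>) / real T\<bar>) \<le> sqrt (c1 + 2 * (C2 * A\<^sup>2 * C3)) * sqrt R"
      using mean(2) by (simp add: real_sqrt_mult)
    have bias: "\<bar>\<mu> - \<psi> z * f z\<bar> \<le> (C1 + cf) * sqrt R"
    proof -
      have "(LBINT w. K w * (\<psi> (z + b *\<^sub>R w) * f (z + b *\<^sub>R w))) = (LBINT x. scaled_kernel K b (x - z) * (\<psi> x * f x))"
        using integral_scaled_kernel[of K "\<lambda>x. \<psi> x * f x" b z] b by simp
      also have "\<dots> = (LBINT x. f x * ?u x + f x * ?w x)"
        by (intro Bochner_Integration.integral_cong) (auto simp: near_def far_def)
      also have "\<dots> = \<mu> + (LBINT x. f x * ?w x)"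
        unfolding \<mu>_def using fu fw by (rule Bochner_Integration.integral_add)
      finally have e: "\<bar>\<mu> + (LBINT x. f x * ?w x) - \<psi> z * f z\<bar> \<le> C1 * b powr \<rho>"
        using C1(2) b by (auto simp: \<rho>)
      have "\<bar>LBINT x. f x * ?w x\<bar> \<le> (LBINT x. \<bar>f x * ?w x\<bar>)" by (rule integral_abs_bound)
      also have "\<dots> = (LBINT x. f x * \<bar>?w x\<bar>)" using f_nonneg by (simp add: abs_mult)
      also have "\<dots> \<le> cf * b powr \<rho>" using fw_le by (simp add: cf_def)
      finally have "\<bar>\<mu> - \<psi> z * f z\<bar> \<le> (C1 + cf) * b powr \<rho>" using e by (simp add: distrib_right)
      also have "\<dots> \<le> (C1 + cf) * sqrt R" using R(2) C1(1) cf by (intro mult_left_mono) auto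
      finally show ?thesis .
    qed
    have "?L b T \<omega> = (\<Sum>t=1..T. Y t \<omega>) / real T + (\<Sum>t=1..T. ?w (Z (int t) \<omega>)) / real T + (\<mu> - \<psi> z * f z)" for \<omega>
      using T unfolding near_plus_far[of \<psi> _ b z \<delta>] Y_def
      by (simp add: sum.distrib sum_subtractf field_simps)
    from abs_mean_split_le[OF T mean(1) Ymean wi wI this]
    have L: "integrable M (?L b T)" "(LINT \<omega>|M. \<bar>?L b T \<omega>\<bar>) \<le>
        sqrt (c1 + 2 * (C2 * A\<^sup>2 * C3)) * sqrt R + cf * b powr \<rho> + \<bar>\<mu> - \<psi> z * f z\<bar>" by simp_all
    note L(2)
    also have "\<dots> \<le> sqrt (c1 + 2 * (C2 * A\<^sup>2 * C3)) * sqrt R + cf * sqrt R + (C1 + cf) * sqrt R"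
      using bias mult_left_mono[OF R(2) cf] by linarith
    also have "\<dots> = C * sqrt R" by (simp add: C_def distrib_right)
    finally show ?thesis using L(1) by simp
  qed
  show ?thesis
    unfolding L1_rate_def by (intro exI[of _ C] conjI[OF C0] allI impI main)
qed

text \<open>By independence the second moments factor into those of the weights and those of \<open>e\<close>. The pair expectation of the weights is bounded through \<open>F\<close> by \<open>b powr (- d * (1 - q\<^sub>F))\<close>; compared with \<open>b powr (- d)\<close>, which the Cauchy-Schwarz inequality would give, this leaves the factor \<open>b powr (d * q\<^sub>F)\<close> that \<open>weighted_sum_rate\<close> requires.\<close>

lemma kernel_noise_L1_rate:
  fixes e :: "int \<Rightarrow> 'w \<Rightarrow> real"
  assumes \<psi> [measurable]: "\<psi> \<in> borel_measurable borel" and \<delta>: "\<delta> > 0"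
    and A: "0 < A" "\<And>x. norm (x - z) < \<delta> \<Longrightarrow> \<bar>\<psi> x\<bar> \<le> A"
    and B: "\<And>x. \<bar>\<psi> x * f x\<bar> \<le> B" and fB: "\<And>x. f x \<le> Bf"
    and e [measurable]: "\<And>t. e t \<in> borel_measurable M" and e2: "\<And>t. integrable M (\<lambda>\<omega>. (e t \<omega>)\<^sup>2)"
    and e_var: "\<And>t. (LINT \<omega>|M. (e t \<omega>)\<^sup>2) \<le> \<sigma>"
    and e_cov: "\<And>t \<tau>. t \<noteq> \<tau> \<Longrightarrow> \<bar>\<integral>\<omega>. e t \<omega> * e \<tau> \<omega> \<partial>M\<bar> \<le> C\<eta> * real_of_int \<bar>t - \<tau>\<bar> powr (- u)"
    and indep: "\<And>t \<tau> a c. a \<in> borel_measurable borel \<Longrightarrow> c \<in> borel_measurable borel \<Longrightarrow>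
      indep_var borel (\<lambda>\<omega>. a (Z t \<omega>, Z \<tau> \<omega>) :: real) borel (\<lambda>\<omega>. c (e t \<omega>, e \<tau> \<omega>) :: real)"
    and \<rho>: "0 < \<rho>" "\<rho> \<le> real r"
  shows "L1_rate \<rho> q' u (\<lambda>b T \<omega>.
    (\<Sum>t=1..T. \<psi> (Z (int t) \<omega>) * e (int t) \<omega> * scaled_kernel K b (Z (int t) \<omega> - z)) / real T)"
    (is "L1_rate _ _ _ ?L")
proof -
  let ?d = "real CARD('d)"
  have Bf0: "0 \<le> Bf" using f_nonneg[of 0] fB[of 0] by simp
  have B0: "0 \<le> B" using B[of 0] by simp
  have C\<eta>0: "0 \<le> C\<eta>" using e_cov[of 0 1] by simp
  have \<sigma>0: "0 \<le> \<sigma>" by (rule order_trans[OF _ e_var[of 0]]) simp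
  from bilinear_form_bounds[of z] obtain C2 where C2: "C2 \<ge> 0"
    "\<forall>t \<tau> b u A. t \<noteq> \<tau> \<longrightarrow> 0 < b \<longrightarrow> 0 < A \<longrightarrow> u \<in> borel_measurable borel \<longrightarrow>
     (\<forall>x. \<bar>u x\<bar> \<le> A * \<bar>scaled_kernel K b (x - z)\<bar>) \<longrightarrow>
     \<bar>LBINT x. u (fst x) * u (snd x) * F t \<tau> x\<bar> \<le> C2 * A\<^sup>2 * lag_bound (real CARD('d)) q q\<^sub>F (q * v) b (real_of_int \<bar>t - \<tau>\<bar>)"
    by (elim exE conjE)
  have \<epsilon>: "0 < ?d * q\<^sub>F" using q_bounds by simp
  from weighted_sum_rate[OF \<epsilon> \<rho>(1), of ?d u] obtain C3 where C3: "C3 \<ge> 0"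
    "\<forall>b T R. 0 < b \<longrightarrow> b \<le> 1 \<longrightarrow> 1 \<le> T \<longrightarrow> b powr (2 * \<rho>) \<le> R \<longrightarrow>
     b powr (- ?d) * real T powr (- min u 1) \<le> R \<longrightarrow>
     b powr (- ?d + ?d * q\<^sub>F) * (\<Sum>k=1..T. real k powr (- u)) / real T \<le> C3 * R"
    by (elim exE conjE)
  define c1 where "c1 = Bf * A\<^sup>2 * (LBINT x. (K x)\<^sup>2)"
  have c1: "0 \<le> c1" using Bf0 by (simp add: c1_def)
  define cf where "cf = B * (LBINT w. \<bar>K w\<bar> * norm w powr \<rho>) / \<delta> powr \<rho>"
  have cf: "0 \<le> cf" using B0 by (auto simp: cf_def intro!: divide_nonneg_nonneg mult_nonneg_nonneg)
  \<comment> \<open>The first summand bounds the deviation from independence at distinct times, the second the product of the two means.\<close>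
  define c4 where "c4 = C2 * A\<^sup>2 + (Bf * A * (LBINT x. \<bar>K x\<bar>))\<^sup>2"
  have c4: "0 \<le> c4" using C2(1) by (simp add: c4_def)
  define C where "C = sqrt (c1 * \<sigma> + 2 * (c4 * C\<eta> * C3)) + cf * (1 + \<sigma>)"
  have C0: "C \<ge> 0" using c1 c4 cf C3(1) C\<eta>0 \<sigma>0 by (simp add: C_def)
  have ei: "integrable M (e t)" for t by (rule square_integrable_imp_integrable[OF e e2])
  have e_abs: "(LINT \<omega>|M. \<bar>e t \<omega>\<bar>) \<le> 1 + \<sigma>" for t
  proof -
    have "(LINT \<omega>|M. \<bar>e t \<omega>\<bar>) \<le> (LINT \<omega>|M. 1 + (e t \<omega>)\<^sup>2)"
    proof (rule integral_mono)
      fix \<omega>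
      show "\<bar>e t \<omega>\<bar> \<le> 1 + (e t \<omega>)\<^sup>2"
        using sum_squares_bound[of 1 "\<bar>e t \<omega>\<bar>"] by simp
    qed (use ei e2 in auto)
    also have "\<dots> \<le> 1 + \<sigma>" using e2 e_var[of t] by (simp add: prob_space)
    finally show ?thesis .
  qed
  have main: "integrable M (?L b T) \<and> (LINT \<omega>|M. \<bar>?L b T \<omega>\<bar>) \<le> C * sqrt R"
    if rate: "rate_bound ?d \<rho> q q' (q * v) u b T R" for b T R
  proof -
    have b: "0 < b" "b \<le> 1" and T: "1 \<le> T" using rate by (auto simp: rate_bound_def)
    note R = rate_boundD[OF rate]
    let ?u = "near z \<delta> \<psi> b" and ?w = "far z \<delta> \<psi> b"
    have u_le: "\<bar>?u x\<bar> \<le> A * \<bar>scaled_kernel K b (x - z)\<bar>" for x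
      using A by (intro near_le) auto
    have um [measurable]: "?u \<in> borel_measurable borel" and wm [measurable]: "?w \<in> borel_measurable borel" by measurable
    have uam: "(\<lambda>x. \<bar>?u x\<bar>) \<in> borel_measurable borel" by measurable
    have ua_le: "\<bar>\<bar>?u x\<bar>\<bar> \<le> A * \<bar>scaled_kernel K b (x - z)\<bar>" for x using u_le[of x] by simp
    note fu2 = local_second_moment_integrable[OF b(1) um less_imp_le[OF A(1)] u_le fB]
    note fu2_le = local_second_moment_le[OF b(1) um less_imp_le[OF A(1)] u_le fB]
    note fu = local_first_moment_integrable[OF b(1) uam less_imp_le[OF A(1)] ua_le fB]
    note fu_le = local_first_moment_le[OF b(1) um less_imp_le[OF A(1)] u_le fB]
    note fw = far_integrable[OF b(1) \<rho> \<delta> \<psi> B]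
    note fw_le = far_integral_le[OF b(1) \<rho> \<delta> \<psi> B]
    have u2i: "integrable M (\<lambda>\<omega>. (?u (Z t \<omega>))\<^sup>2)" and u2I: "(LINT \<omega>|M. (?u (Z t \<omega>))\<^sup>2) = (LBINT x. f x * (?u x)\<^sup>2)" for t
      using has_density_integrable_iff[OF density[of t], of "\<lambda>x. (?u x)\<^sup>2"] has_density_integral[OF density[of t], of "\<lambda>x. (?u x)\<^sup>2"] fu2
      by simp_all
    have wi: "integrable M (\<lambda>\<omega>. ?w (Z t \<omega>))" for t
      using has_density_integrable_iff[OF density[of t] wm] fw by simp
    have wI: "(LINT \<omega>|M. \<bar>?w (Z t \<omega>)\<bar>) \<le> cf * b powr \<rho>" for t
      using has_density_integral[OF density[of t], of "\<lambda>x. \<bar>?w x\<bar>"] fw_le by (simp add: cf_def)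
    have uui: "integrable M (\<lambda>\<omega>. ?u (Z t \<omega>) * ?u (Z \<tau> \<omega>))" for t \<tau>
      using u2i by (intro integrable_mult_of_squares) auto
    have uuai: "integrable M (\<lambda>\<omega>. \<bar>?u (Z t \<omega>)\<bar> * \<bar>?u (Z \<tau> \<omega>)\<bar>)" for t \<tau>
      using integrable_abs[OF uui[of t \<tau>]] by (simp add: abs_mult)
    have eei: "integrable M (\<lambda>\<omega>. e t \<omega> * e \<tau> \<omega>)" for t \<tau>
      using e2 by (intro integrable_mult_of_squares) auto
    define Y where "Y = (\<lambda>(t::nat) \<omega>. ?u (Z (int t) \<omega>) * e (int t) \<omega>)"
    have Ym: "Y t \<in> borel_measurable M" for t unfolding Y_def by measurable
    have Y_prod: "integrable M (\<lambda>\<omega>. Y t \<omega> * Y \<tau> \<omega>)"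
      "(LINT \<omega>|M. Y t \<omega> * Y \<tau> \<omega>) = (LINT \<omega>|M. ?u (Z (int t) \<omega>) * ?u (Z (int \<tau>) \<omega>)) * (LINT \<omega>|M. e (int t) \<omega> * e (int \<tau>) \<omega>)" for t \<tau>
    proof -
      have am: "(\<lambda>x. ?u (fst x) * ?u (snd x)) \<in> borel_measurable borel"
        and cm: "(\<lambda>x::real \<times> real. fst x * snd x) \<in> borel_measurable borel" by measurable
      have iv: "indep_var borel (\<lambda>\<omega>. ?u (Z (int t) \<omega>) * ?u (Z (int \<tau>) \<omega>)) borel (\<lambda>\<omega>. e (int t) \<omega> * e (int \<tau>) \<omega>)"
        using indep[OF am cm, of "int t" "int \<tau>"] by simp
      have eq: "Y t \<omega> * Y \<tau> \<omega> = (?u (Z (int t) \<omega>) * ?u (Z (int \<tau>) \<omega>)) * (e (int t) \<omega> * e (int \<tau>) \<omega>)" for \<omega>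
        by (simp add: Y_def mult_ac)
      show "integrable M (\<lambda>\<omega>. Y t \<omega> * Y \<tau> \<omega>)"
        unfolding eq by (rule indep_var_integrable[OF iv uui eei])
      show "(LINT \<omega>|M. Y t \<omega> * Y \<tau> \<omega>) = (LINT \<omega>|M. ?u (Z (int t) \<omega>) * ?u (Z (int \<tau>) \<omega>)) * (LINT \<omega>|M. e (int t) \<omega> * e (int \<tau>) \<omega>)"
        unfolding eq by (rule indep_var_lebesgue_integral[OF iv uui eei])
    qed
    have Y2: "integrable M (\<lambda>\<omega>. (Y t \<omega>)\<^sup>2)" for t
      using Y_prod(1)[of t t] by (simp add: power2_eq_square)
    have diag: "(LINT \<omega>|M. (Y t \<omega>)\<^sup>2) \<le> (c1 * b powr (- ?d)) * \<sigma>" for t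
    proof -
      have "(LINT \<omega>|M. (Y t \<omega>)\<^sup>2) = (LBINT x. f x * (?u x)\<^sup>2) * (LINT \<omega>|M. (e (int t) \<omega>)\<^sup>2)"
        using Y_prod(2)[of t t] u2I[of "int t"] by (simp add: power2_eq_square)
      also have "\<dots> \<le> (c1 * b powr (- ?d)) * \<sigma>"
        using fu2_le e_var[of "int t"] c1 by (intro mult_mono) (auto simp: c1_def)
      finally show ?thesis .
    qed
    define B' where "B' = (\<lambda>k::nat. c4 * b powr (- (?d * (1 - q\<^sub>F))) * (C\<eta> * real k powr (- u)))"
    have B'0: "0 \<le> B' k" for k using c4 C\<eta>0 by (simp add: B'_def)
    have off: "(LINT \<omega>|M. Y t \<omega> * Y \<tau> \<omega>) \<le> B' (\<tau> - t)" if t: "t < \<tau>" for t \<tau>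
    proof -
      have ne: "int t \<noteq> int \<tau>" using t by simp
      have "\<bar>\<integral>\<omega>. ?u (Z (int t) \<omega>) * ?u (Z (int \<tau>) \<omega>) \<partial>M\<bar> \<le> (LINT \<omega>|M. \<bar>?u (Z (int t) \<omega>)\<bar> * \<bar>?u (Z (int \<tau>) \<omega>)\<bar>)"
        using integral_abs_bound[of M "\<lambda>\<omega>. ?u (Z (int t) \<omega>) * ?u (Z (int \<tau>) \<omega>)"] by (simp add: abs_mult)
      also have "\<dots> = (LBINT x. \<bar>?u (fst x)\<bar> * \<bar>?u (snd x)\<bar> * F (int t) (int \<tau>) x) + (LBINT x. f x * \<bar>?u x\<bar>)\<^sup>2"
        using pair_deviation[OF ne uam uam fu fu uuai] by (simp add: power2_eq_square)
      also have "(LBINT x. \<bar>?u (fst x)\<bar> * \<bar>?u (snd x)\<bar> * F (int t) (int \<tau>) x) \<le> C2 * A\<^sup>2 * b powr (- (?d * (1 - q\<^sub>F)))"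
      proof -
        have "\<bar>LBINT x. \<bar>?u (fst x)\<bar> * \<bar>?u (snd x)\<bar> * F (int t) (int \<tau>) x\<bar> \<le> C2 * A\<^sup>2 *
          lag_bound ?d q q\<^sub>F (q * v) b (real_of_int \<bar>int t - int \<tau>\<bar>)"
          using C2(2)[rule_format, OF ne b(1) A(1) uam ua_le] by simp
        also have "\<dots> \<le> C2 * A\<^sup>2 * b powr (- (?d * (1 - q\<^sub>F)))"
          using C2(1) by (intro mult_left_mono) (auto simp: lag_bound_def)
        finally show ?thesis by linarith
      qed
      also have "(LBINT x. f x * \<bar>?u x\<bar>)\<^sup>2 \<le> (Bf * A * (LBINT x. \<bar>K x\<bar>))\<^sup>2 * 1"
        using fu_le f_nonneg by (simp add: power_mono)
      also have "(Bf * A * (LBINT x. \<bar>K x\<bar>))\<^sup>2 * 1 \<le> (Bf * A * (LBINT x. \<bar>K x\<bar>))\<^sup>2 * b powr (- (?d * (1 - q\<^sub>F)))"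
      proof (intro mult_left_mono)
        have "b powr 0 \<le> b powr (- (?d * (1 - q\<^sub>F)))"
          using b q_bounds by (intro powr_mono') (auto intro: mult_nonneg_nonneg)
        then show "1 \<le> b powr (- (?d * (1 - q\<^sub>F)))" using b by simp
      qed simp
      finally have uu: "\<bar>\<integral>\<omega>. ?u (Z (int t) \<omega>) * ?u (Z (int \<tau>) \<omega>) \<partial>M\<bar> \<le> c4 * b powr (- (?d * (1 - q\<^sub>F)))"
        by (simp add: c4_def distrib_right)
      have "(LINT \<omega>|M. Y t \<omega> * Y \<tau> \<omega>) \<le> \<bar>\<integral>\<omega>. ?u (Z (int t) \<omega>) * ?u (Z (int \<tau>) \<omega>) \<partial>M\<bar> * \<bar>\<integral>\<omega>. e (int t) \<omega> * e (int \<tau>) \<omega> \<partial>M\<bar>"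
        unfolding Y_prod(2) abs_mult[symmetric] by (rule abs_ge_self)
      also have "\<dots> \<le> (c4 * b powr (- (?d * (1 - q\<^sub>F)))) * (C\<eta> * real_of_int \<bar>int t - int \<tau>\<bar> powr (- u))"
        using c4 by (intro mult_mono uu e_cov[OF ne]) auto
      also have "real_of_int \<bar>int t - int \<tau>\<bar> = real (\<tau> - t)" using t by simp
      finally show ?thesis by (simp add: B'_def)
    qed
    have mean: "integrable M (\<lambda>\<omega>. (\<Sum>t=1..T. Y t \<omega>) / real T)"
      "(LINT \<omega>|M. \<bar>(\<Sum>t=1..T. Y t \<omega>) / real T\<bar>) \<le> sqrt (((c1 * b powr (- ?d)) * \<sigma> + 2 * (\<Sum>k=1..T. B' k)) / real T)"
      by (rule abs_mean_le_of_second_moments[of Y _ B', OF Ym Y2 diag off B'0 T], assumption)+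
    have sumB: "(\<Sum>k=1..T. B' k) / real T \<le> c4 * C\<eta> * (C3 * R)"
    proof -
      have "- ?d + ?d * q\<^sub>F = - (?d * (1 - q\<^sub>F))" by (simp add: algebra_simps)
      then have "(\<Sum>k=1..T. B' k) / real T = c4 * C\<eta> * (b powr (- ?d + ?d * q\<^sub>F) * (\<Sum>k=1..T. real k powr (- u)) / real T)"
        unfolding B'_def by (simp add: sum_distrib_left mult_ac)
      also have "\<dots> \<le> c4 * C\<eta> * (C3 * R)"
        using C3(2) rate c4 C\<eta>0 by (intro mult_left_mono) (simp_all add: rate_bound_def)
      finally show ?thesis .
    qed
    have "((c1 * b powr (- ?d)) * \<sigma> + 2 * (\<Sum>k=1..T. B' k)) / real T =
        c1 * \<sigma> * (b powr (- ?d) / real T) + 2 * ((\<Sum>k=1..T. B' k) / real T)"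
      by (simp add: add_divide_distrib)
    also have "\<dots> \<le> c1 * \<sigma> * R + 2 * (c4 * C\<eta> * (C3 * R))"
      using sumB R(3) c1 \<sigma>0 by (intro add_mono mult_left_mono) auto
    also have "\<dots> = (c1 * \<sigma> + 2 * (c4 * C\<eta> * C3)) * R" by (simp add: algebra_simps)
    finally have "sqrt (((c1 * b powr (- ?d)) * \<sigma> + 2 * (\<Sum>k=1..T. B' k)) / real T) \<le> sqrt ((c1 * \<sigma> + 2 * (c4 * C\<eta> * C3)) * R)"
      by (rule real_sqrt_le_mono)
    then have Ymean: "(LINT \<omega>|M. \<bar>(\<Sum>t=1..T. Y t \<omega>) / real T\<bar>) \<le> sqrt (c1 * \<sigma> + 2 * (c4 * C\<eta> * C3)) * sqrt R"
      using mean(2) by (simp add: real_sqrt_mult)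
    have we: "integrable M (\<lambda>\<omega>. ?w (Z t \<omega>) * e t \<omega>)"
      "(LINT \<omega>|M. \<bar>?w (Z t \<omega>) * e t \<omega>\<bar>) \<le> cf * b powr \<rho> * (1 + \<sigma>)" for t
    proof -
      have am: "(\<lambda>x::(real^'d) \<times> (real^'d). ?w (fst x)) \<in> borel_measurable borel"
        and cm: "(\<lambda>x::real \<times> real. fst x) \<in> borel_measurable borel"
        and am': "(\<lambda>x::(real^'d) \<times> (real^'d). \<bar>?w (fst x)\<bar>) \<in> borel_measurable borel"
        and cm': "(\<lambda>x::real \<times> real. \<bar>fst x\<bar>) \<in> borel_measurable borel" by measurable
      have iv: "indep_var borel (\<lambda>\<omega>. ?w (Z t \<omega>)) borel (e t)"
        using indep[OF am cm, of t t] by simp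
      have iv': "indep_var borel (\<lambda>\<omega>. \<bar>?w (Z t \<omega>)\<bar>) borel (\<lambda>\<omega>. \<bar>e t \<omega>\<bar>)"
        using indep[OF am' cm', of t t] by simp
      show "integrable M (\<lambda>\<omega>. ?w (Z t \<omega>) * e t \<omega>)"
        by (rule indep_var_integrable[OF iv wi ei])
      have "(LINT \<omega>|M. \<bar>?w (Z t \<omega>) * e t \<omega>\<bar>) = (LINT \<omega>|M. \<bar>?w (Z t \<omega>)\<bar>) * (LINT \<omega>|M. \<bar>e t \<omega>\<bar>)"
        using indep_var_lebesgue_integral[OF iv' integrable_abs[OF wi] integrable_abs[OF ei]] by (simp add: abs_mult)
      also have "\<dots> \<le> (cf * b powr \<rho>) * (1 + \<sigma>)"
        using cf by (intro mult_mono wI e_abs) auto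
      finally show "(LINT \<omega>|M. \<bar>?w (Z t \<omega>) * e t \<omega>\<bar>) \<le> cf * b powr \<rho> * (1 + \<sigma>)" .
    qed
    have "?L b T \<omega> = (\<Sum>t=1..T. Y t \<omega>) / real T + (\<Sum>t=1..T. ?w (Z (int t) \<omega>) * e (int t) \<omega>) / real T + 0" for \<omega>
    proof -
      have "\<psi> x * a * scaled_kernel K b (x - z) = ?u x * a + ?w x * a" for x a
        using near_plus_far[of \<psi> x b z \<delta>] by (simp add: mult_ac flip: distrib_left)
      then show ?thesis unfolding Y_def by (simp add: sum.distrib add_divide_distrib)
    qed
    from abs_mean_split_le[OF T mean(1) Ymean we this]
    have L: "integrable M (?L b T)" "(LINT \<omega>|M. \<bar>?L b T \<omega>\<bar>) \<le>
        sqrt (c1 * \<sigma> + 2 * (c4 * C\<eta> * C3)) * sqrt R + cf * b powr \<rho> * (1 + \<sigma>)" by simp_all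
    note L(2)
    also have "\<dots> \<le> sqrt (c1 * \<sigma> + 2 * (c4 * C\<eta> * C3)) * sqrt R + cf * sqrt R * (1 + \<sigma>)"
      using mult_right_mono[OF mult_left_mono[OF R(2) cf], of "1 + \<sigma>"] \<sigma>0 by linarith
    also have "\<dots> = C * sqrt R" by (simp add: C_def algebra_simps)
    finally show ?thesis using L(1) by simp
  qed
  show ?thesis
    unfolding L1_rate_def by (intro exI[of _ C] conjI[OF C0] allI impI main)
qed

end

section \<open>Independent processes and centred noise\<close>

lemma process_coordinate_measurable:
  "Y t \<in> borel_measurable (process_sigma M Y)"
proof -
  have "(\<lambda>\<omega> t. Y t \<omega>) \<in> process_sigma M Y \<rightarrow>\<^sub>M PiM UNIV (\<lambda>_. borel)"
    unfolding process_sigma_def by (rule measurable_vimage_algebra1) (auto simp: space_PiM)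
  then have "(\<lambda>\<omega>. (\<lambda>t. Y t \<omega>) t) \<in> process_sigma M Y \<rightarrow>\<^sub>M borel"
    by (rule measurable_compose[OF _ measurable_component_singleton]) simp
  then show ?thesis by simp
qed

text \<open>A measurable function of two coordinates of a process is measurable with respect to the sigma-algebra generated by the whole process.\<close>

lemma (in prob_space) indep_processes_imp_indep_var:
  fixes Y :: "int \<Rightarrow> 'a \<Rightarrow> 'b::second_countable_topology" and W :: "int \<Rightarrow> 'a \<Rightarrow> 'c::second_countable_topology"
  assumes ind: "indep_processes M Y W"
    and Ym: "\<And>t. Y t \<in> borel_measurable M" and Wm: "\<And>t. W t \<in> borel_measurable M"
    and a: "a \<in> borel_measurable borel" and c: "c \<in> borel_measurable borel"
  shows "indep_var borel (\<lambda>\<omega>. a (Y t \<omega>, Y \<tau> \<omega>) :: real) borel (\<lambda>\<omega>. c (W t \<omega>, W \<tau> \<omega>) :: real)"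
proof -
  have comp: "(\<lambda>\<omega>. e (V t \<omega>, V \<tau> \<omega>)) \<in> borel_measurable N"
    if "e \<in> borel_measurable borel" "\<And>t. V t \<in> borel_measurable N"
    for e :: "'e::second_countable_topology \<times> 'e \<Rightarrow> real" and V :: "int \<Rightarrow> 'a \<Rightarrow> 'e" and N
    using that(1) by (rule measurable_compose[rotated]) (intro borel_measurable_Pair that(2))
  have sub: "sigma_sets (space M) {U -` A \<inter> space M |A. A \<in> sets borel} \<subseteq> sets (process_sigma M V)"
    if "U \<in> borel_measurable (process_sigma M V)" for U :: "'a \<Rightarrow> real" and V :: "int \<Rightarrow> 'a \<Rightarrow> 'e::second_countable_topology"
  proof -
    have sp: "space (process_sigma M V) = space M" by (simp add: process_sigma_def)
    have "sigma_sets (space (process_sigma M V)) {U -` A \<inter> space M |A. A \<in> sets borel} \<subseteq> sets (process_sigma M V)"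
      using measurable_sets[OF that] by (intro sets.sigma_sets_subset) (auto simp: sp)
    then show ?thesis by (simp add: sp)
  qed
  note sY = sub[OF comp[OF a process_coordinate_measurable[of Y]]]
  note sW = sub[OF comp[OF c process_coordinate_measurable[of W]]]
  note P' = ind[unfolded indep_processes_def indep_sets2_eq]
  note P = conjunct1[OF P'] conjunct1[OF conjunct2[OF P']] conjunct2[OF conjunct2[OF P']]
  show ?thesis
    unfolding indep_var_eq
  proof (intro conjI)
    show "indep_set (sigma_sets (space M) {(\<lambda>\<omega>. a (Y t \<omega>, Y \<tau> \<omega>)) -` A \<inter> space M |A. A \<in> sets borel})
       (sigma_sets (space M) {(\<lambda>\<omega>. c (W t \<omega>, W \<tau> \<omega>)) -` A \<inter> space M |A. A \<in> sets borel})"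
      unfolding indep_sets2_eq
      by (intro conjI ballI order_trans[OF sY P(1)] order_trans[OF sW P(2)] P(3)[rule_format] subsetD[OF sY] subsetD[OF sW])
  qed (auto intro!: comp a c Ym Wm)
qed

text \<open>Testing the conditional mean with \<open>w(Z)\<close>, where \<open>w\<close> is the indicator of \<open>h \<le> n\<close>, and using independence gives \<open>E[w(Z) h(Z)] * E[\<eta>] = 0\<close>. So either the noise is centred or it is multiplied by \<open>0\<close>; in both cases \<open>\<eta>\<close> may be replaced by \<open>\<eta> - E[\<eta>]\<close>. The truncation is there because \<open>h(Z)\<close> by itself need not be integrable.\<close>

lemma (in prob_space) scale_times_noise_mean_eq_0:
  fixes X \<eta> :: "'a \<Rightarrow> real" and Z :: "'a \<Rightarrow> 'b::topological_space"
  assumes cm: "cond_mean_fun M X Z \<phi>"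
    and h [measurable]: "h \<in> borel_measurable borel" and h0: "\<And>x. 0 \<le> h x"
    and Z [measurable]: "Z \<in> borel_measurable M" and \<eta>: "integrable M \<eta>"
    and X: "AE \<omega> in M. X \<omega> = \<phi> (Z \<omega>) + h (Z \<omega>) * \<eta> \<omega>"
    and ind: "\<And>a. a \<in> borel_measurable borel \<Longrightarrow> indep_var borel (\<lambda>\<omega>. a (Z \<omega>) :: real) borel \<eta>"
  shows "AE \<omega> in M. h (Z \<omega>) * (LINT \<omega>|M. \<eta> \<omega>) = 0"
proof (cases "(LINT \<omega>|M. \<eta> \<omega>) = 0")
  case False
  have Xi: "integrable M X" and [measurable]: "\<phi> \<in> borel_measurable borel"
    and ce: "AE \<omega> in M. real_cond_exp M (rv_sigma M Z) X \<omega> = \<phi> (Z \<omega>)"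
    using cm by (auto simp: cond_mean_fun_def)
  have [measurable]: "X \<in> borel_measurable M" "\<eta> \<in> borel_measurable M"
    using Xi \<eta> by (auto dest: borel_measurable_integrable)
  have Zr: "Z \<in> borel_measurable (rv_sigma M Z)"
    unfolding rv_sigma_def by (rule measurable_vimage_algebra1) simp
  have "sets (rv_sigma M Z) \<subseteq> sets M"
    using measurable_sets[OF Z] unfolding rv_sigma_def sets_vimage_algebra
    by (intro sets.sigma_sets_subset) auto
  then have "subalgebra M (rv_sigma M Z)"
    by (simp add: subalgebra_def rv_sigma_def)
  then interpret sub: finite_measure_subalgebra M "rv_sigma M Z"
    by unfold_locales
  have "AE \<omega> in M. h (Z \<omega>) \<le> real n \<longrightarrow> h (Z \<omega>) = 0" for n
  proof -
    define w where "w = (\<lambda>x. indicator {x. h x \<le> real n} x :: real)"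
    have wm [measurable]: "w \<in> borel_measurable borel" unfolding w_def by measurable
    have wh [measurable]: "(\<lambda>x. w x * h x) \<in> borel_measurable borel" by measurable
    have wXi: "integrable M (\<lambda>\<omega>. w (Z \<omega>) * X \<omega>)"
      using Xi by (rule Bochner_Integration.integrable_bound) (auto simp: w_def indicator_def)
    have wr: "(\<lambda>\<omega>. w (Z \<omega>)) \<in> borel_measurable (rv_sigma M Z)"
      using Zr wm by (rule measurable_compose)
    note c = sub.real_cond_exp_intg[OF wXi wr, simplified]
    have ae: "AE \<omega> in M. w (Z \<omega>) * real_cond_exp M (rv_sigma M Z) X \<omega> = w (Z \<omega>) * \<phi> (Z \<omega>)"
      using ce by eventually_elim simp
    have "(\<lambda>\<omega>. real_cond_exp M (rv_sigma M Z) X \<omega>) \<in> borel_measurable M"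
      using borel_measurable_cond_exp2 by simp
    note [measurable] = this
    have w\<phi>i: "integrable M (\<lambda>\<omega>. w (Z \<omega>) * \<phi> (Z \<omega>))"
      using c(1) ae by (subst (asm) integrable_cong_AE) auto
    have w\<phi>: "(LINT \<omega>|M. w (Z \<omega>) * \<phi> (Z \<omega>)) = (LINT \<omega>|M. w (Z \<omega>) * X \<omega>)"
      unfolding c(2)[symmetric] using ae by (intro integral_cong_AE) auto
    have whi: "integrable M (\<lambda>\<omega>. w (Z \<omega>) * h (Z \<omega>))"
      by (rule integrable_const_bound[of _ "real n"]) (use h0 in \<open>auto simp: w_def indicator_def\<close>)
    have "(LINT \<omega>|M. w (Z \<omega>) * h (Z \<omega>)) * (LINT \<omega>|M. \<eta> \<omega>) = (LINT \<omega>|M. (w (Z \<omega>) * h (Z \<omega>)) * \<eta> \<omega>)"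
      using indep_var_lebesgue_integral[OF ind[OF wh] whi \<eta>] by simp
    also have "\<dots> = (LINT \<omega>|M. w (Z \<omega>) * X \<omega> - w (Z \<omega>) * \<phi> (Z \<omega>))"
      using X by (intro integral_cong_AE) (auto elim!: eventually_mono simp: algebra_simps)
    also have "\<dots> = 0" using wXi w\<phi>i w\<phi> by simp
    finally have "(LINT \<omega>|M. w (Z \<omega>) * h (Z \<omega>)) = 0" using False by simp
    then have "AE \<omega> in M. w (Z \<omega>) * h (Z \<omega>) = 0"
      using whi h0 by (subst (asm) integral_nonneg_eq_0_iff_AE) (auto simp: w_def)
    then show ?thesis by eventually_elim (auto simp: w_def indicator_def)
  qed
  then have "AE \<omega> in M. \<forall>n. h (Z \<omega>) \<le> real n \<longrightarrow> h (Z \<omega>) = 0"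
    by (subst AE_all_countable) blast
  then show ?thesis
  proof eventually_elim
    case (elim \<omega>)
    then show ?case using real_arch_simple[of "h (Z \<omega>)"] by auto
  qed
qed simp

lemma stationary_process_integral:
  fixes \<eta> :: "int \<Rightarrow> 'w \<Rightarrow> real"
  assumes st: "stationary_process M \<eta>" and g [measurable]: "g \<in> borel_measurable borel"
  shows "(LINT \<omega>|M. g (\<eta> t \<omega>)) = (\<integral>\<omega>. g (\<eta> 0 \<omega>) \<partial>M :: real)"
proof -
  have m: "\<And>t. \<eta> t \<in> borel_measurable M"
    and d: "\<And>J k. finite J \<Longrightarrow> distr M (PiM J (\<lambda>_. borel)) (\<lambda>\<omega>. \<lambda>t\<in>J. \<eta> (t + k) \<omega>) =
        distr M (PiM J (\<lambda>_. borel)) (\<lambda>\<omega>. \<lambda>t\<in>J. \<eta> t \<omega>)"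
    using st by (auto simp: stationary_process_def)
  have mr: "(\<lambda>\<omega>. \<lambda>t\<in>{0::int}. \<eta> (t + k) \<omega>) \<in> M \<rightarrow>\<^sub>M PiM {0} (\<lambda>_. borel)" for k
    using m by (intro measurable_restrict) auto
  have gm: "(\<lambda>x. g (x 0)) \<in> borel_measurable (PiM {0::int} (\<lambda>_. borel))"
    by measurable
  have "(LINT \<omega>|M. g (\<eta> t \<omega>)) = (\<integral>x. g (x 0) \<partial>distr M (PiM {0::int} (\<lambda>_. borel)) (\<lambda>\<omega>. \<lambda>i\<in>{0}. \<eta> (i + t) \<omega>))"
    using integral_distr[OF mr gm, of t] by simp
  also have "\<dots> = (\<integral>x. g (x 0) \<partial>distr M (PiM {0::int} (\<lambda>_. borel)) (\<lambda>\<omega>. \<lambda>i\<in>{0}. \<eta> (i + 0) \<omega>))"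
    using d[of "{0}" t] by simp
  also have "\<dots> = (LINT \<omega>|M. g (\<eta> 0 \<omega>))"
    using integral_distr[OF mr gm, of 0] by simp
  finally show ?thesis .
qed

section \<open>The kernel regression estimator\<close>

text \<open>Outside the event that the denominator \<open>G\<close> deviates from its limit \<open>y\<close> by \<open>y / 2\<close> or more, the ratio is at most \<open>2 |N| / y\<close>. Both this event and large values of \<open>|N|\<close> are controlled by Markov's inequality.\<close>

lemma (in prob_space) bigO_P_square_ratio:
  fixes H G N :: "nat \<Rightarrow> 'a \<Rightarrow> real"
  assumes y: "0 < y" and C: "0 \<le> C1" "0 \<le> C2"
    and ev: "\<forall>\<^sub>F T in sequentially. 0 < R T \<and>
      integrable M (\<lambda>\<omega>. G T \<omega> - y) \<and> (LINT \<omega>|M. \<bar>G T \<omega> - y\<bar>) \<le> C1 * sqrt (R T) \<and>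
      integrable M (N T) \<and> (LINT \<omega>|M. \<bar>N T \<omega>\<bar>) \<le> C2 * sqrt (R T) \<and>
      (AE \<omega> in M. G T \<omega> \<noteq> 0 \<longrightarrow> H T \<omega> = N T \<omega> / G T \<omega>)"
    and R: "R \<longlonglongrightarrow> 0"
  shows "bigO_P M (\<lambda>T \<omega>. \<bar>H T \<omega>\<bar>\<^sup>2) R"
  unfolding bigO_P_def
proof (intro allI impI)
  fix \<epsilon> :: real assume \<epsilon>: "0 < \<epsilon>"
  \<comment> \<open>Each of the two events is to have probability at most \<open>\<epsilon> / 2\<close>.\<close>
  define a where "a = 2 * (C2 + 1) / \<epsilon>"
  have a: "0 < a" using C \<epsilon> by (simp add: a_def)
  define C where "C = (2 * a / y)\<^sup>2"
  have C0: "0 < C" using a y by (simp add: C_def)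
  have lim: "(\<lambda>T. C1 * sqrt (R T) / (y / 2)) \<longlonglongrightarrow> C1 * sqrt 0 / (y / 2)"
    using y by (intro tendsto_intros R) auto
  then have "(\<lambda>T. C1 * sqrt (R T) / (y / 2)) \<longlonglongrightarrow> 0" by simp
  then have "\<forall>\<^sub>F T in sequentially. C1 * sqrt (R T) / (y / 2) < \<epsilon> / 2"
    by (rule order_tendstoD) (use \<epsilon> in auto)
  with ev have "\<forall>\<^sub>F T in sequentially. measure M {\<omega> \<in> space M. \<bar>\<bar>H T \<omega>\<bar>\<^sup>2\<bar> > C * R T} < \<epsilon>"
  proof eventually_elim
    case (elim T)
    then have RT: "0 < R T" and Gi: "integrable M (\<lambda>\<omega>. G T \<omega> - y)"
      and GI: "(LINT \<omega>|M. \<bar>G T \<omega> - y\<bar>) \<le> C1 * sqrt (R T)"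
      and Ni: "integrable M (N T)" and NI: "(LINT \<omega>|M. \<bar>N T \<omega>\<bar>) \<le> C2 * sqrt (R T)"
      and H: "AE \<omega> in M. G T \<omega> \<noteq> 0 \<longrightarrow> H T \<omega> = N T \<omega> / G T \<omega>"
      and small: "C1 * sqrt (R T) / (y / 2) < \<epsilon> / 2" by auto
    let ?A = "{\<omega> \<in> space M. \<bar>G T \<omega> - y\<bar> \<ge> y / 2}" and ?B = "{\<omega> \<in> space M. \<bar>N T \<omega>\<bar> \<ge> a * sqrt (R T)}"
    have [measurable]: "(\<lambda>\<omega>. G T \<omega> - y) \<in> borel_measurable M" "N T \<in> borel_measurable M"
      using Gi Ni by (auto dest: borel_measurable_integrable)
    have A: "?A \<in> sets M" and B: "?B \<in> sets M" by measurable
    have "measure M {\<omega> \<in> space M. \<bar>\<bar>H T \<omega>\<bar>\<^sup>2\<bar> > C * R T} \<le> measure M (?A \<union> ?B)"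
    proof (rule finite_measure_mono_AE)
      show "AE \<omega> in M. \<omega> \<in> {\<omega> \<in> space M. \<bar>\<bar>H T \<omega>\<bar>\<^sup>2\<bar> > C * R T} \<longrightarrow> \<omega> \<in> ?A \<union> ?B"
        using H
      proof eventually_elim
        case (elim \<omega>)
        show ?case
        proof (rule impI, rule ccontr)
          assume \<omega>: "\<omega> \<in> {\<omega> \<in> space M. \<bar>\<bar>H T \<omega>\<bar>\<^sup>2\<bar> > C * R T}" and n: "\<omega> \<notin> ?A \<union> ?B"
          from n \<omega> have G: "\<bar>G T \<omega> - y\<bar> < y / 2" and N: "\<bar>N T \<omega>\<bar> < a * sqrt (R T)" by auto
          have G2: "G T \<omega> > y / 2" using G by linarith
          then have "\<bar>H T \<omega>\<bar> = \<bar>N T \<omega>\<bar> / G T \<omega>" using elim y by auto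
          also have "\<dots> \<le> (a * sqrt (R T)) / (y / 2)"
            using G2 N y by (intro frac_le) auto
          finally have "\<bar>H T \<omega>\<bar>\<^sup>2 \<le> ((a * sqrt (R T)) / (y / 2))\<^sup>2" by (intro power_mono) auto
          also have "\<dots> = C * R T"
            using RT y by (simp add: C_def power_divide power_mult_distrib)
          finally show False using \<omega> by simp
        qed
      qed
    qed (use A B in auto)
    also have "\<dots> \<le> measure M ?A + measure M ?B" using A B by (rule measure_Un_le)
    also have "measure M ?A \<le> (LINT \<omega>|M. \<bar>G T \<omega> - y\<bar>) / (y / 2)"
      using Gi y by (intro integral_Markov_inequality_measure[of _ _ "space M"]) auto
    also have "\<dots> \<le> C1 * sqrt (R T) / (y / 2)"
      using GI y by (intro divide_right_mono) auto
    also have "\<dots> < \<epsilon> / 2" by (rule small)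
    also have "measure M ?B \<le> (LINT \<omega>|M. \<bar>N T \<omega>\<bar>) / (a * sqrt (R T))"
      using Ni a RT by (intro integral_Markov_inequality_measure[of _ _ "space M"]) auto
    also have "\<dots> \<le> C2 * sqrt (R T) / (a * sqrt (R T))"
      using NI a RT by (intro divide_right_mono) auto
    also have "\<dots> = C2 / a" using RT by simp
    also have "\<dots> \<le> \<epsilon> / 2" using C \<epsilon> by (simp add: a_def field_simps)
    finally show ?case by simp
  qed
  then show "\<exists>C>0. \<forall>\<^sub>F T in sequentially. measure M {\<omega> \<in> space M. \<bar>\<bar>H T \<omega>\<bar>\<^sup>2\<bar> > C * R T} < \<epsilon>"
    using C0 by blast
qed

theorem theorem4p1:
  fixes M :: "'w measure"
    and X \<eta> :: "int \<Rightarrow> 'w \<Rightarrow> real"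
    and Z :: "int \<Rightarrow> 'w \<Rightarrow> real ^ 'd"
    and \<phi> h f g K :: "real ^ 'd \<Rightarrow> real"
    and f2 m2 g2 F G :: "int \<Rightarrow> int \<Rightarrow> (real ^ 'd) \<times> (real ^ 'd) \<Rightarrow> real"
    and u v p q p\<^sub>F p\<^sub>G q\<^sub>F q\<^sub>G q\<^sub>F\<^sub>G s \<Delta> \<rho> c S\<^sub>K :: real
    and r :: nat
    and D :: "(real ^ 'd) set"
    and b R :: "nat \<Rightarrow> real"
  assumes "prob_space M"
    and "stationary_process M (\<lambda>t \<omega>. (X t \<omega>, Z t \<omega>))"
    and "\<phi> \<in> borel_measurable borel" and "h \<in> borel_measurable borel" and "\<And>x. 0 \<le> h x"
    and "\<And>t. \<eta> t \<in> borel_measurable M"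
    and "\<And>t. AE \<omega> in M. X t \<omega> = \<phi> (Z t \<omega>) + h (Z t \<omega>) * \<eta> t \<omega>"
    and "indep_processes M Z \<eta>"
    and "\<And>t. cond_mean_fun M (X t) (Z t) \<phi>"
    and "two_mixing M Z v"
    and "autocov_size M \<eta> u"
    and "\<And>t. has_density M (Z t) f"
    and "g = (\<lambda>x. \<phi> x * f x)"
    (* (i) *)
    and "p > 2"
    and "uniformly_bounded (\<lambda>x. (h x)\<^sup>2 * f x)"
    and "uniformly_bounded (\<lambda>x. \<bar>\<phi> x\<bar> powr p * f x)"
    and "q = 1 - 2 / p"
    (* (ii) *)
    and "\<And>t \<tau>. t \<noteq> \<tau> \<Longrightarrow> has_density M (\<lambda>\<omega>. (Z t \<omega>, Z \<tau> \<omega>)) (f2 t \<tau>)"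
    and "\<And>t \<tau>. t \<noteq> \<tau> \<Longrightarrow>
           cond_mean_fun M (\<lambda>\<omega>. X t \<omega> * X \<tau> \<omega>) (\<lambda>\<omega>. (Z t \<omega>, Z \<tau> \<omega>)) (m2 t \<tau>)"
    and "\<And>t \<tau>. g2 t \<tau> = (\<lambda>x. m2 t \<tau> x * f2 t \<tau> x)"
    and "\<And>t \<tau>. F t \<tau> = (\<lambda>x. f2 t \<tau> x - tensor f f x)"
    and "\<And>t \<tau>. G t \<tau> = (\<lambda>x. g2 t \<tau> x - tensor g g x)"
    and "p\<^sub>F > 2" and "p\<^sub>G > 2"
    and "\<exists>C. \<forall>t \<tau>. t \<noteq> \<tau> \<longrightarrow> in_Lp p\<^sub>F (F t \<tau>) \<and> Lp_norm p\<^sub>F (F t \<tau>) \<le> C"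
    and "\<exists>C. \<forall>t \<tau>. t \<noteq> \<tau> \<longrightarrow> in_Lp p\<^sub>G (G t \<tau>) \<and> Lp_norm p\<^sub>G (G t \<tau>) \<le> C"
    and "q\<^sub>F = 1 - 2 / p\<^sub>F" and "q\<^sub>G = 1 - 2 / p\<^sub>G" and "q\<^sub>F\<^sub>G = min q\<^sub>F q\<^sub>G"
    (* (iii) *)
    and "multiplicative_kernel r S\<^sub>K K"
    and "in_Lp 1 K" and "in_Lp p K"
    (* (iv); D = UNIV is the hypothesis verbatim, but no probability density satisfies it *)
    and "\<Delta> > 0" and "s > 0"
    and "g \<in> smooth_class s \<Delta>" and "f \<in> smooth_class s \<Delta>"
    and "c > 0" and "\<And>x. x \<in> D \<Longrightarrow> c \<le> f x"
    and "\<rho> = min (real r) s"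
    (* bandwidths b = b(T), for which the asserted bound R(T) is a rate of convergence *)
    and "\<And>T. b T > 0"
    and "\<And>T. R T =
           b T powr (2 * \<rho>)
           + b T powr (- real CARD('d)) * real T powr (- min u 1)
           + b T powr (- (real CARD('d) * (1 + q + q\<^sub>F\<^sub>G * (1 - max (q * v) 1))))
               * real T powr (- min (q * v) 1)"
    and "R \<longlonglongrightarrow> 0"
  shows "\<forall>z\<in>D. bigO_P M (\<lambda>T \<omega>. \<bar>phi_hat K X Z (b T) T z \<omega> - \<phi> z\<bar>\<^sup>2) R"
proof
  fix z assume z: "z \<in> D"
  interpret prob_space M by (rule assms(1))
  interpret mixing_kernel_sample M Z f K f2 F p q p\<^sub>F q\<^sub>F v S\<^sub>K r
    by (intro mixing_kernel_sample.intro mixing_kernel_sample_axioms.intro assms)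
  have fz: "0 < f z" using assms(37) assms(38)[OF z] by linarith
  have r: "1 \<le> r" by (rule multiplicative_kernel_order_pos[OF assms(30)])
  have \<rho>: "0 < \<rho>" "\<rho> \<le> real r" using r assms(34) by (auto simp: assms(39))
  note [measurable] = assms(3,4,6)
  from smooth_class_integrable_imp_bounded[OF assms(36,34,33) f_integrable]
  obtain Bf where Bf: "\<bar>f x\<bar> \<le> Bf" for x by (elim exE) blast
  from assms(15) obtain Ch where Ch: "\<bar>(h x)\<^sup>2 * f x\<bar> \<le> Ch" for x
    unfolding uniformly_bounded_def by (elim exE) blast
  from assms(16) obtain C\<phi> where C\<phi>: "\<bar>\<bar>\<phi> x\<bar> powr p * f x\<bar> \<le> C\<phi>" for x
    unfolding uniformly_bounded_def by (elim exE) blast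
  have fB: "f x \<le> Bf" for x using Bf[of x] by simp
  have Ch0: "0 \<le> Ch" using Ch[of 0] by simp
  have C\<phi>0: "0 \<le> C\<phi>" using C\<phi>[of 0] by simp
  \<comment> \<open>A bound on a higher power gives bounds on \<open>\<phi>\<close> and \<open>h\<close> themselves, up to an additive constant; together with the bound on \<open>f\<close> this bounds \<open>\<phi> * f\<close> and \<open>h * f\<close> everywhere.\<close>
  have \<phi>_le: "\<bar>\<phi> x\<bar> \<le> 1 + \<bar>\<phi> x\<bar> powr p" for x
    using powr_le_add_powr[of "\<bar>\<phi> x\<bar>" 0 1 p] assms(14) by (cases "\<phi> x = 0") auto
  have h_le: "\<bar>h x\<bar> \<le> 1 + (h x)\<^sup>2" for x
    using sum_squares_bound[of 1 "\<bar>h x\<bar>"] by simp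
  have \<phi>f: "\<bar>\<phi> x * f x\<bar> \<le> Bf + C\<phi>" for x
  proof -
    have "\<bar>\<phi> x * f x\<bar> \<le> (1 + \<bar>\<phi> x\<bar> powr p) * f x"
      using mult_right_mono[OF \<phi>_le f_nonneg, of x x] f_nonneg[of x] by (simp add: abs_mult)
    also have "\<dots> \<le> Bf + C\<phi>"
      using fB[of x] C\<phi>[of x] f_nonneg[of x] by (simp add: distrib_right)
    finally show ?thesis .
  qed
  have hf: "\<bar>h x * f x\<bar> \<le> Bf + Ch" for x
  proof -
    have "\<bar>h x * f x\<bar> \<le> (1 + (h x)\<^sup>2) * f x"
      using mult_right_mono[OF h_le f_nonneg, of x x] f_nonneg[of x] by (simp add: abs_mult)
    also have "\<dots> \<le> Bf + Ch"
      using fB[of x] Ch[of x] f_nonneg[of x] by (simp add: distrib_right)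
    finally show ?thesis .
  qed
  have "isCont f z" by (rule smooth_class_isCont[OF assms(36,34)])
  then obtain \<delta> where \<delta>: "\<delta> > 0" and f_near: "norm (x - z) < \<delta> \<Longrightarrow> f z / 2 \<le> f x" for x
  proof -
    assume "isCont f z"
    have half: "0 < f z / 2" using fz by simp
    have "\<exists>d>0. \<forall>x. dist x z < d \<longrightarrow> dist (f x) (f z) < f z / 2"
      by (rule \<open>isCont f z\<close>[unfolded continuous_at_eps_delta, rule_format, OF half])
    then obtain d where d: "d > 0" "\<And>x. dist x z < d \<Longrightarrow> dist (f x) (f z) < f z / 2" by (elim exE conjE) simp
    show thesis
    proof (rule that[OF d(1)])
      fix x assume "norm (x - z) < d"
      then have "\<bar>f x - f z\<bar> < f z / 2" using d(2)[of x] by (simp add: dist_norm)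
      then show "f z / 2 \<le> f x" unfolding abs_less_iff by linarith
    qed
  qed
  have A\<phi>: "\<bar>\<phi> x\<bar> \<le> 1 + C\<phi> / (f z / 2)" if x: "norm (x - z) < \<delta>" for x
  proof -
    have "\<bar>\<phi> x\<bar> powr p * (f z / 2) \<le> \<bar>\<phi> x\<bar> powr p * f x"
      using f_near[OF x] by (intro mult_left_mono) auto
    also have "\<dots> \<le> C\<phi>" using C\<phi>[of x] by simp
    finally have "\<bar>\<phi> x\<bar> powr p \<le> C\<phi> / (f z / 2)" using fz by (simp add: pos_le_divide_eq)
    then show ?thesis using \<phi>_le[of x] by linarith
  qed
  have Ah: "\<bar>h x\<bar> \<le> 1 + Ch / (f z / 2)" if x: "norm (x - z) < \<delta>" for x
  proof -
    have "(h x)\<^sup>2 * (f z / 2) \<le> (h x)\<^sup>2 * f x"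
      using f_near[OF x] by (intro mult_left_mono) auto
    also have "\<dots> \<le> Ch" using Ch[of x] by simp
    finally have "(h x)\<^sup>2 \<le> Ch / (f z / 2)" using fz by (simp add: pos_le_divide_eq)
    then show ?thesis using h_le[of x] by linarith
  qed
  have A\<phi>0: "0 < 1 + C\<phi> / (f z / 2)" and Ah0: "0 < 1 + Ch / (f z / 2)"
    using C\<phi>0 Ch0 fz by (auto intro!: add_pos_nonneg)
  have q': "0 \<le> q\<^sub>F\<^sub>G" "q\<^sub>F\<^sub>G \<le> q\<^sub>F" using assms(23,24) by (auto simp: assms(27,28,29))

  have st: "stationary_process M \<eta>" and \<eta>2: "integrable M (\<lambda>\<omega>. (\<eta> t \<omega>)\<^sup>2)" for t
    using assms(11) by (auto simp: autocov_size_def)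
  from assms(11) obtain C\<eta> where C\<eta>: "\<forall>t \<tau>. t \<noteq> \<tau> \<longrightarrow> \<bar>covar M (\<eta> t) (\<eta> \<tau>)\<bar> \<le> C\<eta> * real_of_int \<bar>t - \<tau>\<bar> powr (- u)"
    unfolding autocov_size_def by (elim conjE exE)
  have \<eta>i: "integrable M (\<eta> t)" for t by (rule square_integrable_imp_integrable[OF assms(6) \<eta>2])
  define m where "m = (LINT \<omega>|M. \<eta> 0 \<omega>)"
  define e where "e = (\<lambda>t \<omega>. \<eta> t \<omega> - m)"
  have \<eta>m: "(LINT \<omega>|M. \<eta> t \<omega>) = m" for t
    unfolding m_def using stationary_process_integral[OF st, of "\<lambda>x. x" t] by simp
  have em: "e t \<in> borel_measurable M" for t unfolding e_def by measurable
  have e2: "integrable M (\<lambda>\<omega>. (e t \<omega>)\<^sup>2)" for t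
    using \<eta>2[of t] \<eta>i[of t] by (simp add: e_def power2_diff)
  have e_var: "(LINT \<omega>|M. (e t \<omega>)\<^sup>2) \<le> (LINT \<omega>|M. (e 0 \<omega>)\<^sup>2)" for t
    using stationary_process_integral[OF st, of "\<lambda>x. (x - m)\<^sup>2" t] by (simp add: e_def)
  have e_cov: "\<bar>\<integral>\<omega>. e t \<omega> * e \<tau> \<omega> \<partial>M\<bar> \<le> C\<eta> * real_of_int \<bar>t - \<tau>\<bar> powr (- u)" if "t \<noteq> \<tau>" for t \<tau>
    using C\<eta>[rule_format, OF that] by (simp only: covar_def \<eta>m e_def)
  note ind = indep_processes_imp_indep_var[OF assms(8) Z_measurable assms(6)]
  have e_ind: "indep_var borel (\<lambda>\<omega>. a (Z t \<omega>, Z \<tau> \<omega>) :: real) borel (\<lambda>\<omega>. k (e t \<omega>, e \<tau> \<omega>) :: real)"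
    if [measurable]: "a \<in> borel_measurable borel" "k \<in> borel_measurable borel" for t \<tau> a k
  proof -
    have "(\<lambda>x. k (fst x - m, snd x - m)) \<in> borel_measurable borel" by measurable
    from ind[OF that(1) this, of t \<tau>] show ?thesis by (simp add: e_def)
  qed
  have h_mean: "AE \<omega> in M. h (Z t \<omega>) * m = 0" for t
  proof -
    have "indep_var borel (\<lambda>\<omega>. a (Z t \<omega>) :: real) borel (\<eta> t)" if [measurable]: "a \<in> borel_measurable borel" for a
    proof -
      have "(\<lambda>x::(real^'d) \<times> (real^'d). a (fst x)) \<in> borel_measurable borel"
        and "(\<lambda>x::real \<times> real. fst x) \<in> borel_measurable borel" by measurable
      from ind[OF this, of t t] show ?thesis by simp
    qed
    from scale_times_noise_mean_eq_0[OF assms(9) assms(4,5) Z_measurable \<eta>i assms(7) this]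
    show ?thesis by (simp add: \<eta>m)
  qed
  have X_eq: "AE \<omega> in M. X t \<omega> = \<phi> (Z t \<omega>) + h (Z t \<omega>) * e t \<omega>" for t
    using h_mean[of t] assms(7)[of t] by eventually_elim (simp add: e_def right_diff_distrib)

  have f1: "\<bar>1 * f x\<bar> \<le> Bf" for x using Bf[of x] by simp
  have f_smooth: "(\<lambda>x. 1 * f x) \<in> smooth_class s \<Delta>" using assms(36) by simp
  have g_smooth: "(\<lambda>x. \<phi> x * f x) \<in> smooth_class s \<Delta>" using assms(35) by (simp add: assms(13))
  have one: "(0::real) < 1" "\<And>x. norm (x - z) < \<delta> \<Longrightarrow> \<bar>1::real\<bar> \<le> 1" by auto
  let ?rate = "\<lambda>b T R. rate_bound (real CARD('d)) \<rho> q q\<^sub>F\<^sub>G (q * v) u b T R"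
  let ?f = "\<lambda>b T \<omega>. f_hat K Z b T z \<omega> - f z"
  let ?g = "\<lambda>b T \<omega>. (\<Sum>t=1..T. \<phi> (Z (int t) \<omega>) * scaled_kernel K b (Z (int t) \<omega> - z)) / real T - \<phi> z * f z"
  let ?n = "\<lambda>b T \<omega>. (\<Sum>t=1..T. h (Z (int t) \<omega>) * e (int t) \<omega> * scaled_kernel K b (Z (int t) \<omega> - z)) / real T"
  have one_m: "(\<lambda>_::real^'d. 1::real) \<in> borel_measurable borel" by simp
  have "L1_rate \<rho> q\<^sub>F\<^sub>G u ?f"
    using kernel_mean_L1_rate[where z = z and u = u, OF one_m \<delta> one f1 fB f_smooth assms(34,33,39) q']
    by (simp add: f_hat_def)
  then obtain C1 where C1: "C1 \<ge> 0" and L1: "\<And>b T R. ?rate b T R \<Longrightarrow>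
      integrable M (?f b T) \<and> (LINT \<omega>|M. \<bar>?f b T \<omega>\<bar>) \<le> C1 * sqrt R"
    unfolding L1_rate_def by (elim exE conjE) simp
  have "L1_rate \<rho> q\<^sub>F\<^sub>G u ?g"
    by (rule kernel_mean_L1_rate[where z = z and u = u, OF assms(3) \<delta> A\<phi>0 A\<phi> \<phi>f fB g_smooth assms(34,33,39) q'])
  then obtain C2 where C2: "C2 \<ge> 0" and L2: "\<And>b T R. ?rate b T R \<Longrightarrow>
      integrable M (?g b T) \<and> (LINT \<omega>|M. \<bar>?g b T \<omega>\<bar>) \<le> C2 * sqrt R"
    unfolding L1_rate_def by (elim exE conjE) simp
  have "L1_rate \<rho> q\<^sub>F\<^sub>G u ?n"
    by (rule kernel_noise_L1_rate[where z = z, OF assms(4) \<delta> Ah0 Ah hf fB em e2 e_var e_cov e_ind \<rho>])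
  then obtain C3 where C3: "C3 \<ge> 0" and L3: "\<And>b T R. ?rate b T R \<Longrightarrow>
      integrable M (?n b T) \<and> (LINT \<omega>|M. \<bar>?n b T \<omega>\<bar>) \<le> C3 * sqrt R"
    unfolding L1_rate_def by (elim exE conjE) simp

  \<comment> \<open>Since \<open>b powr (2 * \<rho>) \<le> R\<close> and \<open>R\<close> tends to \<open>0\<close>, the bandwidth is eventually below \<open>1\<close>.\<close>
  have rate: "\<forall>\<^sub>F T in sequentially. ?rate (b T) T (R T)"
    using eventually_ge_at_top[of 1] order_tendstoD(2)[OF assms(42), of 1, simplified]
  proof eventually_elim
    case (elim T)
    have "b T powr (2 * \<rho>) \<le> R T" unfolding assms(41)[of T] by simp
    then have "b T powr (2 * \<rho>) < 1" using elim by simp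
    then have "b T \<le> 1"
      using \<rho> ge_one_powr_ge_zero[of "b T" "2 * \<rho>"] by (cases "b T \<le> 1") auto
    then show ?case
      using elim assms(40)[of T] unfolding rate_bound_def assms(41)[of T] by simp
  qed
  let ?N = "\<lambda>T \<omega>. ?g (b T) T \<omega> + ?n (b T) T \<omega> - \<phi> z * ?f (b T) T \<omega>"
  show "bigO_P M (\<lambda>T \<omega>. \<bar>phi_hat K X Z (b T) T z \<omega> - \<phi> z\<bar>\<^sup>2) R"
  proof (rule bigO_P_square_ratio[OF fz C1 _ _ assms(42)])
    show "0 \<le> C2 + C3 + \<bar>\<phi> z\<bar> * C1" using C1 C2 C3 by simp
    show "\<forall>\<^sub>F T in sequentially. 0 < R T \<and>
      integrable M (?f (b T) T) \<and> (LINT \<omega>|M. \<bar>?f (b T) T \<omega>\<bar>) \<le> C1 * sqrt (R T) \<and>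
      integrable M (?N T) \<and> (LINT \<omega>|M. \<bar>?N T \<omega>\<bar>) \<le> (C2 + C3 + \<bar>\<phi> z\<bar> * C1) * sqrt (R T) \<and>
      (AE \<omega> in M. f_hat K Z (b T) T z \<omega> \<noteq> 0 \<longrightarrow>
        phi_hat K X Z (b T) T z \<omega> - \<phi> z = ?N T \<omega> / f_hat K Z (b T) T z \<omega>)"
      using rate
    proof eventually_elim
      case (elim T)
      note l1 = L1[OF elim] and l2 = L2[OF elim] and l3 = L3[OF elim]
      have gi: "integrable M (?g (b T) T)" and ni: "integrable M (?n (b T) T)" and fi: "integrable M (?f (b T) T)"
        using l1 l2 l3 by blast+
      have pf: "integrable M (\<lambda>\<omega>. \<phi> z * ?f (b T) T \<omega>)" using fi by (rule integrable_mult_right)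
      have "0 < b T powr (2 * \<rho>)" using assms(40)[of T] by simp
      also have "\<dots> \<le> R T" using elim by (simp add: rate_bound_def)
      finally have R0: "0 < R T" .
      have Ni: "integrable M (?N T)"
        by (rule Bochner_Integration.integrable_diff[OF Bochner_Integration.integrable_add[OF gi ni] pf])
      have "(LINT \<omega>|M. \<bar>?N T \<omega>\<bar>) \<le> (LINT \<omega>|M. (\<bar>?g (b T) T \<omega>\<bar> + \<bar>?n (b T) T \<omega>\<bar>) + \<bar>\<phi> z\<bar> * \<bar>?f (b T) T \<omega>\<bar>)"
      proof (rule integral_mono[OF integrable_abs[OF Ni]])
        show "integrable M (\<lambda>\<omega>. (\<bar>?g (b T) T \<omega>\<bar> + \<bar>?n (b T) T \<omega>\<bar>) + \<bar>\<phi> z\<bar> * \<bar>?f (b T) T \<omega>\<bar>)"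
          by (intro Bochner_Integration.integrable_add integrable_mult_right integrable_abs gi ni fi)
        have tri: "\<bar>x + y - w\<bar> \<le> (\<bar>x\<bar> + \<bar>y\<bar>) + \<bar>w\<bar>" for x y w :: real by linarith
        show "\<bar>?N T \<omega>\<bar> \<le> (\<bar>?g (b T) T \<omega>\<bar> + \<bar>?n (b T) T \<omega>\<bar>) + \<bar>\<phi> z\<bar> * \<bar>?f (b T) T \<omega>\<bar>" for \<omega>
          unfolding abs_mult[symmetric] by (rule tri)
      qed
      also have "\<dots> = ((LINT \<omega>|M. \<bar>?g (b T) T \<omega>\<bar>) + (LINT \<omega>|M. \<bar>?n (b T) T \<omega>\<bar>)) + \<bar>\<phi> z\<bar> * (LINT \<omega>|M. \<bar>?f (b T) T \<omega>\<bar>)"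
        using integrable_abs[OF gi] integrable_abs[OF ni] integrable_mult_right[OF integrable_abs[OF fi], of "\<bar>\<phi> z\<bar>"]
        by (simp only: Bochner_Integration.integral_add Bochner_Integration.integrable_add integral_mult_right_zero)
      also have "\<dots> \<le> (C2 * sqrt (R T) + C3 * sqrt (R T)) + \<bar>\<phi> z\<bar> * (C1 * sqrt (R T))"
        using l1 l2 l3 by (intro add_mono mult_left_mono) auto
      also have "\<dots> = (C2 + C3 + \<bar>\<phi> z\<bar> * C1) * sqrt (R T)" by (simp add: distrib_right)
      finally have NI: "(LINT \<omega>|M. \<bar>?N T \<omega>\<bar>) \<le> (C2 + C3 + \<bar>\<phi> z\<bar> * C1) * sqrt (R T)" .
      have "AE \<omega> in M. \<forall>t\<in>{1..T}. X (int t) \<omega> = \<phi> (Z (int t) \<omega>) + h (Z (int t) \<omega>) * e (int t) \<omega>"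
        by (intro AE_finite_allI X_eq) simp
      then have "AE \<omega> in M. f_hat K Z (b T) T z \<omega> \<noteq> 0 \<longrightarrow>
        phi_hat K X Z (b T) T z \<omega> - \<phi> z = ?N T \<omega> / f_hat K Z (b T) T z \<omega>"
      proof eventually_elim
        case (elim \<omega>)
        have "g_hat K X Z (b T) T z \<omega> =
          (\<Sum>t=1..T. \<phi> (Z (int t) \<omega>) * scaled_kernel K (b T) (Z (int t) \<omega> - z)
            + h (Z (int t) \<omega>) * e (int t) \<omega> * scaled_kernel K (b T) (Z (int t) \<omega> - z)) / real T"
          unfolding g_hat_def using elim by (intro arg_cong2[where f="(/)"] sum.cong) (auto simp: distrib_right)
        then have "g_hat K X Z (b T) T z \<omega> = ?g (b T) T \<omega> + ?n (b T) T \<omega> + \<phi> z * f z"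
          by (simp add: sum.distrib add_divide_distrib)
        then have "?N T \<omega> = g_hat K X Z (b T) T z \<omega> - \<phi> z * f_hat K Z (b T) T z \<omega>"
          by (simp add: algebra_simps)
        then show ?case
          by (simp add: phi_hat_def diff_divide_distrib)
      qed
      then show ?case using R0 l1 Ni NI by blast
    qed
  qed
qed

end
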